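(* Let $X$ be a generic $n\times m$ generalized diagonal matrix over a field $k$ such that the ladder $L_1$ is a triangle of size $t_1$ and the ladder $L_2$ is a triangle of size $t_2$. Let $1\le r\le \min(n,m)$, $R=k[X]$, $I=I_r(X)$, and let $\Delta_I$ be the Stanley–Reisner complex of the initial ideal of $I$. Then $\Delta_I$ is pure with $$\dim \Delta_I=\dim R-\mathrm{EN}(n,m,r)+\mathrm{ENS}(t_1,r)+\mathrm{ENS}(t_2,r)-1,$$ and thus $$\mathrm{ht}\, I=\mathrm{EN}(n,m,r)-\mathrm{ENS}(t_1,r)-\mathrm{ENS}(t_2,r).$$
   Context: A generalized diagonal (GD) matrix is an $n\times m$ matrix with two ladders of zeros, $L_1$ (bottom left) and $L_2$ (top right): given positive integers $c_1\ge\dots\ge c_s$ with $s<m$, $c_1<n$, $L_1$ consists of the last $c_i$ entries of column $i$ for $i=1,\dots,s$; given positive integers $d_t\le\dots\le d_m$ with $t>1$, $d_m<n$, $L_2$ consists of the first $d_i$ entries of column $i$ for $i=t,\dots,m$; either ladder may be empty. It is generic if the entries outside $L_1\cup L_2$ are distinct indeterminates $x_{ij}$ over a field $k$; $R=k[X]$ is the polynomial ring in these entries. $L_1$ is a triangle of size $t_1\ge 0$ if $c_1=t_1,\ c_2=t_1-1,\dots,c_{t_1}=1$ (so $L_1$ is the set of positions $(i,j)$ with $i-j\ge n-t_1$); $L_2$ is a triangle of size $t_2\ge 0$ if $d_{m-t_2+1}=1,\ d_{m-t_2+2}=2,\dots,d_m=t_2$ (positions with $j-i\ge m-t_2$). Size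 $0$ means the ladder is empty. $I_r(X)$ is the ideal of $r\times r$ minors of $X$. The monomial order on $R$ is lexicographic with $x_{ij}>x_{kl}$ if $i<k$, or $i=k$ and $j<l$. The initial ideal $\mathrm{in}(I)$ is a square-free monomial ideal. $\Delta_I$ is the simplicial complex with vertices labeled by the non-zero entries of $X$ whose faces are the sets of entries whose product is not in $\mathrm{in}(I)$. Its dimension is the maximal cardinality of a face minus $1$, and pure means that all facets have the same dimension. Define $\mathrm{EN}(n,m,r)=(n-r+1)(m-r+1)$ and $\mathrm{ENS}(t,r)=\binom{t-r+2}{2}$, with the convention $\binom{a}{2}=0$ for all integers $a<2$ (including negative $a$). *)

theory Defs
  imports
    "HOL-Algebra.Ideal"
    "HOL-Library.Poly_Mapping"
    "HOL-Library.Product_Lexorder"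
    "HOL-Library.Extended_Nat"
    "Jordan_Normal_Form.Determinant"
    "Jordan_Normal_Form.DL_Submatrix"
begin

section \<open>Krull dimension and height\<close>

definition prime_chain :: "('a, 'b) ring_scheme \<Rightarrow> nat \<Rightarrow> (nat \<Rightarrow> 'a set) \<Rightarrow> bool" where
  "prime_chain R l P \<longleftrightarrow> (\<forall>i\<le>l. primeideal (P i) R) \<and> (\<forall>i<l. P i \<subset> P (Suc i))"

definition krull_dim :: "('a, 'b) ring_scheme \<Rightarrow> enat" where
  "krull_dim R = Sup {enat l | l. \<exists>P. prime_chain R l P}"

definition prime_height :: "('a, 'b) ring_scheme \<Rightarrow> 'a set \<Rightarrow> enat" where
  "prime_height R Q = Sup {enat l | l. \<exists>P. prime_chain R l P \<and> P l = Q}"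

definition height :: "('a, 'b) ring_scheme \<Rightarrow> 'a set \<Rightarrow> enat" where
  "height R I = Inf {prime_height R Q | Q. primeideal Q R \<and> I \<subseteq> Q}"


section \<open>The polynomial ring in the variables of a set\<close>

text \<open>A monomial is a finitely supported exponent function, a polynomial a finitely supported
  function from monomials to coefficients.\<close>

type_synonym pos = "nat \<times> nat"
type_synonym 'k poly_pos = "(pos \<Rightarrow>\<^sub>0 nat) \<Rightarrow>\<^sub>0 'k"

definition Var :: "pos \<Rightarrow> 'k::field poly_pos" where
  "Var v = Poly_Mapping.single (Poly_Mapping.single v 1) 1"

definition poly_ring :: "pos set \<Rightarrow> 'k::field poly_pos ring" where
  "poly_ring V = \<lparr> carrier = {p. \<forall>a \<in> Poly_Mapping.keys p. Poly_Mapping.keys a \<subseteq> V},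
     monoid.mult = (*), one = 1, zero = 0, add = (+) \<rparr>"

lemma poly_ring_cring: "cring (poly_ring V :: 'k::field poly_pos ring)"
proof (rule cringI)
  let ?R = "poly_ring V :: 'k poly_pos ring"
  show "abelian_group ?R"
  proof (rule abelian_groupI)
    fix x y assume "x \<in> carrier ?R" "y \<in> carrier ?R"
    then show "x \<oplus>\<^bsub>?R\<^esub> y \<in> carrier ?R"
      using Poly_Mapping.keys_add[of x y] by (auto simp: poly_ring_def)
  next
    fix x assume "x \<in> carrier ?R"
    then show "\<exists>y\<in>carrier ?R. y \<oplus>\<^bsub>?R\<^esub> x = \<zero>\<^bsub>?R\<^esub>"
      by (intro bexI[of _ "- x"]) (auto simp: poly_ring_def)
  qed (auto simp: poly_ring_def algebra_simps)
  show "comm_monoid ?R"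
  proof (rule comm_monoidI)
    fix x y assume xy: "x \<in> carrier ?R" "y \<in> carrier ?R"
    show "x \<otimes>\<^bsub>?R\<^esub> y \<in> carrier ?R"
      unfolding poly_ring_def
    proof (simp, intro ballI)
      fix a assume "a \<in> Poly_Mapping.keys (x * y)"
      then obtain b c where bc: "b \<in> Poly_Mapping.keys x" "c \<in> Poly_Mapping.keys y" "a = b + c"
        using Poly_Mapping.keys_mult[of x y] by auto
      then show "Poly_Mapping.keys a \<subseteq> V"
        using xy Poly_Mapping.keys_add[of b c] unfolding poly_ring_def partial_object.simps by blast
    qed
  qed (auto simp: poly_ring_def algebra_simps)
qed (auto simp: poly_ring_def algebra_simps)


section \<open>Initial ideals\<close>

text \<open>The library order on \<^typ>\<open>pos \<Rightarrow>\<^sub>0 nat\<close> compares exponents at the least position (in the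
  lexicographic order of positions) where two monomials differ.  It is thus the lexicographic
  monomial order in which the variable at \<open>(i, j)\<close> is bigger than the one at \<open>(k, l)\<close>
  iff \<open>i < k\<close>, or \<open>i = k\<close> and \<open>j < l\<close>.\<close>

lemma monomial_less_iff:
  fixes a b :: "pos \<Rightarrow>\<^sub>0 nat"
  shows "a < b \<longleftrightarrow> (\<exists>i j. Poly_Mapping.lookup a (i, j) < Poly_Mapping.lookup b (i, j) \<and>
    (\<forall>k l. k < i \<or> k = i \<and> l < j \<longrightarrow> Poly_Mapping.lookup a (k, l) = Poly_Mapping.lookup b (k, l)))"
  by (auto simp: less_poly_mapping.rep_eq less_fun_def less_prod_def')

definition initial_monomial :: "'k::field poly_pos \<Rightarrow> 'k poly_pos" where
  "initial_monomial f = Poly_Mapping.single (Max (Poly_Mapping.keys f)) 1"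

definition initial_ideal :: "'k::field poly_pos ring \<Rightarrow> 'k poly_pos set \<Rightarrow> 'k poly_pos set" where
  "initial_ideal R I = genideal R (initial_monomial ` (I - {0}))"


section \<open>Simplicial complexes\<close>

definition facets :: "'v set set \<Rightarrow> 'v set set" where
  "facets \<Delta> = {F \<in> \<Delta>. \<forall>G \<in> \<Delta>. F \<subseteq> G \<longrightarrow> G = F}"

definition face_dim :: "'v set \<Rightarrow> int" where
  "face_dim F = int (card F) - 1"

definition complex_dim :: "'v set set \<Rightarrow> int" where
  "complex_dim \<Delta> = int (Max (card ` \<Delta>)) - 1"

definition pure_complex :: "'v set set \<Rightarrow> bool" where
  "pure_complex \<Delta> \<longleftrightarrow> (\<forall>F \<in> facets \<Delta>. \<forall>G \<in> facets \<Delta>. face_dim F = face_dim G)"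

definition stanley_reisner :: "pos set \<Rightarrow> 'k::field poly_pos set \<Rightarrow> pos set set" where
  "stanley_reisner V I = {F. F \<subseteq> V \<and> (\<Prod>v\<in>F. Var v) \<notin> initial_ideal (poly_ring V) I}"


section \<open>Generalized diagonal matrices\<close>

text \<open>The ladder data: \<open>c j\<close> is used for \<open>1 \<le> j \<le> s\<close> and \<open>d j\<close> for \<open>t \<le> j \<le> m\<close>.  The bottom left
  ladder is empty iff \<open>s = 0\<close>, the top right one iff \<open>t = m + 1\<close>.\<close>

definition gd_ladders ::
  "nat \<Rightarrow> nat \<Rightarrow> nat \<Rightarrow> (nat \<Rightarrow> nat) \<Rightarrow> nat \<Rightarrow> (nat \<Rightarrow> nat) \<Rightarrow> bool" where
  "gd_ladders n m s c t d \<longleftrightarrow>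
     s < m \<and> (\<forall>j\<in>{1..s}. 0 < c j) \<and> antimono_on {1..s} c \<and> (1 \<le> s \<longrightarrow> c 1 < n) \<and>
     1 < t \<and> t \<le> m + 1 \<and> (\<forall>j\<in>{t..m}. 0 < d j) \<and> mono_on {t..m} d \<and> (t \<le> m \<longrightarrow> d m < n)"

definition ladder1 :: "nat \<Rightarrow> nat \<Rightarrow> (nat \<Rightarrow> nat) \<Rightarrow> pos set" where
  "ladder1 n s c = {(i, j). j \<in> {1..s} \<and> i \<in> {1..n} \<and> n < i + c j}"

definition ladder2 :: "nat \<Rightarrow> nat \<Rightarrow> nat \<Rightarrow> (nat \<Rightarrow> nat) \<Rightarrow> pos set" where
  "ladder2 n m t d = {(i, j). j \<in> {t..m} \<and> i \<in> {1..n} \<and> i \<le> d j}"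

definition triangle1 :: "nat \<Rightarrow> nat \<Rightarrow> (nat \<Rightarrow> nat) \<Rightarrow> bool" where
  "triangle1 t1 s c \<longleftrightarrow> s = t1 \<and> (\<forall>k\<in>{1..t1}. c k = t1 + 1 - k)"

definition triangle2 :: "nat \<Rightarrow> nat \<Rightarrow> nat \<Rightarrow> (nat \<Rightarrow> nat) \<Rightarrow> bool" where
  "triangle2 t2 m t d \<longleftrightarrow> t + t2 = m + 1 \<and> (\<forall>k\<in>{1..t2}. d (m - t2 + k) = k)"

lemma ladder1_triangle:
  assumes "gd_ladders n m s c t d" "triangle1 t1 s c"
  shows "ladder1 n s c = {(i, j). i \<in> {1..n} \<and> j \<in> {1..m} \<and> int i - int j \<ge> int n - int t1}"
  using assms by (force simp: ladder1_def triangle1_def gd_ladders_def)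

lemma ladder2_triangle:
  assumes "gd_ladders n m s c t d" "triangle2 t2 m t d"
  shows "ladder2 n m t d = {(i, j). i \<in> {1..n} \<and> j \<in> {1..m} \<and> int j - int i \<ge> int m - int t2}"
proof -
  have t2: "t2 < m" "t = m + 1 - t2"
    using assms by (auto simp: gd_ladders_def triangle2_def)
  have "d j = j + t2 - m" if "j \<in> {t..m}" for j
  proof -
    have "j + t2 - m \<in> {1..t2}" "m - t2 + (j + t2 - m) = j"
      using that t2 by auto
    then show ?thesis
      using assms(2) unfolding triangle2_def by metis
  qed
  then show ?thesis
    using t2 by (force simp: ladder2_def)
qed

definition gd_entries ::
  "nat \<Rightarrow> nat \<Rightarrow> nat \<Rightarrow> (nat \<Rightarrow> nat) \<Rightarrow> nat \<Rightarrow> (nat \<Rightarrow> nat) \<Rightarrow> pos set" where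
  "gd_entries n m s c t d = {1..n} \<times> {1..m} - (ladder1 n s c \<union> ladder2 n m t d)"

text \<open>Positions are numbered from 1, indices of \<^const>\<open>mat\<close> from 0.\<close>

definition generic_gd_matrix ::
  "nat \<Rightarrow> nat \<Rightarrow> nat \<Rightarrow> (nat \<Rightarrow> nat) \<Rightarrow> nat \<Rightarrow> (nat \<Rightarrow> nat) \<Rightarrow> 'k::field poly_pos mat" where
  "generic_gd_matrix n m s c t d = mat n m (\<lambda>(i, j).
     if (i + 1, j + 1) \<in> gd_entries n m s c t d then Var (i + 1, j + 1) else 0)"

definition minors :: "nat \<Rightarrow> 'a::comm_ring_1 mat \<Rightarrow> 'a set" where
  "minors r A = {det (submatrix A I J) | I J.
     I \<subseteq> {..<dim_row A} \<and> J \<subseteq> {..<dim_col A} \<and> card I = r \<and> card J = r}"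

definition determinantal_ideal :: "'k::field poly_pos ring \<Rightarrow> nat \<Rightarrow> 'k poly_pos mat \<Rightarrow> 'k poly_pos set" where
  "determinantal_ideal R r A = genideal R (minors r A)"


section \<open>The numbers EN and ENS\<close>

definition EN :: "nat \<Rightarrow> nat \<Rightarrow> nat \<Rightarrow> int" where
  "EN n m r = (int n - int r + 1) * (int m - int r + 1)"

text \<open>Since \<^const>\<open>nat\<close> sends negative integers to 0, this binomial coefficient vanishes
  whenever its upper argument \<open>t - r + 2\<close> is less than 2.\<close>

definition ENS :: "nat \<Rightarrow> nat \<Rightarrow> int" where
  "ENS t r = int (nat (int t - int r + 2) choose 2)"

end

theory Submission
  imports Defs "HOL-Computational_Algebra.Fraction_Field"
begin

text \<open>Call a sequence of positions a chain if rows and columns both increase strictly. The key fact is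
  that the faces of the complex are the sets of non-zero positions that contain no chain of length
  \<open>r\<close>; everything else is counting and dimension theory.

  Why these are the faces. In the given order the leading monomial of a minor is its diagonal, unless
  the diagonal hits a zero. So the product over a chain of length \<open>r\<close> lies in the initial ideal, and
  faces contain no such chain. For the converse one has to show that no member of \<open>I\<close> has a leading
  monomial supported on a facet \<open>F\<close> of the complex of chain-free sets. This is done without Groebner
  bases: for each polynomial \<open>g\<close> with such a leading monomial there is a matrix over an infinite
  extension field that has rank less than \<open>r\<close> and the prescribed zeros, and at which \<open>g\<close> does not
  vanish (\<open>exists_point\<close>). The matrix is filled from its last entry backwards; entries in \<open>F\<close> are
  chosen very large compared with the later ones, and the remaining entries are forced by the rank
  conditions, which can be met because \<open>F\<close> is maximal.

  Why the complex is pure. Let \<open>F\<close> be maximal without chains of length \<open>r\<close>. Along a diagonal of the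
  matrix the length of the longest chain of \<open>F\<close> to the north-west grows by one exactly at the members
  of \<open>F\<close>. It follows that \<open>F\<close> contains \<open>min (r - 1) L\<close> of the \<open>L\<close> positions of each diagonal
  (\<open>facet_card_diagonal\<close>). Triangles consist of whole diagonals, so the number of non-zero positions
  outside \<open>F\<close> does not depend on \<open>F\<close>: it is the number \<open>h\<close> of non-zero positions \<open>(i, j)\<close> with \<open>i, j \<ge> r\<close>,
  which is \<^const>\<open>EN\<close> minus the two numbers \<^const>\<open>ENS\<close>.

  Dimension theory. The Krull dimension and the height are governed by sets \<open>S\<close> of variables that are
  independent modulo a prime \<open>Q\<close>, in the sense that no non-zero polynomial in \<open>S\<close> lies in \<open>Q\<close>. If \<open>S\<close> is
  independent modulo \<open>Q\<close>, chains of primes ending in \<open>Q\<close> have at most \<open>card V - card S\<close> steps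
  (\<open>prime_chain_length_le\<close>), and if \<open>S\<close> is maximal, some chain has this length (\<open>prime_chain_below\<close>).
  A facet is independent modulo \<open>I\<close>, and therefore modulo some prime over \<open>I\<close>, by the description of
  the faces; so the height is at most \<open>h\<close>. Conversely, modulo \<open>I\<close> every monomial reduces to monomials
  supported on faces, and comparing growth rates shows that a set that is independent modulo \<open>I\<close> is
  not larger than a facet (\<open>indep_card_le\<close>); so every prime over \<open>I\<close> has height at least \<open>h\<close>.\<close>

section \<open>Polynomials as finitely supported functions\<close>

abbreviation mons :: "('a \<Rightarrow>\<^sub>0 'b::zero) \<Rightarrow> 'a set" where
  "mons \<equiv> Poly_Mapping.keys"

abbreviation coef :: "('a \<Rightarrow>\<^sub>0 'b::zero) \<Rightarrow> 'a \<Rightarrow> 'b" where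
  "coef \<equiv> Poly_Mapping.lookup"

abbreviation single :: "'a \<Rightarrow> 'b \<Rightarrow> 'a \<Rightarrow>\<^sub>0 'b::zero" where
  "single \<equiv> Poly_Mapping.single"

abbreviation supp :: "(pos \<Rightarrow>\<^sub>0 nat) \<Rightarrow> pos set" where
  "supp \<equiv> Poly_Mapping.keys"

abbreviation expo :: "(pos \<Rightarrow>\<^sub>0 nat) \<Rightarrow> pos \<Rightarrow> nat" where
  "expo \<equiv> Poly_Mapping.lookup"

lemma supp_add: "supp (a + b) = supp a \<union> supp b"
  by (auto simp: in_keys_iff lookup_add)

lemma coef_times:
  fixes p q :: "'a::monoid_add \<Rightarrow>\<^sub>0 'b::semiring_0"
  shows "coef (p * q) k = (\<Sum>a\<in>mons p. \<Sum>b\<in>mons q. coef p a * coef q b when a + b = k)"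
proof -
  have fin: "finite {l. coef p l * (\<Sum>b. coef q b when k = l + b) \<noteq> 0}"
    by (rule finite_subset[of _ "mons p"]) (auto simp: in_keys_iff)
  have inner: "(\<Sum>b. coef q b when k = l + b) = (\<Sum>b\<in>mons q. coef q b when k = l + b)" for l
    by (rule Sum_any.expand_superset) (auto simp: in_keys_iff)
  have "coef (p * q) k = (\<Sum>l\<in>mons p. coef p l * (\<Sum>b. coef q b when k = l + b))"
    unfolding lookup_mult by (rule Sum_any.expand_superset) (auto simp: in_keys_iff)
  also have "\<dots> = (\<Sum>a\<in>mons p. \<Sum>b\<in>mons q. coef p a * coef q b when a + b = k)"
    unfolding inner sum_distrib_left by (intro sum.cong refl) (auto simp: when_def)
  finally show ?thesis .
qed

text \<open>Addition of monomials is strictly monotone, so only one pair of monomials can have the sum of the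
  upper bounds as its sum.\<close>

lemma coef_times_top:
  fixes p q :: "'a::{ordered_cancel_comm_monoid_add,linorder} \<Rightarrow>\<^sub>0 'b::semiring_0"
  assumes "\<And>a. a \<in> mons p \<Longrightarrow> a \<le> A" "\<And>b. b \<in> mons q \<Longrightarrow> b \<le> B"
  shows "coef (p * q) (A + B) = coef p A * coef q B"
proof -
  have eq: "a = A \<and> b = B" if "a \<in> mons p" "b \<in> mons q" "a + b = A + B" for a b
  proof -
    have "a \<le> A" "b \<le> B" using assms that by auto
    then show ?thesis
      using that(3) add_le_less_mono[of a A b B] add_less_le_mono[of a A b B]
      by (metis add_left_cancel add_right_cancel antisym_conv2 order_less_irrefl)
  qed
  have "coef (p * q) (A + B)
      = (\<Sum>a\<in>mons p. \<Sum>b\<in>mons q. if b = B then (if a = A then coef p A * coef q B else 0) else 0)"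
    unfolding coef_times by (intro sum.cong refl) (use eq in \<open>auto simp: when_def\<close>)
  also have "\<dots> = (\<Sum>a\<in>mons p. if a = A then (if B \<in> mons q then coef p A * coef q B else 0) else 0)"
    by (intro sum.cong refl) auto
  also have "\<dots> = coef p A * coef q B"
    by (auto simp: in_keys_iff)
  finally show ?thesis .
qed

text \<open>The additive extension of a map that is given on terms; ring homomorphisms out of a
  polynomial ring arise in this way from maps that are multiplicative on terms.\<close>

definition lin_ext :: "('a \<Rightarrow> 'b \<Rightarrow> 'c::comm_monoid_add) \<Rightarrow> ('a \<Rightarrow>\<^sub>0 'b::zero) \<Rightarrow> 'c" where
  "lin_ext h p = (\<Sum>a\<in>mons p. h a (coef p a))"

lemma lin_ext_superset:
  assumes "\<And>a. h a 0 = 0" "finite S" "mons p \<subseteq> S"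
  shows "lin_ext h p = (\<Sum>a\<in>S. h a (coef p a))"
  unfolding lin_ext_def using assms by (intro sum.mono_neutral_left) (auto simp: in_keys_iff)

lemma lin_ext_add:
  fixes h :: "'a \<Rightarrow> 'b::comm_monoid_add \<Rightarrow> 'c::comm_monoid_add"
  assumes "\<And>a. h a 0 = 0" "\<And>a x y. h a (x + y) = h a x + h a y"
  shows "lin_ext h (p + q) = lin_ext h p + lin_ext h q"
proof -
  let ?S = "mons p \<union> mons q"
  have "lin_ext h u = (\<Sum>a\<in>?S. h a (coef u a))" if "mons u \<subseteq> ?S" for u
    using assms(1) that by (intro lin_ext_superset) auto
  then show ?thesis
    using keys_add[of p q] by (simp add: lookup_add assms(2) sum.distrib)
qed

lemma lin_ext_sum:
  fixes h :: "'a \<Rightarrow> 'b::comm_monoid_add \<Rightarrow> 'c::comm_monoid_add"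
  assumes "\<And>a. h a 0 = 0" "\<And>a x y. h a (x + y) = h a x + h a y"
  shows "lin_ext h (sum f A) = (\<Sum>i\<in>A. lin_ext h (f i))"
proof (induction A rule: infinite_finite_induct)
  case (insert x F)
  then show ?case using lin_ext_add[of h "f x" "sum f F"] assms by simp
qed (auto simp: lin_ext_def)

lemma lin_ext_single:
  assumes "\<And>a. h a 0 = 0"
  shows "lin_ext h (single a x) = h a x"
  using assms by (auto simp: lin_ext_def)

lemma poly_eq_sum_singles: "p = (\<Sum>a\<in>mons p. single a (coef p a))"
  by (rule poly_mapping_eqI)
     (auto simp: lookup_sum lookup_single when_def in_keys_iff)

lemma lin_ext_mult:
  fixes h :: "'a::monoid_add \<Rightarrow> 'b::semiring_0 \<Rightarrow> 'c::semiring_0"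
  assumes 0: "\<And>a. h a 0 = 0" and add: "\<And>a x y. h a (x + y) = h a x + h a y"
    and mult: "\<And>a b x y. h (a + b) (x * y) = h a x * h b y"
  shows "lin_ext h (p * q) = lin_ext h p * lin_ext h q"
proof -
  have "p * q = (\<Sum>a\<in>mons p. \<Sum>b\<in>mons q. single (a + b) (coef p a * coef q b))"
    by (subst poly_eq_sum_singles[of p], subst poly_eq_sum_singles[of q])
       (simp add: sum_product mult_single)
  then have "lin_ext h (p * q) = (\<Sum>a\<in>mons p. \<Sum>b\<in>mons q. h (a + b) (coef p a * coef q b))"
    by (simp add: lin_ext_sum[of h, OF 0 add] lin_ext_single[of h, OF 0])
  also have "\<dots> = lin_ext h p * lin_ext h q"
    by (simp add: mult lin_ext_def sum_product)
  finally show ?thesis .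
qed

section \<open>Evaluation\<close>

definition mono_eval :: "(pos \<Rightarrow> 'c::comm_monoid_mult) \<Rightarrow> (pos \<Rightarrow>\<^sub>0 nat) \<Rightarrow> 'c" where
  "mono_eval \<xi> a = (\<Prod>v\<in>supp a. \<xi> v ^ expo a v)"

lemma mono_eval_superset:
  assumes "finite S" "supp a \<subseteq> S"
  shows "mono_eval \<xi> a = (\<Prod>v\<in>S. \<xi> v ^ expo a v)"
  unfolding mono_eval_def using assms
  by (intro prod.mono_neutral_left) (auto simp: in_keys_iff)

lemma mono_eval_add: "mono_eval \<xi> (a + b) = mono_eval \<xi> a * mono_eval \<xi> b"
proof -
  let ?S = "supp a \<union> supp b"
  have "mono_eval \<xi> c = (\<Prod>v\<in>?S. \<xi> v ^ expo c v)" if "supp c \<subseteq> ?S" for c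
    using that by (intro mono_eval_superset) auto
  then show ?thesis
    by (simp add: supp_add lookup_add power_add prod.distrib)
qed

lemma mono_eval_zero [simp]: "mono_eval \<xi> 0 = 1"
  by (simp add: mono_eval_def)

lemma mono_eval_cong:
  assumes "\<And>v. v \<in> supp a \<Longrightarrow> \<xi> v = \<eta> v"
  shows "mono_eval \<xi> a = mono_eval \<eta> a"
  unfolding mono_eval_def using assms by (intro prod.cong) auto

text \<open>The coefficients are moved along \<open>\<iota>\<close> because the points constructed below live over an infinite
  field, whereas the coefficient field may be finite.\<close>

definition eval_at :: "('k \<Rightarrow> 'c) \<Rightarrow> (pos \<Rightarrow> 'c::comm_ring_1) \<Rightarrow> 'k::comm_ring_1 poly_pos \<Rightarrow> 'c" where
  "eval_at \<iota> \<xi> = lin_ext (\<lambda>a x. \<iota> x * mono_eval \<xi> a)"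

lemma eval_at_hom:
  assumes "comm_ring_hom \<iota>"
  shows "comm_ring_hom (eval_at \<iota> \<xi>)"
proof -
  interpret comm_ring_hom \<iota> by fact
  show ?thesis
  proof
    fix p q
    show "eval_at \<iota> \<xi> (p + q) = eval_at \<iota> \<xi> p + eval_at \<iota> \<xi> q"
      unfolding eval_at_def by (rule lin_ext_add) (auto simp: hom_add algebra_simps)
    show "eval_at \<iota> \<xi> (p * q) = eval_at \<iota> \<xi> p * eval_at \<iota> \<xi> q"
      unfolding eval_at_def
      by (rule lin_ext_mult) (auto simp: hom_add hom_mult mono_eval_add algebra_simps)
    show "eval_at \<iota> \<xi> 0 = 0"
      by (simp add: eval_at_def lin_ext_def)
    show "eval_at \<iota> \<xi> 1 = 1"
      unfolding eval_at_def single_one[symmetric] by (subst lin_ext_single) auto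
  qed
qed

lemma mono_eval_single: "mono_eval \<xi> (single v e) = \<xi> v ^ e"
  by (cases "e = 0") (auto simp: mono_eval_def)

lemma eval_at_Var:
  assumes "comm_ring_hom \<iota>"
  shows "eval_at \<iota> \<xi> (Var v) = \<xi> v"
proof -
  interpret comm_ring_hom \<iota> by fact
  show ?thesis
    unfolding eval_at_def Var_def by (subst lin_ext_single) (auto simp: mono_eval_single)
qed

lemma eval_at_cong:
  assumes "\<And>a v. a \<in> mons p \<Longrightarrow> v \<in> supp a \<Longrightarrow> \<xi> v = \<eta> v"
  shows "eval_at \<iota> \<xi> p = eval_at \<iota> \<eta> p"
  unfolding eval_at_def lin_ext_def
  using assms by (intro sum.cong refl arg_cong2[of _ _ _ _ "(*)"] mono_eval_cong) auto

section \<open>Ideals of a polynomial ring\<close>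

definition polys :: "pos set \<Rightarrow> 'k::field poly_pos set" where
  "polys V = {p. \<forall>a\<in>mons p. supp a \<subseteq> V}"

lemma polys_iff: "p \<in> polys V \<longleftrightarrow> (\<forall>a\<in>mons p. supp a \<subseteq> V)"
  by (simp add: polys_def)

lemma poly_ring_simps [simp]:
  "carrier (poly_ring V) = polys V"
  "p \<otimes>\<^bsub>poly_ring V\<^esub> q = p * q" "p \<oplus>\<^bsub>poly_ring V\<^esub> q = p + q"
  "\<one>\<^bsub>poly_ring V\<^esub> = 1" "\<zero>\<^bsub>poly_ring V\<^esub> = 0"
  by (simp_all add: poly_ring_def polys_def)

lemma polys_add: "p \<in> polys V \<Longrightarrow> q \<in> polys V \<Longrightarrow> p + q \<in> polys V"
  using keys_add[of p q] by (auto simp: polys_iff)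

lemma polys_mult:
  assumes "p \<in> polys V" "q \<in> polys V"
  shows "p * q \<in> polys V"
proof -
  interpret cring "poly_ring V :: 'a poly_pos ring" by (rule poly_ring_cring)
  show ?thesis using m_closed[of p q] assms by simp
qed

lemma polys_uminus: "p \<in> polys V \<Longrightarrow> - p \<in> polys V"
  by (simp add: polys_iff)

lemma polys_0 [simp]: "0 \<in> polys V" and polys_1 [simp]: "1 \<in> polys V"
  by (simp_all add: polys_iff)

lemma polys_sum: "(\<And>i. i \<in> A \<Longrightarrow> f i \<in> polys V) \<Longrightarrow> sum f A \<in> polys V"
  by (induction A rule: infinite_finite_induct) (auto intro!: polys_add)

lemma polys_prod: "(\<And>i. i \<in> A \<Longrightarrow> f i \<in> polys V) \<Longrightarrow> prod f A \<in> polys V"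
  by (induction A rule: infinite_finite_induct) (auto intro!: polys_mult)

lemma polys_power: "p \<in> polys V \<Longrightarrow> p ^ e \<in> polys V"
  by (induction e) (auto intro!: polys_mult)

lemma polys_mono: "V \<subseteq> W \<Longrightarrow> polys V \<subseteq> polys W"
  unfolding polys_def by blast

lemma polys_Var: "v \<in> V \<Longrightarrow> Var v \<in> polys V"
  by (auto simp: Var_def polys_iff)

lemma ideal_poly_ring_iff:
  "ideal J (poly_ring V) \<longleftrightarrow> J \<subseteq> polys V \<and> 0 \<in> J \<and> (\<forall>p\<in>J. \<forall>q\<in>J. p + q \<in> J)
    \<and> (\<forall>p\<in>J. \<forall>q\<in>polys V. q * p \<in> J)" (is "?L \<longleftrightarrow> ?R")
proof
  interpret R: cring "poly_ring V :: 'a poly_pos ring" by (rule poly_ring_cring)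
  assume ?L
  then interpret ideal J "poly_ring V" .
  show ?R
    using a_subset zero_closed a_closed I_l_closed by auto
next
  interpret R: cring "poly_ring V :: 'a poly_pos ring" by (rule poly_ring_cring)
  assume r: ?R
  have neg: "- p \<in> J" if "p \<in> J" for p
  proof -
    have "(- 1) * p \<in> J" using r that polys_uminus[OF polys_1, of V] by blast
    then show ?thesis by simp
  qed
  have inv: "\<ominus>\<^bsub>poly_ring V\<^esub> p = - p" if "p \<in> polys V" for p :: "'a poly_pos"
    using that polys_uminus[OF that] by (intro R.minus_equality) auto
  show ?L
  proof (rule idealI)
    show "ring (poly_ring V :: 'a poly_pos ring)" by (rule R.ring_axioms)
    show "subgroup J (add_monoid (poly_ring V))"
    proof (rule R.add.subgroupI)
      show "J \<subseteq> carrier (poly_ring V)" using r by simp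
      show "J \<noteq> {}" using r by auto
      show "\<ominus>\<^bsub>poly_ring V\<^esub> a \<in> J" if "a \<in> J" for a
        using inv[of a] neg[OF that] r that by auto
      show "a \<oplus>\<^bsub>poly_ring V\<^esub> b \<in> J" if "a \<in> J" "b \<in> J" for a b
        using r that by auto
    qed
  qed (use r in \<open>auto simp: mult.commute\<close>)
qed

lemma primeideal_poly_ring_iff:
  "primeideal J (poly_ring V) \<longleftrightarrow> ideal J (poly_ring V) \<and> 1 \<notin> J
    \<and> (\<forall>p\<in>polys V. \<forall>q\<in>polys V. p * q \<in> J \<longrightarrow> p \<in> J \<or> q \<in> J)" (is "?L \<longleftrightarrow> ?R")
proof
  assume ?L
  then interpret primeideal J "poly_ring V" .
  show ?R
    using is_ideal one_imp_carrier I_notcarr I_prime by auto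
next
  assume r: ?R
  have "carrier (poly_ring V) \<noteq> J" using r by auto
  then show ?L
    using r by (intro primeidealI poly_ring_cring) auto
qed

lemma ideal_sum:
  assumes "ideal J (poly_ring V)" "\<And>i. i \<in> A \<Longrightarrow> f i \<in> J"
  shows "sum f A \<in> J"
  using assms(2)
  by (induction A rule: infinite_finite_induct) (use assms(1) in \<open>auto simp: ideal_poly_ring_iff\<close>)

lemma ideal_uminus:
  assumes "ideal J (poly_ring V)" "p \<in> J"
  shows "- p \<in> J"
proof -
  have "(- 1) * p \<in> J"
    using assms polys_uminus[OF polys_1, of V] unfolding ideal_poly_ring_iff by blast
  then show ?thesis by simp
qed

lemma ideal_diff:
  assumes "ideal J (poly_ring V)" "p \<in> J" "q \<in> J"
  shows "p - q \<in> J"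
  using ideal_uminus[OF assms(1,3)] assms unfolding ideal_poly_ring_iff
  by (metis uminus_add_conv_diff add.commute)

lemma ideal_mult:
  assumes "ideal J (poly_ring V)" "p \<in> J" "q \<in> polys V"
  shows "q * p \<in> J"
  using assms by (auto simp: ideal_poly_ring_iff)

section \<open>Sets of positions without long chains\<close>

definition strictly_nw :: "pos \<Rightarrow> pos \<Rightarrow> bool" where
  "strictly_nw p q \<longleftrightarrow> fst p < fst q \<and> snd p < snd q"

definition chain_in :: "pos set \<Rightarrow> pos list \<Rightarrow> bool" where
  "chain_in S xs \<longleftrightarrow> set xs \<subseteq> S \<and> sorted_wrt strictly_nw xs"

definition chain_len :: "pos set \<Rightarrow> nat" where
  "chain_len S = Max (length ` {xs. chain_in S xs})"

text \<open>These sets will turn out to be the faces of the Stanley-Reisner complex: a chain of length \<open>r\<close> is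
  the diagonal of an \<open>r \<times> r\<close> minor.\<close>

definition chain_free :: "nat \<Rightarrow> pos set \<Rightarrow> pos set set" where
  "chain_free r V = {F. F \<subseteq> V \<and> (\<forall>xs. chain_in F xs \<longrightarrow> length xs < r)}"

definition north_west :: "pos set \<Rightarrow> nat \<Rightarrow> nat \<Rightarrow> pos set" where
  "north_west F i j = {p\<in>F. fst p \<le> i \<and> snd p \<le> j}"

definition south_east :: "pos set \<Rightarrow> nat \<Rightarrow> nat \<Rightarrow> pos set" where
  "south_east F i j = {p\<in>F. i < fst p \<and> j < snd p}"

abbreviation nw_len :: "pos set \<Rightarrow> nat \<Rightarrow> nat \<Rightarrow> nat" where
  "nw_len F i j \<equiv> chain_len (north_west F i j)"

lemma finite_north_west [simp]: "finite F \<Longrightarrow> finite (north_west F i j)"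
  and finite_south_east [simp]: "finite F \<Longrightarrow> finite (south_east F i j)"
  by (auto simp: north_west_def south_east_def)

lemma chain_in_mono: "chain_in S xs \<Longrightarrow> S \<subseteq> T \<Longrightarrow> chain_in T xs"
  by (auto simp: chain_in_def)

lemma chain_distinct_fst: "sorted_wrt strictly_nw xs \<Longrightarrow> distinct (map fst xs)"
  by (induction xs) (fastforce simp: strictly_nw_def)+

lemma chain_distinct_snd: "sorted_wrt strictly_nw xs \<Longrightarrow> distinct (map snd xs)"
  by (induction xs) (fastforce simp: strictly_nw_def)+

lemma chain_length_le:
  assumes "chain_in S xs" "fst ` S \<subseteq> A \<or> snd ` S \<subseteq> A" "finite A"
  shows "length xs \<le> card A"
proof -
  have "length xs \<le> card A" if "distinct (map f xs)" "f ` S \<subseteq> A" for f :: "pos \<Rightarrow> nat"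
  proof -
    have "length xs = card (f ` set xs)" using distinct_card[OF that(1)] by simp
    also have "\<dots> \<le> card A"
      using assms that(2) by (intro card_mono) (auto simp: chain_in_def)
    finally show ?thesis .
  qed
  then show ?thesis
    using assms chain_distinct_fst[of xs] chain_distinct_snd[of xs] unfolding chain_in_def by blast
qed

lemma finite_chain_lengths:
  assumes "finite S"
  shows "finite (length ` {xs. chain_in S xs})"
proof (rule finite_subset)
  show "length ` {xs. chain_in S xs} \<subseteq> {..card (fst ` S)}"
    using chain_length_le[of S _ "fst ` S"] assms by blast
qed simp

lemma chain_in_Nil [simp]: "chain_in S []"
  by (simp add: chain_in_def)

lemma chain_len_ge: "finite S \<Longrightarrow> chain_in S xs \<Longrightarrow> length xs \<le> chain_len S"
  unfolding chain_len_def by (rule Max_ge) (auto intro: finite_chain_lengths)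

lemma chain_len_witness:
  assumes "finite S"
  obtains xs where "chain_in S xs" "length xs = chain_len S"
proof -
  have "chain_len S \<in> length ` {xs. chain_in S xs}"
    unfolding chain_len_def
    by (rule Max_in) (use finite_chain_lengths[OF assms] in \<open>auto intro: exI[of _ "[]"]\<close>)
  then show ?thesis using that by auto
qed

lemma chain_len_mono:
  assumes "finite T" "S \<subseteq> T"
  shows "chain_len S \<le> chain_len T"
proof -
  obtain xs where "chain_in S xs" "length xs = chain_len S"
    using chain_len_witness[of S] finite_subset[OF assms(2,1)] by blast
  then show ?thesis
    using chain_len_ge[OF assms(1) chain_in_mono[OF _ assms(2)], of xs] by simp
qed

lemma nw_len_mono: "finite F \<Longrightarrow> i \<le> i' \<Longrightarrow> j \<le> j' \<Longrightarrow> nw_len F i j \<le> nw_len F i' j'"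
  unfolding north_west_def by (rule chain_len_mono) auto

lemma nw_len_less:
  assumes "F \<in> chain_free r V" "finite F"
  shows "nw_len F i j < r"
proof -
  obtain xs where "chain_in (north_west F i j) xs" "length xs = nw_len F i j"
    using chain_len_witness[of "north_west F i j"] assms(2) by auto
  moreover from this have "chain_in F xs"
    by (auto intro: chain_in_mono simp: north_west_def)
  ultimately show ?thesis using assms(1) by (auto simp: chain_free_def)
qed

lemma nw_len_Suc_Suc_le:
  assumes "finite F"
  shows "nw_len F (Suc i) (Suc j) \<le> nw_len F i j + 1"
proof -
  obtain xs where xs: "chain_in (north_west F (Suc i) (Suc j)) xs"
    "length xs = nw_len F (Suc i) (Suc j)"
    using chain_len_witness[of "north_west F (Suc i) (Suc j)"] assms by auto
  have "length xs \<le> nw_len F i j + 1"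
  proof (cases xs rule: rev_cases)
    case (snoc ys y)
    have "sorted_wrt strictly_nw ys" "\<forall>x\<in>set ys. strictly_nw x y" "set ys \<subseteq> F" "fst y \<le> Suc i" "snd y \<le> Suc j"
      using xs(1) snoc by (auto simp: chain_in_def sorted_wrt_append north_west_def)
    then have "chain_in (north_west F i j) ys"
      by (fastforce simp: chain_in_def north_west_def strictly_nw_def)
    from chain_len_ge[OF _ this] show ?thesis using snoc assms by simp
  qed simp
  then show ?thesis using xs by simp
qed

lemma nw_len_Suc_Suc_ge:
  assumes "finite F" "(Suc i, Suc j) \<in> F"
  shows "nw_len F i j + 1 \<le> nw_len F (Suc i) (Suc j)"
proof -
  obtain xs where xs: "chain_in (north_west F i j) xs" "length xs = nw_len F i j"
    using chain_len_witness[of "north_west F i j"] assms by auto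
  have "chain_in (north_west F (Suc i) (Suc j)) (xs @ [(Suc i, Suc j)])"
    using xs(1) assms(2) by (fastforce simp: chain_in_def sorted_wrt_append north_west_def strictly_nw_def)
  from chain_len_ge[OF _ this] show ?thesis using xs assms by simp
qed

lemma facets_chain_free:
  assumes "F \<in> facets (chain_free r V)"
  shows "F \<in> chain_free r V" "F \<subseteq> V"
  using assms unfolding facets_def chain_free_def by blast+

text \<open>By maximality, adding a position to a facet creates a chain of length \<open>r\<close>, and this chain passes
  through the new position.\<close>

lemma facet_chain_through:
  assumes "F \<in> facets (chain_free r V)" "finite V" "(Suc i, Suc j) \<in> V" "(Suc i, Suc j) \<notin> F"
  shows "r \<le> nw_len F i j + 1 + chain_len (south_east F (Suc i) (Suc j))"
proof -
  let ?v = "(Suc i, Suc j)"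
  have fin: "finite F" using finite_subset[OF facets_chain_free(2)[OF assms(1)] assms(2)] .
  have "insert ?v F \<notin> chain_free r V"
    using assms(1,4) unfolding facets_def by blast
  then obtain xs where xs: "chain_in (insert ?v F) xs" "r \<le> length xs"
    using assms(3) facets_chain_free(2)[OF assms(1)] unfolding chain_free_def
    by (auto simp: not_less)
  have "?v \<in> set xs"
  proof (rule ccontr)
    assume "?v \<notin> set xs"
    then have "chain_in F xs" using xs(1) by (auto simp: chain_in_def)
    then show False
      using facets_chain_free(1)[OF assms(1)] xs(2) by (auto simp: chain_free_def)
  qed
  then obtain A B where AB: "xs = A @ ?v # B" by (meson split_list)
  have A: "chain_in (north_west F i j) A" and B: "chain_in (south_east F (Suc i) (Suc j)) B"
    using xs(1) unfolding AB chain_in_def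
    by (fastforce simp: sorted_wrt_append north_west_def south_east_def strictly_nw_def)+
  have "length xs \<le> nw_len F i j + 1 + chain_len (south_east F (Suc i) (Suc j))"
    using chain_len_ge[OF _ A] chain_len_ge[OF _ B] fin AB by simp
  then show ?thesis using xs(2) by simp
qed

text \<open>Along a diagonal the length of the longest chain in the north-west rectangle grows by at most one.
  If it grew at a position outside \<open>F\<close>, a longest chain up to there could be continued by the
  south-eastern part of the chain through that position, giving a chain of length \<open>r\<close> inside \<open>F\<close>.\<close>

lemma facet_mem_iff:
  assumes "F \<in> facets (chain_free r V)" "finite V" "(Suc i, Suc j) \<in> V"
  shows "(Suc i, Suc j) \<in> F \<longleftrightarrow> nw_len F (Suc i) (Suc j) = nw_len F i j + 1"
proof
  have fin: "finite F" using finite_subset[OF facets_chain_free(2)[OF assms(1)] assms(2)] .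
  show "nw_len F (Suc i) (Suc j) = nw_len F i j + 1" if "(Suc i, Suc j) \<in> F"
    using nw_len_Suc_Suc_le[OF fin] nw_len_Suc_Suc_ge[OF fin that] by (simp add: order_antisym)
  show "(Suc i, Suc j) \<in> F" if eq: "nw_len F (Suc i) (Suc j) = nw_len F i j + 1"
  proof (rule ccontr)
    assume nF: "(Suc i, Suc j) \<notin> F"
    obtain A where A: "chain_in (north_west F (Suc i) (Suc j)) A"
      "length A = nw_len F (Suc i) (Suc j)"
      using chain_len_witness[of "north_west F (Suc i) (Suc j)"] fin by auto
    obtain B where B: "chain_in (south_east F (Suc i) (Suc j)) B"
      "length B = chain_len (south_east F (Suc i) (Suc j))"
      using chain_len_witness[of "south_east F (Suc i) (Suc j)"] fin by auto
    have "chain_in F (A @ B)"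
      using A(1) B(1)
      by (fastforce simp: chain_in_def sorted_wrt_append north_west_def south_east_def strictly_nw_def)
    then have "length A + length B < r"
      using facets_chain_free(1)[OF assms(1)] by (auto simp: chain_free_def)
    then show False
      using facet_chain_through[OF assms nF] A(2) B(2) eq by simp
  qed
qed

text \<open>The number of members of \<open>F\<close> on a diagonal is the final value of the growing function of the
  previous lemma. That value cannot stay below both bounds: after the last position of the diagonal
  outside \<open>F\<close> the function grows at every step up to the border of the rectangle, and the border
  leaves no room for a longer chain south-east of that position, so that this position could be added
  to \<open>F\<close>.\<close>

lemma facet_card_diagonal:
  assumes F: "F \<in> facets (chain_free r V)" and fin: "finite V" and V: "V \<subseteq> {1..n} \<times> {1..m}"
    and start: "i0 = 0 \<or> j0 = 0" and stop: "i0 + L = n \<or> j0 + L = m"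
    and diag: "\<And>k. k < L \<Longrightarrow> (Suc (i0 + k), Suc (j0 + k)) \<in> V"
  shows "card {k. k < L \<and> (Suc (i0 + k), Suc (j0 + k)) \<in> F} = min (r - 1) L"
proof -
  define G where "G k = nw_len F (i0 + k) (j0 + k)" for k
  have finF: "finite F" using finite_subset[OF facets_chain_free(2)[OF F] fin] .
  have G0: "G 0 = 0"
  proof -
    have "north_west F i0 j0 = {}"
      using start V facets_chain_free(2)[OF F] by (force simp: north_west_def)
    then show ?thesis by (simp add: G_def chain_len_def chain_in_def)
  qed
  have mem: "(Suc (i0 + k), Suc (j0 + k)) \<in> F \<longleftrightarrow> G (Suc k) = G k + 1" if "k < L" for k
    using facet_mem_iff[OF F fin diag[OF that]] by (simp add: G_def)
  have le: "G k \<le> G (Suc k)" "G (Suc k) \<le> G k + 1" for k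
    using nw_len_mono[OF finF, of "i0 + k" "i0 + Suc k" "j0 + k" "j0 + Suc k"]
      nw_len_Suc_Suc_le[OF finF, of "i0 + k" "j0 + k"] by (auto simp: G_def)
  have cnt: "card {k. k < K \<and> (Suc (i0 + k), Suc (j0 + k)) \<in> F} = G K" if "K \<le> L" for K
    using that
  proof (induction K)
    case (Suc K)
    have split: "{k. k < Suc K \<and> (Suc (i0 + k), Suc (j0 + k)) \<in> F}
      = (if (Suc (i0 + K), Suc (j0 + K)) \<in> F then insert K else id)
          {k. k < K \<and> (Suc (i0 + k), Suc (j0 + k)) \<in> F}"
      by (auto simp: less_Suc_eq)
    show ?case
      unfolding split using Suc mem[of K] le[of K] by (auto)
  qed (simp add: G0)
  have "G L \<le> L"
    unfolding cnt[OF order_refl, symmetric]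
    by (rule order.trans[OF card_mono[of "{..<L}"]]) auto
  moreover have "G L \<le> r - 1"
    using nw_len_less[OF facets_chain_free(1)[OF F] finF, of "i0 + L" "j0 + L"] by (simp add: G_def)
  moreover have "r - 1 \<le> G L" if less: "G L < L"
  proof -
    define N where "N = {k. k < L \<and> (Suc (i0 + k), Suc (j0 + k)) \<notin> F}"
    have "N \<noteq> {}"
    proof
      assume "N = {}"
      then have "{k. k < L \<and> (Suc (i0 + k), Suc (j0 + k)) \<in> F} = {..<L}"
        by (auto simp: N_def)
      then show False using cnt[of L] less by simp
    qed
    moreover have finN: "finite N" by (simp add: N_def)
    ultimately have "Max N \<in> N" by simp
    \<comment> \<open>The last position of the diagonal outside \<open>F\<close>: from there on \<open>G\<close> grows at every step.\<close>
    define k where "k = Max N"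
    have k: "k < L" "(Suc (i0 + k), Suc (j0 + k)) \<notin> F"
      using \<open>Max N \<in> N\<close> by (auto simp: k_def N_def)
    have after: "(Suc (i0 + k'), Suc (j0 + k')) \<in> F" if "k < k'" "k' < L" for k'
      using Max_ge[OF finN, of k'] that by (fastforce simp: N_def k_def)
    have Gk: "G (Suc k) = G k"
      using mem[OF k(1)] k(2) le[of k] by (simp add: le_Suc_eq)
    have grow: "Suc k + q \<le> L \<Longrightarrow> G (Suc k + q) = G (Suc k) + q" for q
    proof (induction q)
      case (Suc q)
      then show ?case using mem[of "Suc k + q"] after[of "Suc k + q"] by simp
    qed simp
    have GL: "G L = G k + (L - Suc k)"
      using grow[of "L - Suc k"] Gk k(1) by simp
    obtain B where B: "chain_in (south_east F (Suc (i0 + k)) (Suc (j0 + k))) B"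
      "length B = chain_len (south_east F (Suc (i0 + k)) (Suc (j0 + k)))"
      using chain_len_witness[of "south_east F (Suc (i0 + k)) (Suc (j0 + k))"] finF by auto
    have sub: "F \<subseteq> {1..n} \<times> {1..m}" using V facets_chain_free(2)[OF F] by blast
    have "length B \<le> L - Suc k"
      using stop
    proof
      assume eq: "i0 + L = n"
      have "length B \<le> card {Suc (i0 + k)<..n}"
        by (rule chain_length_le[OF B(1)]) (use sub in \<open>auto simp: south_east_def\<close>)
      then show ?thesis using eq by simp
    next
      assume eq: "j0 + L = m"
      have "length B \<le> card {Suc (j0 + k)<..m}"
        by (rule chain_length_le[OF B(1)]) (use sub in \<open>auto simp: south_east_def\<close>)
      then show ?thesis using eq by simp
    qed
    then show ?thesis
      using facet_chain_through[OF F fin diag[OF k(1)] k(2)] B(2) GL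
      by (simp add: G_def)
  qed
  ultimately have "G L = min (r - 1) L" by linarith
  then show ?thesis using cnt[of L] by simp
qed

lemma card_eq_by_fibres:
  assumes "finite A" "finite B" "\<And>y. card {x\<in>A. f x = y} = card {x\<in>B. f x = y}"
  shows "card A = card B"
proof -
  let ?T = "f ` A \<union> f ` B"
  have "card S = (\<Sum>y\<in>?T. card {x\<in>S. f x = y})" if "finite S" "f ` S \<subseteq> ?T" for S
    using sum.group[of S ?T f "\<lambda>_. 1::nat"] that assms by simp
  from this[of A] this[of B] show ?thesis using assms by simp
qed

text \<open>Here \<open>V\<close> is a union of complete diagonals. On a diagonal with \<open>L\<close> positions a facet misses
  \<open>L - min (r - 1) L\<close> of them, and so many positions have both coordinates at least \<open>r\<close>.\<close>

lemma facet_card_complement: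
  assumes F: "F \<in> facets (chain_free r V)" and r: "1 \<le> r"
    and V: "V = {(i, j). i \<in> {1..n} \<and> j \<in> {1..m} \<and> int i - int j \<in> D}"
  shows "card (V - F) = card {v\<in>V. r \<le> fst v \<and> r \<le> snd v}"
proof (rule card_eq_by_fibres[where f = "\<lambda>v. int (fst v) - int (snd v)"])
  have sub: "V \<subseteq> {1..n} \<times> {1..m}" by (auto simp: V)
  have fin: "finite V" using sub by (rule finite_subset) auto
  then show "finite (V - F)" and "finite {v \<in> V. r \<le> fst v \<and> r \<le> snd v}"
    by simp_all
  fix \<delta> :: int
  show "card {v \<in> V - F. int (fst v) - int (snd v) = \<delta>}
    = card {v \<in> {v \<in> V. r \<le> fst v \<and> r \<le> snd v}. int (fst v) - int (snd v) = \<delta>}"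
  proof (cases "\<delta> \<in> D \<and> \<delta> < int n \<and> - \<delta> < int m \<and> 0 < n \<and> 0 < m")
    case False
    then have "{v \<in> V. int (fst v) - int (snd v) = \<delta>} = {}"
      by (auto simp: V)
    then have "{v \<in> V - F. int (fst v) - int (snd v) = \<delta>} = {}"
      "{v \<in> {v \<in> V. r \<le> fst v \<and> r \<le> snd v}. int (fst v) - int (snd v) = \<delta>} = {}"
      by blast+
    then show ?thesis by (simp only:)
  next
    case True
    define i0 j0 where "i0 = nat \<delta>" and "j0 = nat (- \<delta>)"
    define L where "L = min (n - i0) (m - j0)"
    let ?c = "\<lambda>k. (Suc (i0 + k), Suc (j0 + k))"
    have ij: "int i0 - int j0 = \<delta>" "i0 = 0 \<or> j0 = 0" "i0 < n" "j0 < m"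
      using True unfolding i0_def j0_def by linarith+
    have L: "i0 + L = n \<or> j0 + L = m" "i0 + L \<le> n" "j0 + L \<le> m"
      using ij unfolding L_def by linarith+
    have inj: "inj_on ?c A" for A by (auto simp: inj_on_def)
    have diag: "{v \<in> V. int (fst v) - int (snd v) = \<delta>} = ?c ` {..<L}"
    proof (intro equalityI subsetI)
      fix v assume "v \<in> {v \<in> V. int (fst v) - int (snd v) = \<delta>}"
      then obtain i j where v: "v = (i, j)" "1 \<le> i" "i \<le> n" "1 \<le> j" "j \<le> m" "int i - int j = \<delta>"
        by (auto simp: V)
      have e: "i + j0 = j + i0" using v(6) ij(1) by linarith
      then have "i0 < i" "j0 < j" using ij(2) v by linarith+
      then have "v = ?c (i - 1 - i0)" "i - 1 - i0 < L"
        using v e by (auto simp: L_def)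
      then show "v \<in> ?c ` {..<L}" by blast
    next
      fix v assume "v \<in> ?c ` {..<L}"
      then show "v \<in> {v \<in> V. int (fst v) - int (snd v) = \<delta>}"
        using True ij L by (auto simp: V)
    qed
    have count: "card {v \<in> V. int (fst v) - int (snd v) = \<delta> \<and> P v} = card {k. k < L \<and> P (?c k)}" for P
    proof -
      have "{v \<in> V. int (fst v) - int (snd v) = \<delta> \<and> P v}
        = {v \<in> {v \<in> V. int (fst v) - int (snd v) = \<delta>}. P v}" by auto
      also have "\<dots> = ?c ` {k. k < L \<and> P (?c k)}" unfolding diag by auto
      finally show ?thesis by (simp add: card_image[OF inj])
    qed
    have inF: "card {k. k < L \<and> ?c k \<in> F} = min (r - 1) L"
      by (rule facet_card_diagonal[OF F fin sub ij(2) L(1)]) (use diag in blast)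
    have "card {k. k < L \<and> ?c k \<notin> F} = card ({..<L} - {k. k < L \<and> ?c k \<in> F})"
      by (rule arg_cong[where f = card]) auto
    also have "\<dots> = L - min (r - 1) L"
      using inF by (subst card_Diff_subset) auto
    also have "\<dots> = card {r - 1..<L}" by simp
    also have "{r - 1..<L} = {k. k < L \<and> r \<le> fst (?c k) \<and> r \<le> snd (?c k)}"
      using ij(2) r by auto
    finally have "card {k. k < L \<and> ?c k \<notin> F}
      = card {k. k < L \<and> r \<le> fst (?c k) \<and> r \<le> snd (?c k)}" .
    then show ?thesis
      using count[of "\<lambda>v. v \<notin> F"] count[of "\<lambda>v. r \<le> fst v \<and> r \<le> snd v"]
      by (simp add: conj_ac)
  qed
qed

lemma face_in_facet:
  assumes "finite V" "F \<in> chain_free r V"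
  obtains G where "G \<in> facets (chain_free r V)" "F \<subseteq> G"
proof -
  have fin: "finite (chain_free r V)"
    by (rule finite_subset[of _ "Pow V"]) (use assms(1) in \<open>auto simp: chain_free_def\<close>)
  obtain G where "G \<in> chain_free r V" "F \<subseteq> G" "\<forall>H\<in>chain_free r V. G \<subseteq> H \<longrightarrow> H = G"
    using finite_has_maximal2[OF fin assms(2)] by metis
  then show ?thesis using that unfolding facets_def by blast
qed

section \<open>The triangular shape\<close>

lemma sum_triangle:
  "(\<Sum>j\<in>{r..t}. t + 1 - j) = nat (int t - int r + 2) choose 2" if "1 \<le> (r::nat)"
proof -
  have "(\<Sum>j\<in>{r..t}. t + 1 - j) = \<Sum>{1..t + 1 - r}"
    by (rule sum.reindex_bij_witness[of _ "\<lambda>k. t + 1 - k" "\<lambda>j. t + 1 - j"]) (use that in auto)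
  also have "\<dots> = \<Sum>{0..t + 1 - r}"
    by (simp add: sum.atLeast_Suc_atMost)
  also have "\<dots> = nat (int t - int r + 2) choose 2"
  proof (cases "r \<le> t + 1")
    case True
    then have "nat (int t - int r + 2) = Suc (t + 1 - r)" by simp
    then show ?thesis by (simp add: choose_two gauss_sum_nat mult.commute)
  next
    case False
    then have "nat (int t - int r + 2) = 0" "t + 1 - r = 0" by simp_all
    then show ?thesis by simp
  qed
  finally show ?thesis .
qed

definition triangular_shape :: "nat \<Rightarrow> nat \<Rightarrow> nat \<Rightarrow> nat \<Rightarrow> pos set" where
  "triangular_shape n m t1 t2 = {(i, j). i \<in> {1..n} \<and> j \<in> {1..m}
     \<and> int i - int j < int n - int t1 \<and> int j - int i < int m - int t2}"

text \<open>The rectangle of positions with both coordinates at least \<open>r\<close> has \<^const>\<open>EN\<close> elements, and each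
  triangle cuts a smaller triangle off its corner, whose size is counted by \<^const>\<open>ENS\<close>.\<close>

lemma card_far_corner:
  assumes "t1 < n" "t1 < m" "t2 < n" "t2 < m" "1 \<le> r" "r \<le> n" "r \<le> m"
  shows "int (card {v \<in> triangular_shape n m t1 t2. r \<le> fst v \<and> r \<le> snd v})
    = EN n m r - ENS t1 r - ENS t2 r"
proof -
  let ?Q = "{r..n} \<times> {r..m}"
  let ?T1 = "(\<lambda>(j, i). (i, j)) ` (SIGMA j:{r..t1}. {j + n - t1..n})"
  let ?T2 = "SIGMA i:{r..t2}. {i + m - t2..m}"
  have eq: "{v \<in> triangular_shape n m t1 t2. r \<le> fst v \<and> r \<le> snd v} = ?Q - (?T1 \<union> ?T2)"
  proof (rule Set.set_eqI)
    fix v :: pos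
    obtain i j where v: "v = (i, j)" by fastforce
    have 1: "v \<in> ?T1 \<longleftrightarrow> r \<le> j \<and> j \<le> t1 \<and> j + n - t1 \<le> i \<and> i \<le> n"
      using v by force
    have 2: "v \<in> ?T2 \<longleftrightarrow> r \<le> i \<and> i \<le> t2 \<and> i + m - t2 \<le> j \<and> j \<le> m"
      using v by force
    show "v \<in> {v \<in> triangular_shape n m t1 t2. r \<le> fst v \<and> r \<le> snd v} \<longleftrightarrow> v \<in> ?Q - (?T1 \<union> ?T2)"
      unfolding Diff_iff Un_iff 1 2 using v assms by (auto simp: triangular_shape_def)
  qed
  have sub: "?T1 \<subseteq> ?Q" "?T2 \<subseteq> ?Q" using assms by auto
  have fin: "finite ?T1" "finite ?T2" by auto
  have disj: "?T1 \<inter> ?T2 = {}" using assms by auto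
  have "card ?T1 = card (SIGMA j:{r..t1}. {j + n - t1..n})"
    by (rule card_image) (auto simp: inj_on_def)
  also have "\<dots> = (\<Sum>j\<in>{r..t1}. t1 + 1 - j)"
    using assms by (subst card_SigmaI) (auto intro!: sum.cong)
  finally have c1: "int (card ?T1) = ENS t1 r"
    using sum_triangle[OF assms(5)] by (simp add: ENS_def)
  have "card ?T2 = (\<Sum>j\<in>{r..t2}. t2 + 1 - j)"
    using assms by (subst card_SigmaI) (auto intro!: sum.cong)
  then have c2: "int (card ?T2) = ENS t2 r"
    using sum_triangle[OF assms(5)] by (simp add: ENS_def)
  have Q: "int (card ?Q) = EN n m r"
  proof -
    have "int (Suc n - r) = int n - int r + 1" "int (Suc m - r) = int m - int r + 1"
      using assms by auto
    then show ?thesis by (simp only: card_cartesian_product card_atLeastAtMost of_nat_mult EN_def)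
  qed
  have sub': "?T1 \<union> ?T2 \<subseteq> ?Q" using sub by (rule Un_least)
  have "card (?T1 \<union> ?T2) = card ?T1 + card ?T2"
    by (rule card_Un_disjoint[OF fin disj])
  moreover have "card (?T1 \<union> ?T2) \<le> card ?Q"
    by (rule card_mono[OF _ sub']) simp
  moreover have "card (?Q - (?T1 \<union> ?T2)) = card ?Q - card (?T1 \<union> ?T2)"
    by (rule card_Diff_subset[OF _ sub']) (use fin in blast)
  ultimately have "int (card (?Q - (?T1 \<union> ?T2))) = int (card ?Q) - int (card ?T1) - int (card ?T2)"
    by linarith
  then show ?thesis
    unfolding eq c1 c2 Q .
qed

section \<open>Leading monomials of minors\<close>

definition sqfree_mon :: "pos set \<Rightarrow> (pos \<Rightarrow>\<^sub>0 nat)" where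
  "sqfree_mon S = (\<Sum>v\<in>S. single v 1)"

lemma expo_sqfree_mon: "finite S \<Longrightarrow> expo (sqfree_mon S) v = (if v \<in> S then 1 else 0)"
  by (simp add: sqfree_mon_def lookup_sum lookup_single when_def)

lemma supp_sqfree_mon [simp]: "finite S \<Longrightarrow> supp (sqfree_mon S) = S"
  by (auto simp: in_keys_iff expo_sqfree_mon split: if_splits)

definition mdeg :: "(pos \<Rightarrow>\<^sub>0 nat) \<Rightarrow> nat" where
  "mdeg a = (\<Sum>v\<in>supp a. expo a v)"

lemma mdeg_superset: "finite S \<Longrightarrow> supp a \<subseteq> S \<Longrightarrow> mdeg a = (\<Sum>v\<in>S. expo a v)"
  unfolding mdeg_def by (intro sum.mono_neutral_left) (auto simp: in_keys_iff)

lemma mdeg_add: "mdeg (a + b) = mdeg a + mdeg b"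
proof -
  let ?S = "supp a \<union> supp b"
  have "mdeg c = (\<Sum>v\<in>?S. expo c v)" if "supp c \<subseteq> ?S" for c
    using that by (intro mdeg_superset) auto
  then show ?thesis by (simp add: supp_add lookup_add sum.distrib)
qed

lemma mdeg_sum: "mdeg (sum f A) = (\<Sum>i\<in>A. mdeg (f i))"
  by (induction A rule: infinite_finite_induct) (simp_all add: mdeg_add, simp_all add: mdeg_def)

lemma mdeg_single [simp]: "mdeg (single v e) = e"
  by (cases "e = 0") (auto simp: mdeg_def)

definition entry :: "pos set \<Rightarrow> pos \<Rightarrow> 'k::field poly_pos" where
  "entry V p = (if p \<in> V then Var p else 0)"

text \<open>The minor whose diagonal is the chain \<open>xs\<close>; its size is the length of the chain.\<close>

definition chain_minor :: "pos set \<Rightarrow> pos list \<Rightarrow> 'k::field poly_pos" where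
  "chain_minor V xs = det (mat (length xs) (length xs) (\<lambda>(k, l). entry V (fst (xs ! k), snd (xs ! l))))"

lemma prod_entry:
  "finite A \<Longrightarrow> (\<Prod>i\<in>A. entry V (w i) :: 'k::field poly_pos)
    = (if w ` A \<subseteq> V then single (\<Sum>i\<in>A. single (w i) 1) 1 else 0)"
  by (induction A rule: finite_induct) (auto simp: entry_def Var_def mult_single)

lemma prod_Var:
  "finite F \<Longrightarrow> (\<Prod>v\<in>F. Var v :: 'k::field poly_pos) = single (sqfree_mon F) 1"
  by (induction F rule: finite_induct) (auto simp: sqfree_mon_def Var_def mult_single)

text \<open>The monomial that a permutation contributes to the expansion of a minor, were all its entries
  non-zero.\<close>

definition perm_mon :: "pos list \<Rightarrow> (nat \<Rightarrow> nat) \<Rightarrow> (pos \<Rightarrow>\<^sub>0 nat)" where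
  "perm_mon xs p = (\<Sum>i<length xs. single (fst (xs ! i), snd (xs ! p i)) 1)"

lemma expo_perm_mon:
  "expo (perm_mon xs p) v = (\<Sum>i<length xs. if (fst (xs ! i), snd (xs ! p i)) = v then 1 else 0)"
  by (auto simp: perm_mon_def lookup_sum lookup_single when_def intro!: sum.cong)

lemma perm_mon_id:
  assumes "sorted_wrt strictly_nw xs"
  shows "perm_mon xs id = sqfree_mon (set xs)"
proof -
  have "distinct xs" using chain_distinct_fst[OF assms] distinct_map by blast
  then show ?thesis
    by (simp add: perm_mon_def sqfree_mon_def sum.distinct_set_conv_list sum_list_sum_nth
        atLeast0LessThan)
qed

text \<open>At the first index moved by the permutation, the diagonal has a variable that precedes, in the
  same row, the variable that the permutation picks; before that index both monomials agree.\<close>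

lemma perm_mon_less:
  assumes xs: "sorted_wrt strictly_nw xs" and p: "p permutes {..<length xs}" "p \<noteq> id"
  shows "perm_mon xs p < perm_mon xs id"
proof -
  let ?q = "length xs"
  define k where "k = (LEAST k. p k \<noteq> k)"
  have ex: "\<exists>k. p k \<noteq> k" using p(2) by (auto simp: fun_eq_iff)
  have k: "p k \<noteq> k" unfolding k_def by (rule LeastI_ex[OF ex])
  have before: "p i = i" if "i < k" for i
    using not_less_Least[of i "\<lambda>k. p k \<noteq> k"] that by (auto simp: k_def)
  have kq: "k < ?q" using k p(1) by (metis lessThan_iff permutes_not_in)
  have pkq: "p k < ?q" using permutes_in_image[OF p(1), of k] kq by simp
  have pk: "k < p k"
  proof (rule ccontr)
    assume "\<not> k < p k"
    then have "p k < k" using k by simp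
    then have "p (p k) = p k" by (rule before)
    then show False using k permutes_inj[OF p(1)] by (auto dest: injD)
  qed
  have mono: "fst (xs ! i) < fst (xs ! l)" "snd (xs ! i) < snd (xs ! l)" if "i < l" "l < ?q" for i l
    using sorted_wrt_nth_less[OF xs that] by (auto simp: strictly_nw_def)
  have other: "fst (xs ! i) \<noteq> fst (xs ! k)" if "i \<noteq> k" "i < ?q" for i
    using mono(1)[of i k] mono(1)[of k i] that kq by (metis less_irrefl linorder_neqE_nat)
  have "expo (perm_mon xs p) (xs ! k) = 0"
  proof -
    have "(fst (xs ! i), snd (xs ! p i)) \<noteq> xs ! k" if "i < ?q" for i
      using other[of i] that mono(2)[OF pk pkq] by (metis fst_conv snd_conv less_irrefl)
    then show ?thesis by (simp add: expo_perm_mon)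
  qed
  moreover have "expo (perm_mon xs id) (xs ! k) > 0"
    using kq nth_mem[OF kq] by (subst perm_mon_id[OF xs]) (simp add: expo_sqfree_mon)
  moreover have "expo (perm_mon xs p) (a, b) = expo (perm_mon xs id) (a, b)"
    if ab: "a < fst (xs ! k) \<or> a = fst (xs ! k) \<and> b < snd (xs ! k)" for a b
    unfolding expo_perm_mon
  proof (intro sum.cong refl)
    fix i assume i: "i \<in> {..<?q}"
    show "(if (fst (xs ! i), snd (xs ! p i)) = (a, b) then 1 else 0)
      = (if (fst (xs ! i), snd (xs ! id i)) = (a, b) then 1 else (0::nat))"
    proof (cases "i < k")
      case True
      then show ?thesis using before by simp
    next
      case False
      show ?thesis
      proof (cases "i = k")
        case True
        then have "snd (xs ! k) \<noteq> b \<and> snd (xs ! p k) \<noteq> b \<or> fst (xs ! k) \<noteq> a"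
          using ab mono(2)[OF pk pkq] by linarith
        then show ?thesis using True by (auto simp: prod_eq_iff)
      next
        case ne: False
        then have "fst (xs ! k) < fst (xs ! i)" using mono(1)[of k i] False i by simp
        then show ?thesis using ab by auto
      qed
    qed
  qed
  ultimately show ?thesis
    unfolding monomial_less_iff by (intro exI[of _ "fst (xs ! k)"] exI[of _ "snd (xs ! k)"]) simp
qed

lemma chain_minor_expand:
  "chain_minor V xs = (\<Sum>p\<in>{p. p permutes {..<length xs}}. if \<forall>i<length xs. (fst (xs ! i), snd (xs ! p i)) \<in> V
     then single (perm_mon xs p) (signof p) else 0)"
proof -
  let ?q = "length xs"
  have "chain_minor V xs = (\<Sum>p\<in>{p. p permutes {..<?q}}. signof p * (\<Prod>i<?q. entry V (fst (xs ! i), snd (xs ! p i))))"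
    unfolding chain_minor_def det_def'[OF mat_carrier] atLeast0LessThan
    by (intro sum.cong refl arg_cong2[of _ _ _ _ "(*)"] prod.cong)
       (use permutes_in_image in fastforce)
  also have "\<dots> = (\<Sum>p\<in>{p. p permutes {..<?q}}. if \<forall>i<?q. (fst (xs ! i), snd (xs ! p i)) \<in> V
     then single (perm_mon xs p) (signof p) else 0)"
    by (intro sum.cong refl)
       (auto simp: prod_entry perm_mon_def sign_def image_subset_iff single_uminus)
  finally show ?thesis .
qed

lemma chain_minor_mons:
  assumes "a \<in> mons (chain_minor V xs :: 'k::field poly_pos)"
  obtains p where "p permutes {..<length xs}" "a = perm_mon xs p"
    "\<And>i. i < length xs \<Longrightarrow> (fst (xs ! i), snd (xs ! p i)) \<in> V"
proof -
  have "\<exists>p\<in>{p. p permutes {..<length xs}}. a \<in> mons (if \<forall>i<length xs. (fst (xs ! i), snd (xs ! p i)) \<in> V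
     then single (perm_mon xs p) (signof p :: 'k) else 0)"
    using assms keys_sum unfolding chain_minor_expand by fast
  then show ?thesis using that by (auto split: if_splits)
qed

lemma chain_minor_mons_le:
  assumes "sorted_wrt strictly_nw xs" "a \<in> mons (chain_minor V xs :: 'k::field poly_pos)"
  shows "a \<le> sqfree_mon (set xs)"
  using assms(2)
proof (rule chain_minor_mons)
  fix p assume p: "p permutes {..<length xs}" "a = perm_mon xs p"
  then show ?thesis
    using perm_mon_less[OF assms(1) p(1)] perm_mon_id[OF assms(1)] by (cases "p = id") auto
qed

lemma coef_chain_minor_top:
  assumes "chain_in V xs"
  shows "coef (chain_minor V xs :: 'k::field poly_pos) (sqfree_mon (set xs)) = 1"
proof -
  have xs: "sorted_wrt strictly_nw xs" "set xs \<subseteq> V" using assms by (auto simp: chain_in_def)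
  have "coef (chain_minor V xs :: 'k poly_pos) (sqfree_mon (set xs))
    = (\<Sum>p\<in>{p. p permutes {..<length xs}}. if p = id then 1 else 0)"
    unfolding chain_minor_expand lookup_sum
  proof (intro sum.cong refl)
    fix p assume "p \<in> {p. p permutes {..<length xs}}"
    then have p: "p permutes {..<length xs}" by simp
    show "coef (if \<forall>i<length xs. (fst (xs ! i), snd (xs ! p i)) \<in> V
       then single (perm_mon xs p) (signof p :: 'k) else 0) (sqfree_mon (set xs)) = (if p = id then 1 else 0)"
    proof (cases "p = id")
      case True
      have "(fst (xs ! i), snd (xs ! i)) \<in> V" if "i < length xs" for i
        using nth_mem[OF that] xs(2) by auto
      then show ?thesis using True by (simp add: perm_mon_id[OF xs(1)])
    next
      case False
      then show ?thesis
        using perm_mon_less[OF xs(1) p] perm_mon_id[OF xs(1)] by (auto simp: lookup_single when_def)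
    qed
  qed
  also have "\<dots> = 1" by (simp add: finite_permutations permutes_id)
  finally show ?thesis .
qed

lemma chain_minor_supp:
  assumes "a \<in> mons (chain_minor V xs :: 'k::field poly_pos)"
  shows "supp a \<subseteq> V" "supp a \<subseteq> fst ` set xs \<times> snd ` set xs" "mdeg a = length xs"
proof -
  obtain p where p: "p permutes {..<length xs}" "a = perm_mon xs p"
    "\<And>i. i < length xs \<Longrightarrow> (fst (xs ! i), snd (xs ! p i)) \<in> V"
    using chain_minor_mons[OF assms] by metis
  have s: "supp a \<subseteq> (\<lambda>i. (fst (xs ! i), snd (xs ! p i))) ` {..<length xs}"
    unfolding p(2) by (auto simp: in_keys_iff expo_perm_mon image_iff split: if_splits)
  show "supp a \<subseteq> V" using s p(3) by auto
  have "p i < length xs" if "i < length xs" for i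
    using permutes_in_image[OF p(1), of i] that by simp
  then show "supp a \<subseteq> fst ` set xs \<times> snd ` set xs" using s by fastforce
  show "mdeg a = length xs" unfolding p(2) perm_mon_def by (simp add: mdeg_sum)
qed

lemma Max_mons_chain_minor:
  assumes "chain_in V xs"
  shows "Max (mons (chain_minor V xs :: 'k::field poly_pos)) = sqfree_mon (set xs)"
    "chain_minor V xs \<noteq> (0 :: 'k poly_pos)"
proof -
  have "sqfree_mon (set xs) \<in> mons (chain_minor V xs :: 'k poly_pos)"
    using coef_chain_minor_top[OF assms, where 'k='k] by (simp add: in_keys_iff)
  then show "Max (mons (chain_minor V xs :: 'k poly_pos)) = sqfree_mon (set xs)"
    "chain_minor V xs \<noteq> (0 :: 'k poly_pos)"
    using chain_minor_mons_le[where 'k='k] assms by (auto intro!: Max_eqI simp: chain_in_def)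
qed

lemma Max_mons_times:
  fixes p q :: "'k::field poly_pos"
  assumes "p \<noteq> 0" "q \<noteq> 0"
  shows "Max (mons (p * q)) = Max (mons p) + Max (mons q)"
proof (rule Max_eqI)
  fix c assume "c \<in> mons (p * q)"
  then obtain a b where "a \<in> mons p" "b \<in> mons q" "c = a + b"
    using keys_mult[of p q] by auto
  then show "c \<le> Max (mons p) + Max (mons q)" by (auto intro!: add_mono)
next
  have "Max (mons p) \<in> mons p" "Max (mons q) \<in> mons q" using assms by (auto intro!: Max_in)
  then show "Max (mons p) + Max (mons q) \<in> mons (p * q)"
    by (subst in_keys_iff, subst coef_times_top) (auto simp: in_keys_iff)
qed simp

lemma pick_strict_mono_image:
  assumes "\<And>k l. k < l \<Longrightarrow> l < q \<Longrightarrow> f k < (f l :: nat)" "k < q"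
  shows "pick (f ` {..<q}) k = f k"
proof -
  have less: "f k' < f k \<longleftrightarrow> k' < k" if "k' < q" for k'
    using assms(1)[of k' k] assms(1)[of k k'] that assms(2) by (metis linorder_neqE_nat not_less_iff_gr_or_eq)
  have "{a \<in> f ` {..<q}. a < f k} = f ` {..<k}"
    using less assms(2) by (auto simp: image_iff)
  moreover have "inj_on f {..<k}"
    using assms by (intro linorder_inj_onI) (auto dest: assms(1))
  ultimately have "card {a \<in> f ` {..<q}. a < f k} = k" by (simp add: card_image)
  then show ?thesis using pick_card_in_set[of "f k" "f ` {..<q}"] assms(2) by auto
qed

lemma submatrix_pick:
  assumes "I \<subseteq> {..<n}" "J \<subseteq> {..<m}" "card I = q" "card J = q"
  shows "submatrix (mat n m f) I J = mat q q (\<lambda>(k, l). f (pick I k, pick J l))"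
    "\<And>k. k < q \<Longrightarrow> pick I k < n" "\<And>l. l < q \<Longrightarrow> pick J l < m"
proof -
  let ?B = "mat q q (\<lambda>(k, l). f (pick I k, pick J l))"
  have rows: "{i. i < n \<and> i \<in> I} = I" and cols: "{j. j < m \<and> j \<in> J} = J" using assms by auto
  show pI: "pick I k < n" if "k < q" for k using pick_in_set_le[of k I] assms that by auto
  show pJ: "pick J l < m" if "l < q" for l using pick_in_set_le[of l J] assms that by auto
  show "submatrix (mat n m f) I J = ?B"
  proof (rule eq_matI)
    fix k l assume "k < dim_row (?B)"
      "l < dim_col (?B)"
    then have kl: "k < q" "l < q" by simp_all
    then have "submatrix (mat n m f) I J $$ (k, l) = mat n m f $$ (pick I k, pick J l)"
      using assms by (intro submatrix_index) (simp_all add: rows cols)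
    then show "submatrix (mat n m f) I J $$ (k, l) = ?B $$ (k, l)"
      using kl pI pJ by simp
  qed (use assms in \<open>simp_all add: dim_submatrix rows cols\<close>)
qed

text \<open>\<^const>\<open>minors\<close> enumerates the rows and columns by \<^const>\<open>pick\<close>; for the rows and columns of a chain
  this is the order in which the chain visits them. The shift by one translates positions into
  matrix indices.\<close>

lemma chain_minor_in_minors:
  fixes X :: "'k::field poly_pos mat"
  assumes X: "X = mat n m (\<lambda>(i, j). entry V (Suc i, Suc j))" and V: "V \<subseteq> {1..n} \<times> {1..m}"
    and xs: "chain_in V xs"
  shows "chain_minor V xs \<in> minors (length xs) X"
proof -
  let ?q = "length xs"
  let ?B = "mat ?q ?q (\<lambda>(k, l). entry V (fst (xs ! k), snd (xs ! l))) :: 'k poly_pos mat"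
  let ?f = "\<lambda>k. fst (xs ! k) - 1" and ?g = "\<lambda>k. snd (xs ! k) - 1"
  have "xs ! k \<in> V" if "k < ?q" for k using xs nth_mem[OF that] by (auto simp: chain_in_def)
  then have in_rect: "1 \<le> fst (xs ! k) \<and> fst (xs ! k) \<le> n \<and> 1 \<le> snd (xs ! k) \<and> snd (xs ! k) \<le> m" if "k < ?q" for k
    using subsetD[OF V] that by (metis SigmaE atLeastAtMost_iff fst_conv snd_conv)
  have mono: "fst (xs ! i) < fst (xs ! l)" "snd (xs ! i) < snd (xs ! l)" if "i < l" "l < ?q" for i l
    using sorted_wrt_nth_less[of strictly_nw xs, OF _ that] xs by (auto simp: strictly_nw_def chain_in_def)
  have f: "?f k < ?f l" if "k < l" "l < ?q" for k l
    using mono(1)[OF that] in_rect[of k] in_rect[of l] that by linarith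
  have g: "?g k < ?g l" if "k < l" "l < ?q" for k l
    using mono(2)[OF that] in_rect[of k] in_rect[of l] that by linarith
  define I J where "I = ?f ` {..<?q}" and "J = ?g ` {..<?q}"
  have I: "I \<subseteq> {..<n}" and J: "J \<subseteq> {..<m}" using in_rect by (force simp: I_def J_def)+
  have "inj_on ?f {..<?q}" by (rule linorder_inj_onI) (use f in \<open>auto dest: f\<close>)
  then have cI: "card I = ?q" by (simp add: I_def card_image)
  have "inj_on ?g {..<?q}" by (rule linorder_inj_onI) (use g in \<open>auto dest: g\<close>)
  then have cJ: "card J = ?q" by (simp add: J_def card_image)
  note sub = submatrix_pick[OF I J cI cJ]
  have "submatrix X I J = ?B"
    unfolding X sub(1)
  proof (rule eq_matI)
    fix k l assume "k < dim_row (mat ?q ?q (\<lambda>(k, l). entry V (fst (xs ! k), snd (xs ! l)) :: 'k poly_pos))"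
      "l < dim_col (mat ?q ?q (\<lambda>(k, l). entry V (fst (xs ! k), snd (xs ! l)) :: 'k poly_pos))"
    then have kl: "k < ?q" "l < ?q" by simp_all
    have "pick I k = ?f k" unfolding I_def by (rule pick_strict_mono_image) (use f kl in auto)
    moreover have "pick J l = ?g l" unfolding J_def by (rule pick_strict_mono_image) (use g kl in auto)
    moreover have "Suc (?f k) = fst (xs ! k)" "Suc (?g l) = snd (xs ! l)"
      using in_rect[OF kl(1)] in_rect[OF kl(2)] by linarith+
    ultimately show "mat ?q ?q (\<lambda>(k, l). case (pick I k, pick J l) of (i, j) \<Rightarrow> entry V (Suc i, Suc j)) $$ (k, l)
      = ?B $$ (k, l)"
      using kl by (simp only: index_mat(1) prod.case)
  qed simp_all
  then have "chain_minor V xs = det (submatrix X I J)" by (simp add: chain_minor_def)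
  then show ?thesis using I J cI cJ by (auto simp: minors_def X)
qed

section \<open>Monomials in an initial ideal\<close>

lemma single_in_polys [simp]: "single a 1 \<in> (polys V :: 'k::field poly_pos set) \<longleftrightarrow> supp a \<subseteq> V"
  by (simp add: polys_iff)

text \<open>The polynomials all of whose monomials are divisible by the leading monomial of a member of \<open>I\<close>
  form an ideal.\<close>

lemma initial_ideal_divisor:
  fixes I :: "'k::field poly_pos set"
  assumes "I \<subseteq> polys V" "single a 1 \<in> initial_ideal (poly_ring V) I"
  obtains f b where "f \<in> I" "f \<noteq> 0" "a = Max (mons f) + b"
proof -
  define J where "J = {p \<in> polys V :: 'k poly_pos set. \<forall>a\<in>mons p. \<exists>f b. f \<in> I \<and> f \<noteq> 0 \<and> a = Max (mons f) + b}"
  interpret R: cring "poly_ring V :: 'k poly_pos ring" by (rule poly_ring_cring)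
  have "ideal J (poly_ring V)"
    unfolding ideal_poly_ring_iff
  proof (intro conjI ballI)
    fix p q assume p: "p \<in> J" and q: "q \<in> J"
    then show "p + q \<in> J" using keys_add[of p q] polys_add[of p V q] unfolding J_def by blast
  next
    fix p q :: "'k poly_pos" assume p: "p \<in> J" and q: "q \<in> polys V"
    have "\<exists>f b. f \<in> I \<and> f \<noteq> 0 \<and> c = Max (mons f) + b" if c: "c \<in> mons (q * p)" for c
    proof -
      obtain x y where "x \<in> mons q" "y \<in> mons p" "c = x + y" using keys_mult[of q p] c by blast
      moreover from this obtain f b where "f \<in> I" "f \<noteq> 0" "y = Max (mons f) + b"
        using p by (auto simp: J_def)
      ultimately show ?thesis by (intro exI[of _ f] exI[of _ "b + x"]) (simp add: ac_simps)
    qed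
    then show "q * p \<in> J" using p q polys_mult[of q V p] by (simp add: J_def)
  qed (auto simp: J_def)
  moreover have "initial_monomial ` (I - {0}) \<subseteq> J"
  proof
    fix x assume "x \<in> initial_monomial ` (I - {0})"
    then obtain f where f: "f \<in> I" "f \<noteq> 0" "x = initial_monomial f" by auto
    then have "f \<in> polys V" "Max (mons f) \<in> mons f" using assms(1) by (auto intro: Max_in)
    then have "supp (Max (mons f)) \<subseteq> V" by (simp add: polys_iff)
    moreover have "\<exists>g b. g \<in> I \<and> g \<noteq> 0 \<and> Max (mons f) = Max (mons g) + b"
      using f by (intro exI[of _ f] exI[of _ 0]) simp
    ultimately show "x \<in> J"
      using f(3) by (simp add: J_def initial_monomial_def polys_iff)
  qed
  ultimately have "initial_ideal (poly_ring V) I \<subseteq> J"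
    unfolding initial_ideal_def by (rule R.genideal_minimal)
  then have "single a 1 \<in> J" using assms(2) by blast
  then show ?thesis using that by (auto simp: J_def)
qed

lemma initial_ideal_multiple:
  fixes I :: "'k::field poly_pos set"
  assumes "I \<subseteq> polys V" "f \<in> I" "f \<noteq> 0" "supp b \<subseteq> V"
  shows "single (Max (mons f) + b) 1 \<in> initial_ideal (poly_ring V) I"
proof -
  interpret R: cring "poly_ring V :: 'k poly_pos ring" by (rule poly_ring_cring)
  have "supp (Max (mons g)) \<subseteq> V" if "g \<in> I" "g \<noteq> 0" for g
  proof -
    have "g \<in> polys V" "Max (mons g) \<in> mons g" using that assms(1) by (auto intro: Max_in)
    then show ?thesis by (simp add: polys_iff)
  qed
  then have sub: "initial_monomial ` (I - {0}) \<subseteq> carrier (poly_ring V)"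
    unfolding initial_monomial_def poly_ring_simps(1) image_subset_iff single_in_polys by blast
  have "initial_monomial f \<in> initial_ideal (poly_ring V) I"
    unfolding initial_ideal_def using R.genideal_self[OF sub] assms by blast
  moreover have "ideal (initial_ideal (poly_ring V) I) (poly_ring V)"
    unfolding initial_ideal_def by (rule R.genideal_ideal[OF sub])
  ultimately have "single b 1 * initial_monomial f \<in> initial_ideal (poly_ring V) I"
    using assms(4) by (intro ideal_mult) auto
  then show ?thesis by (simp add: initial_monomial_def mult_single add.commute)
qed

section \<open>Matrices of bounded rank\<close>

text \<open>A bound on the rank of the submatrix with rows \<open>I\<close> and columns \<open>J\<close>, expressed by a factorization:
  in this form enlarging the block, row and column operations, pivoting and completion are explicit
  changes of the two factors.\<close>

definition rank_le :: "nat \<Rightarrow> nat set \<Rightarrow> nat set \<Rightarrow> (pos \<Rightarrow> 'c::field) \<Rightarrow> bool" where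
  "rank_le \<rho> I J A \<longleftrightarrow> (\<exists>u v. \<forall>i\<in>I. \<forall>j\<in>J. A (i, j) = (\<Sum>k<\<rho>. u i k * v k j))"

lemma rank_leI:
  "(\<And>i j. i \<in> I \<Longrightarrow> j \<in> J \<Longrightarrow> A (i, j) = (\<Sum>k<\<rho>. u i k * v k j)) \<Longrightarrow> rank_le \<rho> I J A"
  unfolding rank_le_def by blast

lemma rank_leE:
  assumes "rank_le \<rho> I J A"
  obtains u v where "\<And>i j. i \<in> I \<Longrightarrow> j \<in> J \<Longrightarrow> A (i, j) = (\<Sum>k<\<rho>. u i k * v k j)"
  using assms unfolding rank_le_def by blast

lemma rank_le_mono:
  assumes "rank_le \<rho> I J A" "\<rho> \<le> \<rho>'" "I' \<subseteq> I" "J' \<subseteq> J"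
  shows "rank_le \<rho>' I' J' A"
proof -
  obtain u v where uv: "\<And>i j. i \<in> I \<Longrightarrow> j \<in> J \<Longrightarrow> A (i, j) = (\<Sum>k<\<rho>. u i k * v k j)"
    using rank_leE[OF assms(1)] by metis
  show ?thesis
  proof (rule rank_leI[where u = "\<lambda>i k. if k < \<rho> then u i k else 0" and v = v])
    fix i j assume "i \<in> I'" "j \<in> J'"
    then have "A (i, j) = (\<Sum>k<\<rho>. u i k * v k j)" using uv assms by blast
    also have "\<dots> = (\<Sum>k<\<rho>'. (if k < \<rho> then u i k else 0) * v k j)"
      using assms(2) by (intro sum.mono_neutral_cong_left) auto
    finally show "A (i, j) = (\<Sum>k<\<rho>'. (if k < \<rho> then u i k else 0) * v k j)" .
  qed
qed

lemma rank_le_cong: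
  assumes "rank_le \<rho> I J A" "\<And>i j. i \<in> I \<Longrightarrow> j \<in> J \<Longrightarrow> B (i, j) = A (i, j)"
  shows "rank_le \<rho> I J B"
  using assms unfolding rank_le_def by metis

lemma rank_le_transpose:
  assumes "rank_le \<rho> I J A"
  shows "rank_le \<rho> J I (\<lambda>(j, i). A (i, j))"
proof -
  obtain u v where uv: "\<And>i j. i \<in> I \<Longrightarrow> j \<in> J \<Longrightarrow> A (i, j) = (\<Sum>k<\<rho>. u i k * v k j)"
    using rank_leE[OF assms(1)] by metis
  show ?thesis
    by (rule rank_leI[where u = "\<lambda>j k. v k j" and v = "\<lambda>k i. u i k"]) (simp add: uv mult.commute)
qed

lemma rank_le_insert_row:
  assumes "rank_le \<rho> I J A"
  shows "rank_le (Suc \<rho>) (insert i0 I) J A"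
proof -
  obtain u v where uv: "\<And>i j. i \<in> I \<Longrightarrow> j \<in> J \<Longrightarrow> A (i, j) = (\<Sum>k<\<rho>. u i k * v k j)"
    using rank_leE[OF assms(1)] by metis
  show ?thesis
  proof (rule rank_leI[where u = "\<lambda>i k. if k < \<rho> then (if i = i0 then 0 else u i k) else (if i = i0 then 1 else 0)"
        and v = "\<lambda>k j. if k < \<rho> then v k j else A (i0, j)"])
    fix i j assume "i \<in> insert i0 I" "j \<in> J"
    then show "A (i, j) = (\<Sum>k<Suc \<rho>. (if k < \<rho> then (if i = i0 then 0 else u i k) else (if i = i0 then 1 else 0))
      * (if k < \<rho> then v k j else A (i0, j)))"
      by (cases "i = i0") (auto simp: uv)
  qed
qed

lemma rank_le_insert_zero_row:
  assumes "rank_le \<rho> I J A" "\<And>j. j \<in> J \<Longrightarrow> A (i0, j) = 0"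
  shows "rank_le \<rho> (insert i0 I) J A"
proof -
  obtain u v where uv: "\<And>i j. i \<in> I \<Longrightarrow> j \<in> J \<Longrightarrow> A (i, j) = (\<Sum>k<\<rho>. u i k * v k j)"
    using rank_leE[OF assms(1)] by metis
  show ?thesis
  proof (rule rank_leI[where u = "\<lambda>i k. if i = i0 then 0 else u i k" and v = v])
    fix i j assume "i \<in> insert i0 I" "j \<in> J"
    then show "A (i, j) = (\<Sum>k<\<rho>. (if i = i0 then 0 else u i k) * v k j)"
      by (cases "i = i0") (simp_all add: uv assms(2))
  qed
qed

lemma rank_le_insert_column:
  "rank_le \<rho> I J A \<Longrightarrow> rank_le (Suc \<rho>) I (insert j0 J) A"
  using rank_le_transpose[OF rank_le_insert_row[OF rank_le_transpose]] by auto

lemma rank_le_insert_zero_column: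
  assumes "rank_le \<rho> I J A" "\<And>i. i \<in> I \<Longrightarrow> A (i, j0) = 0"
  shows "rank_le \<rho> I (insert j0 J) A"
  using rank_le_transpose[OF rank_le_insert_zero_row[OF rank_le_transpose[OF assms(1)], of j0]] assms(2)
  by auto

lemma rank_le_row_operation:
  assumes "rank_le \<rho> I J A" "i0 \<in> I"
  shows "rank_le \<rho> I J (\<lambda>(i, j). A (i, j) + c i * A (i0, j))"
proof -
  obtain u v where uv: "\<And>i j. i \<in> I \<Longrightarrow> j \<in> J \<Longrightarrow> A (i, j) = (\<Sum>k<\<rho>. u i k * v k j)"
    using rank_leE[OF assms(1)] by metis
  show ?thesis
    by (rule rank_leI[where u = "\<lambda>i k. u i k + c i * u i0 k" and v = v])
       (simp add: uv assms(2) sum_distrib_left sum.distrib[symmetric] algebra_simps)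
qed

lemma rank_le_column_operation:
  assumes "rank_le \<rho> I J A" "j0 \<in> J"
  shows "rank_le \<rho> I J (\<lambda>(i, j). A (i, j) + c j * A (i, j0))"
  using rank_le_transpose[OF rank_le_row_operation[OF rank_le_transpose[OF assms(1)] assms(2)]] by simp

text \<open>Here \<open>A\<close> is the Schur complement of the pivot \<open>B (i0, j0)\<close>.\<close>

lemma rank_le_pivot:
  assumes A: "rank_le \<rho> I J A" and T: "B (i0, j0) \<noteq> 0" and "i0 \<notin> I" "j0 \<notin> J"
    and schur: "\<And>i j. i \<in> I \<Longrightarrow> j \<in> J \<Longrightarrow> B (i, j) = A (i, j) + B (i, j0) * B (i0, j) / B (i0, j0)"
  shows "rank_le (Suc \<rho>) (insert i0 I) (insert j0 J) B"
proof -
  obtain u v where uv: "\<And>i j. i \<in> I \<Longrightarrow> j \<in> J \<Longrightarrow> A (i, j) = (\<Sum>k<\<rho>. u i k * v k j)"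
    using rank_leE[OF A] by metis
  show ?thesis
  proof (rule rank_leI[where u = "\<lambda>i k. if k < \<rho> then (if i = i0 then 0 else u i k) else B (i, j0)"
        and v = "\<lambda>k j. if k < \<rho> then (if j = j0 then 0 else v k j) else B (i0, j) / B (i0, j0)"])
    fix i j assume ij: "i \<in> insert i0 I" "j \<in> insert j0 J"
    have "(\<Sum>k<\<rho>. (if i = i0 then 0 else u i k) * (if j = j0 then 0 else v k j))
      = (if i = i0 \<or> j = j0 then 0 else A (i, j))"
      using ij uv by auto
    moreover have "B (i, j) = (if i = i0 \<or> j = j0 then 0 else A (i, j)) + B (i, j0) * B (i0, j) / B (i0, j0)"
      using ij T schur by auto
    ultimately show "B (i, j) = (\<Sum>k<Suc \<rho>. (if k < \<rho> then (if i = i0 then 0 else u i k) else B (i, j0))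
      * (if k < \<rho> then (if j = j0 then 0 else v k j) else B (i0, j) / B (i0, j0)))"
      by simp
  qed
qed

lemma det_nonzero_solve:
  fixes M :: "'c::field mat"
  assumes M: "M \<in> carrier_mat q q" "det M \<noteq> 0"
  obtains w where "\<And>h. h < q \<Longrightarrow> b h = (\<Sum>l<q. M $$ (h, l) * w l)"
proof -
  have "M \<in> Units (ring_mat TYPE('c) q ())" using det_non_zero_imp_unit[OF M] .
  then obtain N where N: "N \<in> carrier_mat q q" "M * N = 1\<^sub>m q"
    by (auto simp: Units_def ring_mat_def)
  define x where "x = N *\<^sub>v vec q b"
  have x: "x \<in> carrier_vec q" using N by (auto simp: x_def)
  have "M *\<^sub>v x = vec q b"
    unfolding x_def using M N by (subst assoc_mult_mat_vec[symmetric, of _ q q _ q]) auto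
  then have "b h = (M *\<^sub>v x) $ h" if "h < q" for h
    using that by simp
  moreover have "(M *\<^sub>v x) $ h = (\<Sum>l<q. M $$ (h, l) * x $ l)" if "h < q" for h
    using that M x by (auto simp: scalar_prod_def atLeast0LessThan)
  ultimately have "b h = (\<Sum>l<q. M $$ (h, l) * x $ l)" if "h < q" for h
    using that by simp
  then show ?thesis using that by blast
qed

text \<open>A nonsingular minor of maximal size on the smaller block expresses the new column through
  old ones; the corner is then forced by the same linear combination in the new row.\<close>

lemma rank_le_complete_corner:
  assumes row: "rank_le \<rho> (insert i0 I) J A" and col: "rank_le \<rho> I (insert j0 J) A"
    and "i0 \<notin> I" "j0 \<notin> J"
    and x: "\<And>k. k < \<rho> \<Longrightarrow> x k \<in> I" and y: "\<And>k. k < \<rho> \<Longrightarrow> y k \<in> J"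
    and det: "det (mat \<rho> \<rho> (\<lambda>(k, l). A (x k, y l))) \<noteq> 0"
  shows "\<exists>z. rank_le \<rho> (insert i0 I) (insert j0 J) (A((i0, j0) := z))"
proof -
  obtain u v where uv: "\<And>i j. i \<in> insert i0 I \<Longrightarrow> j \<in> J \<Longrightarrow> A (i, j) = (\<Sum>k<\<rho>. u i k * v k j)"
    using rank_leE[OF row] by metis
  obtain u' v' where uv': "\<And>i j. i \<in> I \<Longrightarrow> j \<in> insert j0 J \<Longrightarrow> A (i, j) = (\<Sum>k<\<rho>. u' i k * v' k j)"
    using rank_leE[OF col] by metis
  let ?U = "mat \<rho> \<rho> (\<lambda>(k, h). u' (x k) h)" and ?V = "mat \<rho> \<rho> (\<lambda>(h, l). v' h (y l))"
  have "mat \<rho> \<rho> (\<lambda>(k, l). A (x k, y l)) = ?U * ?V"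
    by (rule eq_matI) (simp_all add: scalar_prod_def atLeast0LessThan uv' x y)
  then have "det ?V \<noteq> 0"
    using det det_mult[of ?U \<rho> ?V] by auto
  then obtain w where w: "\<And>h. h < \<rho> \<Longrightarrow> v' h j0 = (\<Sum>l<\<rho>. ?V $$ (h, l) * w l)"
    using det_nonzero_solve[of ?V \<rho> "\<lambda>h. v' h j0"] by (metis mat_carrier)
  have comb: "A (i, j0) = (\<Sum>l<\<rho>. A (i, y l) * w l)" if "i \<in> I" for i
  proof -
    have "A (i, j0) = (\<Sum>h<\<rho>. u' i h * (\<Sum>l<\<rho>. v' h (y l) * w l))"
      using that by (simp add: uv' w)
    also have "\<dots> = (\<Sum>l<\<rho>. (\<Sum>h<\<rho>. u' i h * v' h (y l)) * w l)"
      unfolding sum_distrib_left sum_distrib_right by (subst sum.swap) (simp add: mult.assoc)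
    finally show ?thesis using that by (simp add: uv' y)
  qed
  define z where "z = (\<Sum>l<\<rho>. A (i0, y l) * w l)"
  have "rank_le \<rho> (insert i0 I) (insert j0 J) (A((i0, j0) := z))"
  proof (rule rank_leI[where u = u and v = "\<lambda>k j. if j = j0 then (\<Sum>l<\<rho>. v k (y l) * w l) else v k j"])
    fix i j assume ij: "i \<in> insert i0 I" "j \<in> insert j0 J"
    show "(A((i0, j0) := z)) (i, j) = (\<Sum>k<\<rho>. u i k * (if j = j0 then (\<Sum>l<\<rho>. v k (y l) * w l) else v k j))"
    proof (cases "j = j0")
      case True
      have "(A((i0, j0) := z)) (i, j) = (\<Sum>l<\<rho>. A (i, y l) * w l)"
        using ij True comb \<open>i0 \<notin> I\<close> by (auto simp: z_def)
      also have "\<dots> = (\<Sum>l<\<rho>. (\<Sum>k<\<rho>. u i k * v k (y l)) * w l)"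
        using ij by (simp add: uv y)
      also have "\<dots> = (\<Sum>k<\<rho>. u i k * (\<Sum>l<\<rho>. v k (y l) * w l))"
        unfolding sum_distrib_left sum_distrib_right by (subst sum.swap) (simp add: mult.assoc)
      finally show ?thesis using True by simp
    next
      case False
      then show ?thesis using ij by (auto simp: uv)
    qed
  qed
  then show ?thesis by blast
qed

text \<open>The first factor, filled up with zero columns to a square matrix, is singular.\<close>

lemma rank_le_minor_zero:
  assumes "rank_le \<rho> I J A" "\<rho> < q" and x: "\<And>k. k < q \<Longrightarrow> x k \<in> I" and y: "\<And>k. k < q \<Longrightarrow> y k \<in> J"
  shows "det (mat q q (\<lambda>(k, l). A (x k, y l))) = 0"
proof -
  obtain u v where uv: "\<And>i j. i \<in> I \<Longrightarrow> j \<in> J \<Longrightarrow> A (i, j) = (\<Sum>k<\<rho>. u i k * v k j)"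
    using rank_leE[OF assms(1)] by metis
  let ?U = "mat q q (\<lambda>(k, h). if h < \<rho> then u (x k) h else 0)" and ?V = "mat q q (\<lambda>(h, l). v h (y l))"
  have "(\<Sum>k<\<rho>. f k * g k) = (\<Sum>k<q. (if k < \<rho> then f k else 0) * g k)" for f g :: "nat \<Rightarrow> 'a"
    using assms(2) by (intro sum.mono_neutral_cong_left) auto
  then have "mat q q (\<lambda>(k, l). A (x k, y l)) = ?U * ?V"
    by (intro eq_matI) (simp_all add: scalar_prod_def atLeast0LessThan uv x y)
  moreover have "det ?U = 0"
  proof -
    have "?U *\<^sub>v unit_vec q \<rho> = 0\<^sub>v q"
      by (rule eq_vecI) (use assms(2) in \<open>auto simp: scalar_prod_right_unit\<close>)
    then show ?thesis
      using det_0_iff_vec_prod_zero[of ?U q] assms(2) by (auto intro!: exI[of _ "unit_vec q \<rho>"])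
  qed
  ultimately show ?thesis by (simp add: det_mult[of _ q])
qed

section \<open>Points of small rank that do not annihilate a given leading monomial\<close>

text \<open>Let \<open>F\<close> be a facet. The aim of this section is a point \<open>\<xi>\<close> that is zero outside \<open>V\<close>, has rank
  less than \<open>r\<close>, and is not a zero of a given polynomial \<open>g\<close> whose leading monomial only involves
  variables of \<open>F\<close>. Hence no such \<open>g\<close> lies in the determinantal ideal.

  The matrix is filled from its last position backwards in the reading order of positions. Positions
  that are not yet filled are called dead. Consider the rectangles of live positions that reach the
  south-east corner and whose opposite north-west rectangle is dead. At each stage their rank is
  bounded by \<open>r - 1\<close> minus the length of the longest chain of \<open>F\<close> in that opposite rectangle.
  When \<open>(i, j)\<close> becomes live, a single
  new rectangle appears, the one with \<open>(i, j)\<close> as its corner, and there are three cases.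

  If \<open>(i, j)\<close> belongs to \<open>F\<close>, it receives a very large value \<open>1 / \<epsilon>\<close> and serves as a pivot: the
  block to its south-east is corrected by a multiple of \<open>\<epsilon>\<close>. As \<open>\<epsilon>\<close> tends to zero, \<open>g\<close> is dominated
  by its leading coefficient with respect to the variable at \<open>(i, j)\<close>, which is the largest live
  variable. If \<open>(i, j)\<close> is outside \<open>V\<close>, its value is zero, and a whole row or column of the new
  rectangle vanishes. If \<open>(i, j)\<close> lies in \<open>V\<close> but not in \<open>F\<close>, the variable does not occur in \<open>g\<close>;
  either one of the two neighbouring bounds is smaller than the new one, or maximality of \<open>F\<close> yields
  a chain whose minor, if it does not vanish, forces a suitable value. That minor can be prevented
  from vanishing by multiplying it to \<open>g\<close> beforehand.\<close>

text \<open>A zero spreads over the whole rectangle between it and the bottom left corner, or over the one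
  between it and the top right corner.\<close>

definition corner_shape :: "nat \<Rightarrow> nat \<Rightarrow> pos set \<Rightarrow> bool" where
  "corner_shape n m V \<longleftrightarrow> V \<subseteq> {1..n} \<times> {1..m} \<and> (\<forall>i\<in>{1..n}. \<forall>j\<in>{1..m}. (i, j) \<notin> V \<longrightarrow>
     (\<forall>i'\<in>{i..n}. \<forall>j'\<in>{1..j}. (i', j') \<notin> V) \<or> (\<forall>i'\<in>{1..i}. \<forall>j'\<in>{j..m}. (i', j') \<notin> V))"

text \<open>The positions up to \<open>(Suc i, j)\<close> in reading order.\<close>

definition dead :: "nat \<Rightarrow> nat \<Rightarrow> pos \<Rightarrow> bool" where
  "dead i j p \<longleftrightarrow> fst p \<le> i \<or> fst p = Suc i \<and> snd p \<le> j"

locale facet_point =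
  fixes n m r :: nat and V F :: "pos set" and \<iota> :: "'k::field \<Rightarrow> 'c::field"
  assumes shape: "corner_shape n m V"
    and facet: "F \<in> facets (chain_free r V)"
    and iota: "comm_ring_hom \<iota>"
    and inf: "infinite (UNIV :: 'c set)"
begin

lemma V_sub: "V \<subseteq> {1..n} \<times> {1..m}"
  using shape by (simp add: corner_shape_def)

lemma finV: "finite V"
  using V_sub by (rule finite_subset) simp

lemma F_sub: "F \<subseteq> V"
  by (rule facets_chain_free(2)[OF facet])

lemma finF: "finite F"
  by (rule finite_subset[OF F_sub finV])

definition rk :: "nat \<Rightarrow> nat \<Rightarrow> nat" where
  "rk i j = r - 1 - nw_len F i j"

text \<open>The value 1 at dead positions makes them invisible in products.\<close>

definition feasible :: "nat \<Rightarrow> nat \<Rightarrow> (pos \<Rightarrow> 'c) \<Rightarrow> bool" where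
  "feasible i j \<xi> \<longleftrightarrow> (\<forall>p\<in>V. dead i j p \<longrightarrow> \<xi> p = 1)
     \<and> (\<forall>p\<in>{1..n} \<times> {1..m} - V. \<not> dead i j p \<longrightarrow> \<xi> p = 0)
     \<and> (\<forall>b\<ge>j. rank_le (rk i b) {i<..n} {b<..m} \<xi>)
     \<and> (\<forall>b\<le>j. rank_le (rk (Suc i) b) {Suc i<..n} {b<..m} \<xi>)"

text \<open>A polynomial that on dead positions is a single monomial times a polynomial in live variables;
  keeping the dead factor avoids dividing it out at every step.\<close>

definition admissible :: "nat \<Rightarrow> nat \<Rightarrow> 'k poly_pos \<Rightarrow> bool" where
  "admissible i j g \<longleftrightarrow> g \<in> polys V \<and> g \<noteq> 0 \<and> supp (Max (mons g)) \<subseteq> F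
     \<and> (\<forall>a\<in>mons g. \<forall>p\<in>V. dead i j p \<longrightarrow> expo a p = expo (Max (mons g)) p)"

definition attainable :: "nat \<Rightarrow> nat \<Rightarrow> bool" where
  "attainable i j \<longleftrightarrow> (\<forall>g. admissible i j g \<longrightarrow> (\<exists>\<xi>. feasible i j \<xi> \<and> eval_at \<iota> \<xi> g \<noteq> 0))"

lemma iota_nonzero: "x \<noteq> 0 \<Longrightarrow> \<iota> x \<noteq> 0"
proof -
  interpret comm_ring_hom \<iota> by (rule iota)
  assume "x \<noteq> 0"
  then have "\<iota> x * \<iota> (inverse x) = 1" by (simp flip: hom_mult)
  then show ?thesis by auto
qed

lemma rk_less_Suc:
  assumes "nw_len F i j < nw_len F i' j'"
  shows "Suc (rk i' j') \<le> rk i j"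
  using assms nw_len_less[OF facets_chain_free(1)[OF facet] finF, of i' j'] by (simp add: rk_def)

lemma rk_mono: "i \<le> i' \<Longrightarrow> j \<le> j' \<Longrightarrow> rk i' j' \<le> rk i j"
  unfolding rk_def by (intro diff_le_mono2 nw_len_mono[OF finF])

lemma attainable_last: "attainable n 0"
  unfolding attainable_def
proof (intro allI impI)
  fix g assume g: "admissible n 0 g"
  define A where "A = Max (mons g)"
  have dead: "dead n 0 p" if "p \<in> V" for p using V_sub that by (auto simp: dead_def)
  have A: "A \<in> mons g" using g by (auto simp: A_def admissible_def)
  have "a = A" if "a \<in> mons g" for a
  proof (rule poly_mapping_eqI)
    fix p
    have "supp a \<subseteq> V" "supp A \<subseteq> V" using g that A by (auto simp: admissible_def polys_iff)
    then have "p \<notin> supp a \<and> p \<notin> supp A" if "p \<notin> V" using that by blast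
    then have "expo a p = 0 \<and> expo A p = 0" if "p \<notin> V" using that by (simp add: in_keys_iff)
    moreover have "expo a p = expo A p" if "p \<in> V"
      using g \<open>a \<in> mons g\<close> that dead[OF that] unfolding admissible_def A_def by blast
    ultimately show "expo a p = expo A p" by (cases "p \<in> V") simp_all
  qed
  then have "mons g = {A}" using A by blast
  moreover define \<xi> :: "pos \<Rightarrow> 'c" where "\<xi> p = (if p \<in> V then 1 else 0)" for p
  moreover have "mono_eval \<xi> A = 1"
    unfolding mono_eval_def
  proof (intro prod.neutral ballI)
    fix v assume "v \<in> supp A"
    then have "v \<in> V" using g A by (simp add: admissible_def polys_iff subset_iff del: split_paired_All)
    then show "\<xi> v ^ expo A v = 1" by (simp add: \<xi>_def)
  qed
  ultimately have "eval_at \<iota> \<xi> g = \<iota> (coef g A)" by (simp add: eval_at_def lin_ext_def)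
  moreover have "coef g A \<noteq> 0" using A by (simp add: in_keys_iff)
  ultimately have "eval_at \<iota> \<xi> g \<noteq> 0" using iota_nonzero by simp
  moreover have "feasible n 0 \<xi>"
    by (auto simp: feasible_def \<xi>_def dead_def rank_le_def)
  ultimately show "\<exists>\<xi>. feasible n 0 \<xi> \<and> eval_at \<iota> \<xi> g \<noteq> 0" by blast
qed

lemma attainable_row:
  assumes "attainable (Suc i) 0"
  shows "attainable i m"
proof -
  have dead: "dead i m p \<longleftrightarrow> dead (Suc i) 0 p" if "p \<in> {1..n} \<times> {1..m}" for p
    using that by (auto simp: dead_def)
  have "feasible i m \<xi>" if "feasible (Suc i) 0 \<xi>" for \<xi>
  proof -
    have "rank_le (rk i b) {i<..n} {b<..m} \<xi>" if "b \<ge> m" for b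
      using that by (auto simp: rank_le_def)
    then show ?thesis using that dead V_sub unfolding feasible_def by (auto simp: subset_iff)
  qed
  moreover have "admissible (Suc i) 0 g" if "admissible i m g" for g
    using that dead V_sub unfolding admissible_def by (metis subsetD)
  ultimately show ?thesis using assms unfolding attainable_def by blast
qed

text \<open>The first live position carries the largest live variable, and on the larger variables all
  monomials of \<open>g\<close> agree.\<close>

lemma expo_le_first_live:
  assumes g: "admissible i j g" and a: "a \<in> mons g"
  shows "expo a (Suc i, Suc j) \<le> expo (Max (mons g)) (Suc i, Suc j)"
proof (rule ccontr)
  let ?w = "(Suc i, Suc j)" and ?A = "Max (mons g)"
  assume gt: "\<not> ?thesis"
  have le: "a \<le> ?A" using a by simp
  then have "a < ?A" using gt by (metis le_less order_refl)
  then obtain k l where kl: "expo a (k, l) < expo ?A (k, l)"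
    "\<And>k' l'. k' < k \<or> k' = k \<and> l' < l \<Longrightarrow> expo a (k', l') = expo ?A (k', l')"
    unfolding monomial_less_iff by blast
  have "(k, l) \<in> supp ?A" using kl(1) by (auto simp: in_keys_iff)
  then have "(k, l) \<in> V" using g F_sub by (auto simp: admissible_def)
  then have "\<not> dead i j (k, l)" using g a kl(1) by (auto simp: admissible_def)
  moreover have "(k, l) \<noteq> ?w" using kl(1) gt by auto
  ultimately have "Suc i < k \<or> Suc i = k \<and> Suc j < l"
    by (auto simp: dead_def)
  then show False using kl(2)[of "Suc i" "Suc j"] gt by simp
qed

lemma dead_Suc: "dead i (Suc j) p \<longleftrightarrow> dead i j p \<or> p = (Suc i, Suc j)"
  by (cases p) (auto simp: dead_def)

lemma admissible_Suc_of_not_mem: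
  assumes g: "admissible i j g" and w: "(Suc i, Suc j) \<notin> F"
  shows "admissible i (Suc j) g" "\<And>a. a \<in> mons g \<Longrightarrow> expo a (Suc i, Suc j) = 0"
proof -
  have "expo (Max (mons g)) (Suc i, Suc j) = 0"
    using g w by (auto simp: admissible_def in_keys_iff)
  then show z: "expo a (Suc i, Suc j) = 0" if "a \<in> mons g" for a
    using expo_le_first_live[OF g that] by simp
  show "admissible i (Suc j) g"
    using g z \<open>expo (Max (mons g)) (Suc i, Suc j) = 0\<close>
    unfolding admissible_def dead_Suc by metis
qed

lemma eval_at_update:
  assumes "\<And>a. a \<in> mons g \<Longrightarrow> expo a w = 0"
  shows "eval_at \<iota> (\<xi>(w := z)) g = eval_at \<iota> \<xi> g"
  by (rule eval_at_cong) (use assms in \<open>auto simp: in_keys_iff\<close>)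

text \<open>All constraints that do not involve the first live position persist; it remains to bound
  the rank of the rectangle with this position as its corner.\<close>

lemma feasible_from_Suc:
  assumes \<xi>: "feasible i (Suc j) \<xi>" and ij: "i < n" "j < m"
    and z: "(Suc i, Suc j) \<notin> V \<Longrightarrow> z = 0"
    and corner: "rank_le (rk i j) {i<..n} {j<..m} (\<xi>((Suc i, Suc j) := z))"
  shows "feasible i j (\<xi>((Suc i, Suc j) := z))"
proof -
  let ?w = "(Suc i, Suc j)"
  have 1: "rank_le (rk i b) {i<..n} {b<..m} (\<xi>(?w := z))" if "b \<ge> j" for b
  proof (cases "b = j")
    case False
    then have "rank_le (rk i b) {i<..n} {b<..m} \<xi>" using \<xi> that by (simp add: feasible_def)
    then show ?thesis by (rule rank_le_cong) (use False that in auto)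
  qed (use corner in simp)
  have 2: "rank_le (rk (Suc i) b) {Suc i<..n} {b<..m} (\<xi>(?w := z))" if "b \<le> j" for b
  proof -
    have "rank_le (rk (Suc i) b) {Suc i<..n} {b<..m} \<xi>" using \<xi> that by (simp add: feasible_def)
    then show ?thesis by (rule rank_le_cong) auto
  qed
  have "\<not> dead i j ?w" by (simp add: dead_def)
  then show ?thesis
    using \<xi> z 1 2 unfolding feasible_def by (auto simp: dead_Suc)
qed

lemma insert_first_row: "i < n \<Longrightarrow> {i<..n} = insert (Suc i) {Suc i<..n}"
  and insert_first_column: "j < m \<Longrightarrow> {j<..m} = insert (Suc j) {Suc j<..m}"
  by auto

lemma attainable_outside:
  assumes IH: "attainable i (Suc j)" and ij: "i < n" "j < m" and w: "(Suc i, Suc j) \<notin> V"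
  shows "attainable i j"
  unfolding attainable_def
proof (intro allI impI)
  let ?w = "(Suc i, Suc j)"
  fix g assume g: "admissible i j g"
  have "?w \<notin> F" using w F_sub by blast
  note g' = admissible_Suc_of_not_mem[OF g this]
  obtain \<xi> where \<xi>: "feasible i (Suc j) \<xi>" "eval_at \<iota> \<xi> g \<noteq> 0"
    using IH g' unfolding attainable_def by blast
  let ?\<xi> = "\<xi>(?w := 0)"
  have zero: "?\<xi> (a, b) = 0" if "(a, b) \<notin> V" "\<not> dead i j (a, b)" "a \<in> {1..n}" "b \<in> {1..m}" for a b
    using \<xi>(1) that unfolding feasible_def by (auto simp: dead_Suc)
  have "rank_le (rk i j) {i<..n} {j<..m} ?\<xi>"
  proof (cases "\<forall>i'\<in>{Suc i..n}. (i', Suc j) \<notin> V")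
    case True
    have "rank_le (rk i (Suc j)) {i<..n} {Suc j<..m} \<xi>" using \<xi>(1) by (simp add: feasible_def)
    then have "rank_le (rk i (Suc j)) {i<..n} {Suc j<..m} ?\<xi>"
      by (rule rank_le_cong) auto
    then have "rank_le (rk i (Suc j)) {i<..n} {j<..m} ?\<xi>"
      unfolding insert_first_column[OF ij(2)]
    proof (rule rank_le_insert_zero_column)
      fix a assume "a \<in> {i<..n}"
      then show "?\<xi> (a, Suc j) = 0" using True ij by (intro zero) (auto simp: dead_def)
    qed
    then show ?thesis by (rule rank_le_mono) (auto intro: rk_mono)
  next
    case False
    moreover have "(\<forall>i'\<in>{Suc i..n}. \<forall>j'\<in>{1..Suc j}. (i', j') \<notin> V) \<or> (\<forall>i'\<in>{1..Suc i}. \<forall>j'\<in>{Suc j..m}. (i', j') \<notin> V)"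
      using shape w ij unfolding corner_shape_def by auto
    ultimately have row: "\<forall>j'\<in>{Suc j..m}. (Suc i, j') \<notin> V" by auto
    have "rank_le (rk (Suc i) j) {Suc i<..n} {j<..m} \<xi>" using \<xi>(1) by (simp add: feasible_def)
    then have "rank_le (rk (Suc i) j) {Suc i<..n} {j<..m} ?\<xi>"
      by (rule rank_le_cong) auto
    then have "rank_le (rk (Suc i) j) {i<..n} {j<..m} ?\<xi>"
      unfolding insert_first_row[OF ij(1)]
    proof (rule rank_le_insert_zero_row)
      fix b assume "b \<in> {j<..m}"
      then show "?\<xi> (Suc i, b) = 0" using row ij by (intro zero) (auto simp: dead_def)
    qed
    then show ?thesis by (rule rank_le_mono) (auto intro: rk_mono)
  qed
  from feasible_from_Suc[OF \<xi>(1) ij _ this] have "feasible i j ?\<xi>" by simp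
  moreover have "eval_at \<iota> ?\<xi> g \<noteq> 0" using \<xi>(2) eval_at_update[of g ?w \<xi> 0] g'(2) by simp
  ultimately show "\<exists>\<xi>. feasible i j \<xi> \<and> eval_at \<iota> \<xi> g \<noteq> 0" by blast
qed

text \<open>If neither neighbouring rectangle has a smaller bound than the new one, all three bounds are equal,
  to \<open>\<rho>\<close> say, and \<open>F\<close> contains a chain of length \<open>\<rho>\<close> south-east of the new position.\<close>

lemma attainable_nonmember:
  assumes IH: "attainable i (Suc j)" and ij: "i < n" "j < m"
    and w: "(Suc i, Suc j) \<in> V" "(Suc i, Suc j) \<notin> F"
  shows "attainable i j"
  unfolding attainable_def
proof (intro allI impI)
  let ?w = "(Suc i, Suc j)"
  fix g assume g: "admissible i j g"
  note g' = admissible_Suc_of_not_mem[OF g w(2)]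
  have mono: "nw_len F i j \<le> nw_len F i (Suc j)" "nw_len F i j \<le> nw_len F (Suc i) j"
    using nw_len_mono[OF finF] by auto
  have conclude: "\<exists>\<xi>. feasible i j \<xi> \<and> eval_at \<iota> \<xi> g \<noteq> 0"
    if "feasible i (Suc j) \<xi>" "eval_at \<iota> \<xi> g \<noteq> 0" "rank_le (rk i j) {i<..n} {j<..m} (\<xi>(?w := z))" for \<xi> z
    using feasible_from_Suc[OF that(1) ij _ that(3)] w(1) that(2) eval_at_update[of g ?w \<xi> z] g'(2)
    by (intro exI[of _ "\<xi>(?w := z)"]) simp
  show "\<exists>\<xi>. feasible i j \<xi> \<and> eval_at \<iota> \<xi> g \<noteq> 0"
  proof (cases "nw_len F i j < nw_len F i (Suc j) \<or> nw_len F i j < nw_len F (Suc i) j")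
    case True
    obtain \<xi> where \<xi>: "feasible i (Suc j) \<xi>" "eval_at \<iota> \<xi> g \<noteq> 0"
      using IH g' unfolding attainable_def by blast
    have "rank_le (rk i j) {i<..n} {j<..m} \<xi>"
      using True
    proof
      assume "nw_len F i j < nw_len F i (Suc j)"
      from rk_less_Suc[OF this] show ?thesis
        using rank_le_insert_column[of "rk i (Suc j)" "{i<..n}" "{Suc j<..m}" \<xi> "Suc j"] \<xi>(1)
        unfolding feasible_def insert_first_column[OF ij(2)] by (auto elim: rank_le_mono)
    next
      assume "nw_len F i j < nw_len F (Suc i) j"
      from rk_less_Suc[OF this] show ?thesis
        using rank_le_insert_row[of "rk (Suc i) j" "{Suc i<..n}" "{j<..m}" \<xi> "Suc i"] \<xi>(1)
        unfolding feasible_def insert_first_row[OF ij(1)] by (auto elim: rank_le_mono)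
    qed
    then show ?thesis using conclude[OF \<xi>, of "\<xi> ?w"] by simp
  next
    case False
    then have "nw_len F i (Suc j) = nw_len F i j" "nw_len F (Suc i) j = nw_len F i j"
      using mono by linarith+
    then have eq: "rk i (Suc j) = rk i j" "rk (Suc i) j = rk i j"
      by (simp_all add: rk_def)
    obtain ys where ys: "chain_in (south_east F (Suc i) (Suc j)) ys"
      "length ys = chain_len (south_east F (Suc i) (Suc j))"
      using chain_len_witness[OF finite_south_east[OF finF]] by blast
    have "rk i j \<le> length ys"
      using facet_chain_through[OF facet finV w] ys(2) by (simp add: rk_def)
    define xs where "xs = take (rk i j) ys"
    have len: "length xs = rk i j" using \<open>rk i j \<le> length ys\<close> by (simp add: xs_def)
    have xs: "chain_in (south_east F (Suc i) (Suc j)) xs"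
      using ys(1) set_take_subset[of "rk i j" ys] sorted_wrt_take[of strictly_nw ys "rk i j"]
      unfolding chain_in_def xs_def by blast
    have xsF: "chain_in F xs" and xsV: "chain_in V xs"
      using chain_in_mono[OF xs] F_sub by (auto simp: south_east_def)
    \<comment> \<open>Asking the point to avoid the zeros of this minor makes the corner completable.\<close>
    define \<delta> :: "'k poly_pos" where "\<delta> = chain_minor V xs"
    have \<delta>0: "\<delta> \<noteq> 0" "Max (mons \<delta>) = sqfree_mon (set xs)"
      using Max_mons_chain_minor[OF xsV, where 'k='k] by (simp_all add: \<delta>_def)
    have live: "fst p > Suc i \<and> snd p > Suc j" if "p \<in> fst ` set xs \<times> snd ` set xs" for p
      using that xs by (auto simp: chain_in_def south_east_def)
    have \<delta>dead: "expo a p = 0" if "a \<in> mons \<delta> \<or> a = sqfree_mon (set xs)" "dead i (Suc j) p" for a p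
    proof -
      have "sqfree_mon (set xs) \<in> mons \<delta>"
        using coef_chain_minor_top[OF xsV, where 'k='k] by (simp add: \<delta>_def in_keys_iff)
      then have "a \<in> mons \<delta>" using that(1) by blast
      then have "supp a \<subseteq> fst ` set xs \<times> snd ` set xs"
        using chain_minor_supp(2) by (simp add: \<delta>_def)
      then show ?thesis using live[of p] that(2) by (force simp: dead_def in_keys_iff)
    qed
    have g0: "g \<noteq> 0" using g by (simp add: admissible_def)
    have Max: "Max (mons (g * \<delta>)) = Max (mons g) + sqfree_mon (set xs)"
      using Max_mons_times[OF g0 \<delta>0(1)] \<delta>0(2) by simp
    have "admissible i (Suc j) (g * \<delta>)"
      unfolding admissible_def
    proof (intro conjI ballI impI)
      show "g * \<delta> \<in> polys V"
        using g chain_minor_supp(1)[where 'k='k] by (intro polys_mult) (auto simp: admissible_def polys_iff \<delta>_def)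
      show "g * \<delta> \<noteq> 0" using g0 \<delta>0 by simp
      show "supp (Max (mons (g * \<delta>))) \<subseteq> F"
        using g xsF by (auto simp: Max supp_add admissible_def chain_in_def)
    next
      fix c p assume c: "c \<in> mons (g * \<delta>)" and p: "p \<in> V" "dead i (Suc j) p"
      obtain a b where ab: "a \<in> mons g" "b \<in> mons \<delta>" "c = a + b" using keys_mult[of g \<delta>] c by blast
      have "expo a p = expo (Max (mons g)) p" using g'(1) ab p unfolding admissible_def by blast
      then show "expo c p = expo (Max (mons (g * \<delta>))) p"
        using \<delta>dead[of b p] \<delta>dead[of "sqfree_mon (set xs)" p] ab p by (simp add: Max lookup_add)
    qed
    then obtain \<xi> where \<xi>: "feasible i (Suc j) \<xi>" "eval_at \<iota> \<xi> (g * \<delta>) \<noteq> 0"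
      using IH unfolding attainable_def by blast
    interpret ev: comm_ring_hom "eval_at \<iota> \<xi>" by (rule eval_at_hom[OF iota])
    have ev: "eval_at \<iota> \<xi> g \<noteq> 0" "eval_at \<iota> \<xi> \<delta> \<noteq> 0" using \<xi>(2) by (auto simp: ev.hom_mult)
    have mem: "xs ! k \<in> south_east F (Suc i) (Suc j)" if "k < length xs" for k
      using xs that by (auto simp: chain_in_def)
    have rect: "fst (xs ! k) \<in> {Suc i<..n}" "snd (xs ! k) \<in> {Suc j<..m}" if "k < rk i j" for k
      using mem[of k] that len F_sub V_sub by (auto simp: south_east_def)
    have entry: "eval_at \<iota> \<xi> (entry V p) = \<xi> p" if "p \<in> {Suc i<..n} \<times> {Suc j<..m}" for p
    proof (cases "p \<in> V")
      case True
      then show ?thesis by (simp add: entry_def eval_at_Var[OF iota])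
    next
      case False
      then have "\<xi> p = 0" using \<xi>(1) that unfolding feasible_def by (auto simp: dead_def)
      then show ?thesis using False by (simp add: entry_def)
    qed
    let ?B = "mat (rk i j) (rk i j) (\<lambda>(k, l). entry V (fst (xs ! k), snd (xs ! l)))"
    let ?C = "mat (rk i j) (rk i j) (\<lambda>(k, l). \<xi> (fst (xs ! k), snd (xs ! l)))"
    have "eval_at \<iota> \<xi> \<delta> = det (map_mat (eval_at \<iota> \<xi>) ?B)"
      unfolding \<delta>_def chain_minor_def len by (simp only: ev.hom_det)
    also have "map_mat (eval_at \<iota> \<xi>) ?B
      = ?C"
      by (rule eq_matI) (use entry rect in auto)
    finally have det: "det ?C \<noteq> 0"
      using ev(2) by simp
    have "\<exists>z. rank_le (rk i j) (insert (Suc i) {Suc i<..n}) (insert (Suc j) {Suc j<..m}) (\<xi>(?w := z))"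
    proof (rule rank_le_complete_corner[where x = "\<lambda>k. fst (xs ! k)" and y = "\<lambda>k. snd (xs ! k)"])
      show "rank_le (rk i j) (insert (Suc i) {Suc i<..n}) {Suc j<..m} \<xi>"
        using \<xi>(1) eq(1) unfolding feasible_def insert_first_row[OF ij(1), symmetric] by (metis order_refl)
      show "rank_le (rk i j) {Suc i<..n} (insert (Suc j) {Suc j<..m}) \<xi>"
        using \<xi>(1) eq(2) unfolding feasible_def insert_first_column[OF ij(2), symmetric]
        by (metis le_SucI order_refl)
    qed (use det rect in auto)
    then obtain z where "rank_le (rk i j) {i<..n} {j<..m} (\<xi>(?w := z))"
      using ij by (auto simp: insert_first_row insert_first_column)
    then show ?thesis using conclude[OF \<xi>(1) ev(1)] by blast
  qed
qed

text \<open>The pivot \<open>1 / \<epsilon>\<close> at the new position, and the block south-east of it changed so that its Schur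
  complement is the old block.\<close>

definition bend :: "nat \<Rightarrow> nat \<Rightarrow> (pos \<Rightarrow> 'c) \<Rightarrow> 'c \<Rightarrow> pos \<Rightarrow> 'c" where
  "bend i j \<xi> \<epsilon> p = (if p = (Suc i, Suc j) then 1 / \<epsilon>
     else if Suc i < fst p \<and> Suc j < snd p then \<xi> p + \<epsilon> * (\<xi> (fst p, Suc j) * \<xi> (Suc i, snd p)) else \<xi> p)"

lemma feasible_bend:
  assumes \<xi>: "feasible i (Suc j) \<xi>" and ij: "i < n" "j < m" and w: "(Suc i, Suc j) \<in> F" and \<epsilon>: "\<epsilon> \<noteq> 0"
  shows "feasible i j (bend i j \<xi> \<epsilon>)"
proof -
  let ?w = "(Suc i, Suc j)" and ?\<xi> = "bend i j \<xi> \<epsilon>"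
  have wV: "?w \<in> V" using w F_sub by blast
  have zero: "\<xi> p = 0" if "p \<in> {1..n} \<times> {1..m} - V" "\<not> dead i (Suc j) p" for p
    using \<xi> that unfolding feasible_def by blast
  have row: "rank_le (rk i b) {i<..n} {b<..m} ?\<xi>" if b: "b \<ge> Suc j" for b
  proof -
    have "rank_le (rk i b) {i<..n} {b<..m} \<xi>" using \<xi> b by (simp add: feasible_def)
    from rank_le_row_operation[OF this, of "Suc i" "\<lambda>a. if Suc i < a then \<epsilon> * \<xi> (a, Suc j) else 0"]
    show ?thesis
      by (rule rank_le_cong) (use ij b in \<open>auto simp: bend_def\<close>)
  qed
  have col: "rank_le (rk (Suc i) b) {Suc i<..n} {b<..m} ?\<xi>" if b: "b \<le> j" for b
  proof -
    have "rank_le (rk (Suc i) b) {Suc i<..n} {b<..m} \<xi>" using \<xi> b by (simp add: feasible_def)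
    from rank_le_column_operation[OF this, of "Suc j" "\<lambda>c. if Suc j < c then \<epsilon> * \<xi> (Suc i, c) else 0"]
    show ?thesis
      by (rule rank_le_cong) (use ij b in \<open>auto simp: bend_def\<close>)
  qed
  have "rank_le (rk (Suc i) (Suc j)) {Suc i<..n} {Suc j<..m} \<xi>" using \<xi> by (simp add: feasible_def)
  then have "rank_le (Suc (rk (Suc i) (Suc j))) (insert (Suc i) {Suc i<..n}) (insert (Suc j) {Suc j<..m}) ?\<xi>"
    by (rule rank_le_pivot) (use \<epsilon> in \<open>auto simp: bend_def\<close>)
  then have corner: "rank_le (Suc (rk (Suc i) (Suc j))) {i<..n} {j<..m} ?\<xi>"
    using ij by (simp add: insert_first_row insert_first_column)
  have "Suc (rk (Suc i) (Suc j)) \<le> rk i j"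
    using rk_less_Suc nw_len_Suc_Suc_ge[OF finF w] by simp
  with corner have corner: "rank_le (rk i j) {i<..n} {j<..m} ?\<xi>" by (rule rank_le_mono) auto
  have "?\<xi> p = 1" if "p \<in> V" "dead i j p" for p
    using \<xi> that by (auto simp: bend_def feasible_def dead_def)
  moreover have "?\<xi> p = 0" if p: "p \<in> {1..n} \<times> {1..m} - V" "\<not> dead i j p" for p
  proof -
    have pw: "p \<noteq> ?w" using p wV by blast
    then have "\<not> dead i (Suc j) p" using p dead_Suc by blast
    then have 0: "\<xi> p = 0" using zero p by blast
    moreover have "\<xi> (fst p, Suc j) * \<xi> (Suc i, snd p) = 0" if gt: "Suc i < fst p" "Suc j < snd p"
    proof -
      obtain a b where ab: "p = (a, b)" "a \<in> {1..n}" "b \<in> {1..m}" "(a, b) \<notin> V" using p by auto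
      then have "(\<forall>i'\<in>{a..n}. \<forall>j'\<in>{1..b}. (i', j') \<notin> V) \<or> (\<forall>i'\<in>{1..a}. \<forall>j'\<in>{b..m}. (i', j') \<notin> V)"
        using shape unfolding corner_shape_def by blast
      then have "(a, Suc j) \<notin> V \<or> (Suc i, b) \<notin> V" using ab gt by auto
      then have "\<xi> (a, Suc j) = 0 \<or> \<xi> (Suc i, b) = 0"
        using zero[of "(a, Suc j)"] zero[of "(Suc i, b)"] ab gt ij by (auto simp: dead_def)
      then show ?thesis using ab by auto
    qed
    ultimately show ?thesis using pw by (simp add: bend_def)
  qed
  moreover have "rank_le (rk i b) {i<..n} {b<..m} ?\<xi>" if "b \<ge> j" for b
    using row corner that by (cases "b = j") auto
  ultimately show ?thesis using col unfolding feasible_def by blast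
qed

text \<open>Multiplied by a power of \<open>\<epsilon>\<close>, the value of \<open>g\<close> at the bent point is a polynomial in \<open>\<epsilon>\<close> whose
  value at zero is that of the leading coefficient of \<open>g\<close>, which is non-zero by the choice of \<open>\<xi>\<close>.\<close>

lemma attainable_member:
  assumes IH: "attainable i (Suc j)" and ij: "i < n" "j < m" and w: "(Suc i, Suc j) \<in> F"
  shows "attainable i j"
  unfolding attainable_def
proof (intro allI impI)
  let ?w = "(Suc i, Suc j)"
  fix g assume g: "admissible i j g"
  interpret comm_ring_hom \<iota> by (rule iota)
  have wV: "?w \<in> V" using w F_sub by blast
  define A where "A = Max (mons g)"
  define K where "K = expo A ?w"
  have A: "A \<in> mons g" using g by (auto simp: A_def admissible_def)
  have le: "expo a ?w \<le> K" if "a \<in> mons g" for a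
    using expo_le_first_live[OF g that] by (simp add: K_def A_def)
  \<comment> \<open>The leading term of \<open>g\<close> with respect to the variable at this position.\<close>
  define c where "c = (\<Sum>a\<in>{a\<in>mons g. expo a ?w = K}. single a (coef g a))"
  have coef_c: "coef c a = (if expo a ?w = K then coef g a else 0)" for a
    by (auto simp: c_def lookup_sum lookup_single when_def in_keys_iff)
  have mons_c: "mons c = {a\<in>mons g. expo a ?w = K}"
    by (auto simp: in_keys_iff coef_c split: if_splits)
  have Max_c: "Max (mons c) = A"
    by (rule Max_eqI) (auto simp: mons_c A K_def, simp add: A_def)
  have "admissible i (Suc j) c"
    unfolding admissible_def Max_c
  proof (intro conjI ballI impI)
    show "c \<noteq> 0" using A K_def mons_c by force
  next
    fix a p assume "a \<in> mons c" "p \<in> V" "dead i (Suc j) p"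
    then show "expo a p = expo A p"
      using g by (auto simp: mons_c admissible_def dead_Suc A_def K_def)
  qed (use g in \<open>auto simp: mons_c admissible_def polys_iff A_def\<close>)
  then obtain \<xi> where \<xi>: "feasible i (Suc j) \<xi>" "eval_at \<iota> \<xi> c \<noteq> 0"
    using IH unfolding attainable_def by blast
  have \<xi>w: "\<xi> ?w = 1" using \<xi>(1) wV by (simp add: feasible_def dead_def)
  define \<alpha> where "\<alpha> p = (if Suc i < fst p \<and> Suc j < snd p then \<xi> (fst p, Suc j) * \<xi> (Suc i, snd p) else 0)" for p
  \<comment> \<open>Up to the factor \<open>\<epsilon> ^ K\<close> the value at the bent point is a polynomial in \<open>\<epsilon>\<close>.\<close>
  define P where "P = (\<Sum>a\<in>mons g. [:\<iota> (coef g a):] * [:0, 1:] ^ (K - expo a ?w)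
    * (\<Prod>v\<in>supp a - {?w}. [:\<xi> v, \<alpha> v:] ^ expo a v))"
  have poly_P: "poly P \<epsilon> = (\<Sum>a\<in>mons g. \<iota> (coef g a) * \<epsilon> ^ (K - expo a ?w)
    * (\<Prod>v\<in>supp a - {?w}. (\<xi> v + \<epsilon> * \<alpha> v) ^ expo a v))" for \<epsilon>
    by (simp add: P_def poly_sum poly_prod mult.assoc)
  have split: "mono_eval \<eta> a = \<eta> ?w ^ expo a ?w * (\<Prod>v\<in>supp a - {?w}. \<eta> v ^ expo a v)" for \<eta> :: "pos \<Rightarrow> 'c" and a
  proof (cases "?w \<in> supp a")
    case True
    then show ?thesis unfolding mono_eval_def by (simp add: prod.remove)
  next
    case False
    then show ?thesis unfolding mono_eval_def by (simp add: in_keys_iff)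
  qed
  have "poly P 0 = (\<Sum>a\<in>mons g. if expo a ?w = K then \<iota> (coef g a) * mono_eval \<xi> a else 0)"
    unfolding poly_P by (intro sum.cong refl) (use le in \<open>auto simp: split \<xi>w power_0_left dest!: le\<close>)
  also have "\<dots> = eval_at \<iota> \<xi> c"
    by (simp add: eval_at_def lin_ext_def mons_c coef_c sum.inter_filter)
  finally have "P \<noteq> 0" using \<xi>(2) by auto
  then have "finite {\<epsilon>. poly P \<epsilon> = 0}" by (rule poly_roots_finite)
  then have "finite (insert 0 {\<epsilon>. poly P \<epsilon> = 0})" by simp
  then obtain \<epsilon> where \<epsilon>: "\<epsilon> \<noteq> 0" "poly P \<epsilon> \<noteq> 0"
    using inf by (metis (mono_tags, lifting) UNIV_eq_I insertCI mem_Collect_eq)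
  have "poly P \<epsilon> = \<epsilon> ^ K * eval_at \<iota> (bend i j \<xi> \<epsilon>) g"
    unfolding poly_P eval_at_def lin_ext_def sum_distrib_left
  proof (intro sum.cong refl)
    fix a assume a: "a \<in> mons g"
    have "(\<Prod>v\<in>supp a - {?w}. bend i j \<xi> \<epsilon> v ^ expo a v) = (\<Prod>v\<in>supp a - {?w}. (\<xi> v + \<epsilon> * \<alpha> v) ^ expo a v)"
      by (intro prod.cong refl) (auto simp: bend_def \<alpha>_def)
    moreover have "\<epsilon> ^ (K - expo a ?w) = \<epsilon> ^ K * (1 / \<epsilon>) ^ expo a ?w"
      using le[OF a] \<epsilon>(1) by (simp add: power_diff power_one_over divide_inverse power_inverse)
    moreover have "bend i j \<xi> \<epsilon> ?w = 1 / \<epsilon>" by (simp add: bend_def)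
    ultimately show "\<iota> (coef g a) * \<epsilon> ^ (K - expo a ?w) * (\<Prod>v\<in>supp a - {?w}. (\<xi> v + \<epsilon> * \<alpha> v) ^ expo a v)
      = \<epsilon> ^ K * (\<iota> (coef g a) * mono_eval (bend i j \<xi> \<epsilon>) a)"
      by (simp add: split)
  qed
  then have "eval_at \<iota> (bend i j \<xi> \<epsilon>) g \<noteq> 0" using \<epsilon>(2) by auto
  then show "\<exists>\<xi>. feasible i j \<xi> \<and> eval_at \<iota> \<xi> g \<noteq> 0"
    using feasible_bend[OF \<xi>(1) ij w \<epsilon>(1)] by blast
qed

lemma attainable_step:
  assumes "attainable i (Suc j)" "i < n" "j < m"
  shows "attainable i j"
  using attainable_member[OF assms] attainable_nonmember[OF assms] attainable_outside[OF assms] by blast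

lemma attainable_first: "attainable 0 0"
proof -
  have row: "attainable i (m - j)" if "attainable i m" "i < n" "j \<le> m" for i j
    using that(3)
  proof (induction j)
    case (Suc j)
    then have "attainable i (Suc (m - Suc j))" by (simp add: Suc_diff_Suc)
    then show ?case by (rule attainable_step) (use that Suc in auto)
  qed (use that in simp)
  have "attainable (n - i) 0" if "i \<le> n" for i
    using that
  proof (induction i)
    case (Suc i)
    then have "attainable (Suc (n - Suc i)) 0" by (simp add: Suc_diff_Suc)
    then have "attainable (n - Suc i) m" by (rule attainable_row)
    from row[OF this, of m] Suc show ?case by simp
  qed (simp add: attainable_last)
  from this[of n] show ?thesis by simp
qed

theorem exists_point:
  assumes g: "g \<in> polys V" "g \<noteq> 0" "supp (Max (mons g)) \<subseteq> F"
  obtains \<xi> where "eval_at \<iota> \<xi> g \<noteq> 0" "rank_le (r - 1) {1..n} {1..m} \<xi>"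
    "\<And>p. p \<in> {1..n} \<times> {1..m} - V \<Longrightarrow> \<xi> p = 0"
proof -
  have dead: "\<not> dead 0 0 p" if "p \<in> {1..n} \<times> {1..m}" for p
    using that by (auto simp: dead_def)
  have "admissible 0 0 g"
    using g dead V_sub unfolding admissible_def by blast
  then obtain \<xi> where \<xi>: "feasible 0 0 \<xi>" "eval_at \<iota> \<xi> g \<noteq> 0"
    using attainable_first unfolding attainable_def by blast
  have "rank_le (rk 0 0) {0<..n} {0<..m} \<xi>" using \<xi>(1) by (simp add: feasible_def)
  then have "rank_le (r - 1) {1..n} {1..m} \<xi>"
    by (rule rank_le_mono) (auto simp: rk_def)
  moreover have "\<xi> p = 0" if "p \<in> {1..n} \<times> {1..m} - V" for p
    using \<xi>(1) that dead[of p] unfolding feasible_def by blast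
  ultimately show ?thesis using that \<xi>(2) by blast
qed

end

section \<open>Counting monomials\<close>

lemma growth_exponent_le:
  fixes C D M :: nat
  assumes "\<And>s. 1 \<le> s \<Longrightarrow> s ^ M \<le> C * s ^ D"
  shows "M \<le> D"
proof (rule ccontr)
  assume "\<not> M \<le> D"
  then have "Suc C ^ Suc D \<le> Suc C ^ M" by (intro power_increasing) auto
  also have "\<dots> \<le> C * Suc C ^ D" using assms[of "Suc C"] by simp
  finally show False by simp
qed

definition box :: "pos set \<Rightarrow> nat \<Rightarrow> (pos \<Rightarrow>\<^sub>0 nat) set" where
  "box S s = {a. supp a \<subseteq> S \<and> (\<forall>v. expo a v < s)}"

lemma bij_betw_box:
  assumes "finite S" "1 \<le> s"
  shows "bij_betw (\<lambda>a. restrict (expo a) S) (box S s) (S \<rightarrow>\<^sub>E {..<s})"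
proof (rule bij_betw_byWitness[where f' = "\<lambda>\<phi>. \<Sum>v\<in>S. single v (\<phi> v)"])
  have expo: "expo (\<Sum>v\<in>S. single v (\<phi> v)) w = (if w \<in> S then \<phi> w else 0)" for \<phi> w
    using assms(1) by (simp add: lookup_sum lookup_single when_def)
  show "\<forall>a\<in>box S s. (\<Sum>v\<in>S. single v (restrict (expo a) S v)) = a"
    by (intro ballI poly_mapping_eqI) (auto simp: expo box_def in_keys_iff)
  show "\<forall>\<phi>\<in>S \<rightarrow>\<^sub>E {..<s}. restrict (expo (\<Sum>v\<in>S. single v (\<phi> v))) S = \<phi>"
  proof
    fix \<phi> assume "\<phi> \<in> S \<rightarrow>\<^sub>E {..<s}"
    then show "restrict (expo (\<Sum>v\<in>S. single v (\<phi> v))) S = \<phi>"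
      by (intro ext) (auto simp: expo PiE_iff extensional_def restrict_def)
  qed
  show "(\<lambda>a. restrict (expo a) S) ` box S s \<subseteq> S \<rightarrow>\<^sub>E {..<s}"
    by (auto simp: box_def)
  show "(\<lambda>\<phi>. \<Sum>v\<in>S. single v (\<phi> v)) ` (S \<rightarrow>\<^sub>E {..<s}) \<subseteq> box S s"
    using assms by (auto simp: box_def expo in_keys_iff PiE_iff split: if_splits)
qed

lemma card_box: "finite S \<Longrightarrow> 1 \<le> s \<Longrightarrow> card (box S s) = s ^ card S"
  using bij_betw_same_card[OF bij_betw_box[of S s]] by (simp add: card_PiE)

lemma finite_box: "finite S \<Longrightarrow> 1 \<le> s \<Longrightarrow> finite (box S s)"
  using bij_betw_finite[OF bij_betw_box[of S s]] by (simp add: finite_PiE)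

lemma vector_space_polys: "vector_space (\<lambda>c p. single 0 c * p :: 'k::field poly_pos)"
  by unfold_locales
     (simp_all add: algebra_simps single_add mult_single flip: mult.assoc)

text \<open>All \<open>y i\<close> lie in the span of the monomials of \<open>B\<close>.\<close>

lemma card_le_of_independent:
  fixes y :: "'i \<Rightarrow> 'k::field poly_pos"
  assumes A: "finite A" and B: "finite B" and y: "\<And>i. i \<in> A \<Longrightarrow> mons (y i) \<subseteq> B"
    and indep: "\<And>c i. (\<Sum>i\<in>A. single 0 (c i) * y i) = 0 \<Longrightarrow> i \<in> A \<Longrightarrow> c i = 0"
  shows "card A \<le> card B"
proof -
  interpret vector_space "\<lambda>c p. single 0 c * p :: 'k poly_pos"
    by (rule vector_space_polys)
  have inj: "inj_on y A"
  proof (rule inj_onI, rule ccontr)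
    fix i j assume ij: "i \<in> A" "j \<in> A" "y i = y j" "i \<noteq> j"
    define c :: "'i \<Rightarrow> 'k" where "c = (\<lambda>x. if x = i then 1 else if x = j then - 1 else 0)"
    have "(\<Sum>x\<in>A. single 0 (c x) * y x) = (\<Sum>x\<in>{i, j}. single 0 (c x) * y x)"
      using A ij by (intro sum.mono_neutral_right) (auto simp: c_def)
    also have "\<dots> = 0" using ij by (simp add: c_def single_uminus)
    finally have "c i = 0" using indep ij(1) by blast
    then show False by (simp add: c_def)
  qed
  have "independent (y ` A)"
  proof
    assume "dependent (y ` A)"
    then obtain u v where uv: "v \<in> y ` A" "u v \<noteq> 0" "(\<Sum>v\<in>y ` A. single 0 (u v) * v) = 0"
      using A by (auto simp: dependent_finite)
    then have "(\<Sum>i\<in>A. single 0 (u (y i)) * y i) = 0"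
      by (simp add: sum.reindex[OF inj])
    then show False using indep[of "\<lambda>i. u (y i)"] uv by auto
  qed
  moreover have "y ` A \<subseteq> span ((\<lambda>b. single b 1) ` B)"
  proof
    fix p assume "p \<in> y ` A"
    then have p: "mons p \<subseteq> B" using y by auto
    have "p = (\<Sum>b\<in>mons p. single 0 (coef p b) * single b 1)"
      by (subst poly_eq_sum_singles[of p]) (simp add: mult_single)
    also have "\<dots> \<in> span ((\<lambda>b. single b 1) ` B)"
      using p by (intro span_sum span_scale span_base) auto
    finally show "p \<in> span ((\<lambda>b. single b 1) ` B)" .
  qed
  ultimately have "card (y ` A) \<le> card ((\<lambda>b. single b 1 :: 'k poly_pos) ` B)"
    using independent_span_bound[of "(\<lambda>b. single b 1) ` B" "y ` A"] B by simp
  also have "\<dots> \<le> card B" using B by (rule card_image_le)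
  finally show ?thesis using card_image[OF inj] by simp
qed

definition expo_le :: "nat \<Rightarrow> 'k::zero poly_pos \<Rightarrow> bool" where
  "expo_le D p \<longleftrightarrow> (\<forall>a\<in>mons p. \<forall>v. expo a v \<le> D)"

lemma expo_le_mult:
  fixes p q :: "'k::field poly_pos"
  assumes "expo_le D p" "expo_le E q"
  shows "expo_le (D + E) (p * q)"
  unfolding expo_le_def
proof (intro ballI allI)
  fix c v assume "c \<in> mons (p * q)"
  then obtain a b where "a \<in> mons p" "b \<in> mons q" "c = a + b" using keys_mult[of p q] by blast
  then have "expo a v \<le> D" "expo b v \<le> E" "expo c v = expo a v + expo b v"
    using assms by (simp_all add: expo_le_def lookup_add del: split_paired_All)
  then show "expo c v \<le> D + E" by simp
qed

lemma expo_le_power: "expo_le D p \<Longrightarrow> expo_le (e * D) (p ^ e :: 'k::field poly_pos)"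
proof (induction e)
  case (Suc e)
  then show ?case using expo_le_mult[of D p "e * D" "p ^ e"] by simp
qed (simp add: expo_le_def)

lemma expo_le_mono: "expo_le D p \<Longrightarrow> D \<le> E \<Longrightarrow> expo_le E p"
  by (auto simp: expo_le_def intro: order_trans)

lemma expo_le_exists: "\<exists>D. expo_le D (p :: 'k::field poly_pos)"
proof -
  have "expo a v \<le> Max (insert 0 (\<Union>a\<in>mons p. expo a ` supp a))" if "a \<in> mons p" for a v
    using that by (cases "v \<in> supp a") (auto simp: in_keys_iff intro!: Max_ge)
  then show ?thesis unfolding expo_le_def by blast
qed

section \<open>Chains of primes and independent sets of variables\<close>

text \<open>The variables of \<open>S\<close> are algebraically independent modulo the ideal \<open>J\<close>.\<close>

definition indep_mod :: "'k::field poly_pos set \<Rightarrow> pos set \<Rightarrow> bool" where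
  "indep_mod J S \<longleftrightarrow> (\<forall>p\<in>polys S. p \<in> J \<longrightarrow> p = 0)"

lemma indep_modD: "indep_mod J S \<Longrightarrow> p \<in> polys S \<Longrightarrow> p \<in> J \<Longrightarrow> p = 0"
  by (auto simp: indep_mod_def)

definition list_mon :: "'k::field poly_pos list \<Rightarrow> nat list \<Rightarrow> 'k poly_pos" where
  "list_mon fs es = prod_list (map2 (^) fs es)"

lemma list_mon_simps [simp]:
  "list_mon [] es = 1" "list_mon (f # fs) (e # es) = f ^ e * list_mon fs es"
  by (simp_all add: list_mon_def)

text \<open>Modulo \<open>Q\<close> only the term without \<open>f\<close> survives, so it is zero; what remains is divisible by \<open>f\<close>,
  which can be cancelled modulo the prime \<open>P\<close>.\<close>

lemma power_sum_in_prime: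
  assumes P: "primeideal P (poly_ring V)" and Q: "ideal Q (poly_ring V)" "P \<subseteq> Q"
    and f: "f \<in> Q" "f \<notin> P" and S: "\<And>d. S d \<in> polys V" "\<And>d. S d \<in> Q \<Longrightarrow> S d = 0"
    and mem: "(\<Sum>d<s. f ^ d * S d) \<in> P"
  shows "d < s \<Longrightarrow> S d = 0"
  using S mem
proof (induction s arbitrary: S d)
  case (Suc s)
  have fV: "f \<in> polys V" using f(1) Q(1) by (auto simp: ideal_poly_ring_iff)
  let ?R = "\<Sum>d<s. f ^ d * S (Suc d)"
  have R: "?R \<in> polys V" using fV Suc.prems(2) by (intro polys_sum polys_mult polys_power)
  have eq: "(\<Sum>d<Suc s. f ^ d * S d) = S 0 + f * ?R"
    by (subst sum.lessThan_Suc_shift) (simp add: sum_distrib_left mult.assoc)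
  then have "S 0 + ?R * f \<in> Q" using Suc.prems(4) Q(2) by (auto simp: mult.commute)
  from ideal_diff[OF Q(1) this ideal_mult[OF Q(1) f(1) R]] have "S 0 = 0"
    using Suc.prems(3) by simp
  then have "f * ?R \<in> P" using Suc.prems(4) eq by simp
  then have "?R \<in> P" using P fV R f(2) by (auto simp: primeideal_poly_ring_iff)
  from Suc.IH[OF _ _ _ this] Suc.prems(2,3) have "S (Suc d) = 0" if "d < s" for d using that by blast
  then show ?case using \<open>S 0 = 0\<close> Suc.prems(1) by (cases d) auto
qed simp

abbreviation digits :: "nat \<Rightarrow> nat \<Rightarrow> nat list set" where
  "digits s l \<equiv> {es. set es \<subseteq> {..<s} \<and> length es = l}"

lemma sum_digits_Suc:
  "(\<Sum>es\<in>digits s (Suc l). g es) = (\<Sum>d<s. \<Sum>es\<in>digits s l. g (d # es))"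
proof -
  have "digits s (Suc l) = (\<lambda>(es, d). d # es) ` (digits s l \<times> {..<s})"
    by (rule lists_length_Suc_eq)
  moreover have "inj_on (\<lambda>(es, d). d # es) (digits s l \<times> {..<s})"
    by (auto simp: inj_on_def)
  ultimately have "(\<Sum>es\<in>digits s (Suc l). g es) = (\<Sum>es\<in>digits s l. \<Sum>d<s. g (d # es))"
    by (simp add: sum.reindex sum.cartesian_product case_prod_unfold)
  then show ?thesis by (subst sum.swap)
qed

text \<open>The elements \<open>fs\<close>, one from each successive difference of the chain \<open>P\<close>, satisfy no polynomial
  relation over the polynomials in \<open>S\<close>, not even modulo \<open>P 0\<close>: going up one step in the chain removes
  one of them.\<close>

lemma list_mon_relation:
  assumes "\<And>i. i \<le> length fs \<Longrightarrow> primeideal (P i) (poly_ring V)"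
    and "\<And>i. i < length fs \<Longrightarrow> P i \<subseteq> P (Suc i)"
    and "\<And>i. i < length fs \<Longrightarrow> fs ! i \<in> P (Suc i) \<and> fs ! i \<notin> P i"
    and "indep_mod (P (length fs)) S" "S \<subseteq> V" "\<And>es. h es \<in> polys S"
    and "(\<Sum>es\<in>digits s (length fs). list_mon fs es * h es) \<in> P 0"
    and "es \<in> digits s (length fs)"
  shows "h es = 0"
  using assms
proof (induction fs arbitrary: P h es)
  case Nil
  have "digits s 0 = {[]}" by auto
  then show ?case using Nil.prems(4,6,7,8) by (auto simp: indep_mod_def)
next
  case (Cons f fs)
  let ?S = "\<lambda>d. \<Sum>es\<in>digits s (length fs). list_mon fs es * h (d # es)"
  note IH = Cons.IH[where P = "\<lambda>i. P (Suc i)"]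
  have prime: "primeideal (P i) (poly_ring V)" if "i \<le> Suc (length fs)" for i
    using Cons.prems(1)[of i] that by simp
  have ideal: "ideal (P i) (poly_ring V)" if "i \<le> Suc (length fs)" for i
    using prime[OF that] by (simp add: primeideal_poly_ring_iff)
  have zero: "h (d # es) = 0" if "?S d \<in> P (Suc 0)" "es \<in> digits s (length fs)" for d es
  proof (rule IH[of "\<lambda>es. h (d # es)"])
    show "fs ! i \<in> P (Suc (Suc i)) \<and> fs ! i \<notin> P (Suc i)" if "i < length fs" for i
      using Cons.prems(3)[of "Suc i"] that by simp
  qed (use that Cons.prems(1,2,4,5,6) in auto)
  have fs: "list_mon fs es \<in> polys V" for es
  proof -
    have "fs ! i \<in> polys V" if "i < length fs" for i
      using Cons.prems(3)[of "Suc i"] ideal[of "Suc (Suc i)"] that by (auto simp: ideal_poly_ring_iff)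
    then have "set fs \<subseteq> polys V" by (auto simp: in_set_conv_nth)
    then show ?thesis
    proof (induction fs arbitrary: es)
      case (Cons f fs)
      then show ?case by (cases es) (auto intro!: polys_mult polys_power simp: list_mon_def)
    qed simp
  qed
  have hV: "h es \<in> polys V" for es
    using Cons.prems(5,6) polys_mono by blast
  have mem: "(\<Sum>d<s. f ^ d * ?S d) \<in> P 0"
    using Cons.prems(7) by (simp add: sum_digits_Suc sum_distrib_left mult.assoc)
  have S0: "?S d = 0" if "d < s" for d
  proof (rule power_sum_in_prime[where P = "P 0" and Q = "P (Suc 0)" and V = V and f = f and S = ?S])
    show "(\<Sum>d<s. f ^ d * ?S d) \<in> P 0" by (rule mem)
    show "?S d \<in> polys V" for d by (intro polys_sum polys_mult fs hV)
    show "?S d = 0" if "?S d \<in> P (Suc 0)" for d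
      using zero[OF that] by simp
    show "f \<in> P (Suc 0)" "f \<notin> P 0" using Cons.prems(3)[of 0] by auto
    show "P 0 \<subseteq> P (Suc 0)" using Cons.prems(2)[of 0] by simp
  qed (use prime ideal that in auto)
  obtain d es' where es: "es = d # es'" "d < s" "es' \<in> digits s (length fs)"
    using Cons.prems(8) by (cases es) auto
  have "0 \<in> P (Suc 0)" using ideal[of "Suc 0"] by (simp add: ideal_poly_ring_iff)
  then show ?case using zero[of d es'] S0[OF es(2)] es by simp
qed

text \<open>Elements chosen in the successive differences of a chain of primes, together with variables that
  are independent modulo the top prime, are algebraically independent. If their exponents are below
  \<open>s\<close>, monomials in these \<open>l + card S\<close> elements have exponents below a constant times \<open>s\<close>, so that
  \<open>s ^ (l + card S)\<close> is at most a constant times \<open>s ^ card V\<close>.\<close>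

lemma prime_chain_length_le:
  fixes P :: "nat \<Rightarrow> 'k::field poly_pos set"
  assumes chain: "prime_chain (poly_ring V) l P" and V: "finite V" and S: "S \<subseteq> V" "indep_mod (P l) S"
  shows "l + card S \<le> card V"
proof -
  have prime: "primeideal (P i) (poly_ring V)" if "i \<le> l" for i
    using chain that by (simp add: prime_chain_def)
  have "\<exists>f. f \<in> P (Suc i) \<and> f \<notin> P i" if "i < l" for i
    using chain that unfolding prime_chain_def by blast
  then obtain f where f: "\<And>i. i < l \<Longrightarrow> f i \<in> P (Suc i) \<and> f i \<notin> P i" by metis
  define fs where "fs = map f [0..<l]"
  have len: "length fs = l" by (simp add: fs_def)
  have nth: "fs ! i = f i" if "i < l" for i using that by (simp add: fs_def)
  have finS: "finite S" using S(1) V by (rule finite_subset)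
  have fV: "f i \<in> polys V" if "i < l" for i
    using f[OF that] prime[of "Suc i"] that by (auto simp: primeideal_poly_ring_iff ideal_poly_ring_iff)
  obtain E where E: "\<And>i. i < l \<Longrightarrow> expo_le E (f i)"
  proof -
    define D where "D i = (SOME d. expo_le d (f i))" for i
    have D: "expo_le (D i) (f i)" for i
      unfolding D_def by (rule someI_ex[OF expo_le_exists])
    have "expo_le (Max (insert 0 (D ` {..<l}))) (f i)" if "i < l" for i
      by (rule expo_le_mono[OF D]) (use that in auto)
    then show ?thesis using that by blast
  qed
  have list_mon: "list_mon gs es \<in> polys V \<and> expo_le (length gs * ((s - 1) * E)) (list_mon gs es)"
    if "set gs \<subseteq> f ` {..<l}" "es \<in> digits s (length gs)" for gs es s
    using that
  proof (induction gs arbitrary: es)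
    case (Cons g gs)
    obtain e es' where es: "es = e # es'" "e < s" "es' \<in> digits s (length gs)"
      using Cons.prems(2) by (cases es) auto
    have g: "g \<in> polys V" "expo_le E g" using Cons.prems(1) fV E by auto
    have "expo_le ((s - 1) * E) (g ^ e)"
      by (rule expo_le_mono[OF expo_le_power[OF g(2)]]) (use es(2) in auto)
    moreover have "list_mon gs es' \<in> polys V \<and> expo_le (length gs * ((s - 1) * E)) (list_mon gs es')"
      using Cons es by auto
    ultimately show ?case
      using es(1) g(1) expo_le_mult[of "(s - 1) * E" "g ^ e"] by (auto intro!: polys_mult polys_power)
  qed (simp add: expo_le_def)
  have bound: "s ^ (l + card S) \<le> (l * E + 1) ^ card V * s ^ card V" if s: "1 \<le> s" for s
  proof -
    let ?A = "digits s l \<times> box S s" and ?B = "box V (s * (l * E + 1))"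
    let ?y = "\<lambda>(es, a). list_mon fs es * single a 1"
    have "card ?A \<le> card ?B"
    proof (rule card_le_of_independent[where y = ?y])
      show "finite ?A" using finite_box[OF finS s] finite_lists_length_eq[of "{..<s}" l] by simp
      show "finite ?B" using s by (intro finite_box V) simp
      fix i assume i: "i \<in> ?A"
      then obtain es a where ea: "i = (es, a)" "es \<in> digits s l" "a \<in> box S s" by blast
      have lm: "list_mon fs es \<in> polys V" "expo_le (l * ((s - 1) * E)) (list_mon fs es)"
        using list_mon[of fs es s] ea(2) by (auto simp: len fs_def atLeast0LessThan)
      show "mons (?y i) \<subseteq> ?B"
      proof
        fix c assume "c \<in> mons (?y i)"
        then obtain b where b: "b \<in> mons (list_mon fs es)" "c = b + a"
          using keys_mult[of "list_mon fs es" "single a 1"] ea(1) by auto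
        have "supp b \<subseteq> V" "supp a \<subseteq> V" using lm(1) b(1) ea(3) S(1) by (auto simp: polys_iff box_def)
        moreover have "expo c v < s * (l * E + 1)" for v
        proof -
          have "expo b v \<le> l * ((s - 1) * E)" using lm(2) b(1) by (simp add: expo_le_def del: split_paired_All)
          also have "\<dots> \<le> s * (l * E)" by (simp add: mult.left_commute)
          finally have "expo b v \<le> s * (l * E)" .
          moreover have "expo a v < s" using ea(3) by (simp add: box_def del: split_paired_All)
          ultimately show ?thesis by (simp add: b(2) lookup_add distrib_left)
        qed
        ultimately show "c \<in> ?B" by (simp add: box_def b(2) supp_add)
      qed
    next
      fix c :: "nat list \<times> (pos \<Rightarrow>\<^sub>0 nat) \<Rightarrow> 'k" and i
      assume rel: "(\<Sum>i\<in>?A. single 0 (c i) * ?y i) = 0" and i: "i \<in> ?A"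
      define h where "h es = (\<Sum>a\<in>box S s. single a (c (es, a)))" for es
      have "(\<Sum>i\<in>?A. single 0 (c i) * ?y i)
        = (\<Sum>es\<in>digits s l. \<Sum>a\<in>box S s. single 0 (c (es, a)) * (list_mon fs es * single a 1))"
        by (simp add: sum.cartesian_product case_prod_unfold)
      also have "\<dots> = (\<Sum>es\<in>digits s l. list_mon fs es * h es)"
        unfolding h_def sum_distrib_left
        by (intro sum.cong refl) (simp add: mult.left_commute[of _ "list_mon fs _"] mult_single)
      finally have "(\<Sum>es\<in>digits s (length fs). list_mon fs es * h es) = 0" using rel len by simp
      moreover have "0 \<in> P 0" using prime[of 0] by (simp add: primeideal_poly_ring_iff ideal_poly_ring_iff)
      ultimately have mem: "(\<Sum>es\<in>digits s (length fs). list_mon fs es * h es) \<in> P 0" by simp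
      have h: "h es \<in> polys S" for es
        unfolding h_def by (rule polys_sum) (auto simp: polys_iff box_def)
      have P: "P i \<subseteq> P (Suc i)" if "i < l" for i
        using chain that by (auto simp: prime_chain_def)
      obtain es a where ea: "i = (es, a)" "es \<in> digits s l" "a \<in> box S s" using i by blast
      have "h es = 0"
        by (rule list_mon_relation[where P = P and V = V and fs = fs and S = S and h = h and s = s])
           (use prime P f nth len S h mem ea in auto)
      then have "coef (h es) a = 0" by simp
      then show "c i = 0"
        using ea finite_box[OF finS s] by (simp add: h_def lookup_sum lookup_single when_def)
    qed
    moreover have "card ?A = s ^ (l + card S)"
      using card_lists_length_eq[of "{..<s}" l] card_box[OF finS s]
      by (simp add: card_cartesian_product power_add)
    moreover have "card ?B = (l * E + 1) ^ card V * s ^ card V"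
      using s by (subst card_box[OF V]) (simp, simp only: power_mult_distrib mult.commute)
    ultimately show ?thesis by simp
  qed
  from growth_exponent_le[OF this] show ?thesis .
qed

text \<open>An ideal that is maximal among those that contain \<open>I\<close> and no non-zero polynomial in \<open>S\<close> is prime.\<close>

lemma prime_ideal_avoiding:
  fixes I :: "'k::field poly_pos set"
  assumes I: "ideal I (poly_ring V)" and S: "S \<subseteq> V" "indep_mod I S"
  obtains Q where "primeideal Q (poly_ring V)" "I \<subseteq> Q" "indep_mod Q S"
proof -
  define \<A> where "\<A> = {J. ideal J (poly_ring V) \<and> I \<subseteq> J \<and> indep_mod J S}"
  have "\<exists>M\<in>\<A>. \<forall>X\<in>\<A>. M \<subseteq> X \<longrightarrow> X = M"
  proof (rule subset_Zorn_nonempty)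
    show "\<A> \<noteq> {}" using I S by (auto simp: \<A>_def)
    fix \<C> assume C: "\<C> \<noteq> {}" "subset.chain \<A> \<C>"
    have mem: "J \<in> \<A>" if "J \<in> \<C>" for J using C(2) that by (auto simp: subset.chain_def)
    have "ideal (\<Union>\<C>) (poly_ring V)"
      unfolding ideal_poly_ring_iff
    proof (intro conjI ballI)
      have "J \<subseteq> polys V" if "J \<in> \<C>" for J using mem[OF that] by (simp add: \<A>_def ideal_poly_ring_iff)
      then show "\<Union>\<C> \<subseteq> polys V" by (rule Union_least)
      show "0 \<in> \<Union>\<C>" using C(1) mem by (auto simp: \<A>_def ideal_poly_ring_iff)
    next
      fix p q assume "p \<in> \<Union>\<C>" "q \<in> \<Union>\<C>"
      then obtain J K where JK: "J \<in> \<C>" "K \<in> \<C>" "p \<in> J" "q \<in> K" by blast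
      then have "J \<subseteq> K \<or> K \<subseteq> J" using C(2) by (auto simp: subset.chain_def)
      then obtain L where "L \<in> \<C>" "p \<in> L" "q \<in> L" using JK by blast
      then show "p + q \<in> \<Union>\<C>" using mem[of L] by (auto simp: \<A>_def ideal_poly_ring_iff)
    next
      fix p q :: "'k poly_pos" assume "p \<in> \<Union>\<C>" "q \<in> polys V"
      then obtain J where J: "J \<in> \<C>" "p \<in> J" "q \<in> polys V" by blast
      then have "q * p \<in> J" using mem[OF J(1)] by (intro ideal_mult[where V = V]) (simp_all add: \<A>_def)
      then show "q * p \<in> \<Union>\<C>" using J(1) by blast
    qed
    moreover have "I \<subseteq> \<Union>\<C>" using C(1) mem by (auto simp: \<A>_def)
    moreover have "indep_mod (\<Union>\<C>) S"
      unfolding indep_mod_def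
    proof (intro ballI impI)
      fix p assume p: "p \<in> polys S" "p \<in> \<Union>\<C>"
      then obtain J where "J \<in> \<C>" "p \<in> J" by blast
      then show "p = 0" using mem[of J] p(1) by (auto simp: \<A>_def dest: indep_modD)
    qed
    ultimately show "\<Union>\<C> \<in> \<A>" by (simp add: \<A>_def)
  qed
  then obtain M where MA: "M \<in> \<A>" and M_max: "\<And>X. X \<in> \<A> \<Longrightarrow> M \<subseteq> X \<Longrightarrow> X = M"
    by blast
  have M: "ideal M (poly_ring V)" "I \<subseteq> M" "indep_mod M S"
    using MA by (simp_all add: \<A>_def)
  have max: "J = M" if "ideal J (poly_ring V)" "M \<subseteq> J" "indep_mod J S" for J
    using that M(2) by (intro M_max) (simp_all add: \<A>_def)
  have adjoin: "\<exists>x\<in>polys S. x \<noteq> 0 \<and> (\<exists>y\<in>polys V. x - y * p \<in> M)" if p: "p \<in> polys V" "p \<notin> M" for p :: "'k poly_pos"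
  proof -
    define J where "J = {x \<in> polys V :: 'k poly_pos set. \<exists>y\<in>polys V. x - y * p \<in> M}"
    have MJ: "M \<subseteq> J"
      using M(1) by (auto simp: J_def ideal_poly_ring_iff intro!: bexI[of _ 0])
    have "ideal J (poly_ring V)"
      unfolding ideal_poly_ring_iff
    proof (intro conjI ballI)
      show "0 \<in> J" using MJ M(1) by (auto simp: ideal_poly_ring_iff)
    next
      fix x x' assume "x \<in> J" "x' \<in> J"
      then obtain y y' where "x \<in> polys V" "x' \<in> polys V" "y \<in> polys V" "y' \<in> polys V" "x - y * p \<in> M" "x' - y' * p \<in> M"
        by (auto simp: J_def)
      moreover from this have "(x - y * p) + (x' - y' * p) \<in> M" using M(1) by (auto simp: ideal_poly_ring_iff)
      moreover have "(x - y * p) + (x' - y' * p) = (x + x') - (y + y') * p" by (simp add: algebra_simps)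
      ultimately show "x + x' \<in> J" unfolding J_def by (auto intro!: polys_add bexI[of _ "y + y'"])
    next
      fix x z :: "'k poly_pos" assume "x \<in> J" and z: "z \<in> polys V"
      then obtain y where y: "x \<in> polys V" "y \<in> polys V" "x - y * p \<in> M" by (auto simp: J_def)
      have "z * (x - y * p) \<in> M" by (rule ideal_mult[OF M(1) y(3) z])
      moreover have "z * (x - y * p) = z * x - (z * y) * p" by (simp add: algebra_simps)
      ultimately show "z * x \<in> J" unfolding J_def using y z by (auto intro!: polys_mult bexI[of _ "z * y"])
    qed (simp add: J_def)
    moreover have "p \<in> J"
      using p(1) M(1) by (auto simp: J_def ideal_poly_ring_iff intro!: bexI[of _ 1])
    ultimately have "\<not> indep_mod J S" using max MJ p(2) by blast
    then show ?thesis by (auto simp: indep_mod_def J_def)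
  qed
  have "primeideal M (poly_ring V)"
    unfolding primeideal_poly_ring_iff
  proof (intro conjI ballI impI M(1))
    show "1 \<notin> M" using M(3) by (auto simp: indep_mod_def)
    fix p q :: "'k poly_pos" assume p: "p \<in> polys V" and q: "q \<in> polys V" and pq: "p * q \<in> M"
    show "p \<in> M \<or> q \<in> M"
    proof (rule ccontr)
      assume "\<not> ?thesis"
      then have np: "p \<notin> M" and nq: "q \<notin> M" by auto
      obtain x y where x: "x \<in> polys S" "x \<noteq> 0" "y \<in> polys V" "x - y * p \<in> M" using adjoin[OF p np] by blast
      obtain x' y' where x': "x' \<in> polys S" "x' \<noteq> 0" "y' \<in> polys V" "x' - y' * q \<in> M" using adjoin[OF q nq] by blast
      have V: "x \<in> polys V" "x' \<in> polys V" using x x' S(1) polys_mono by blast+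
      have "x * x' = x' * (x - y * p) + (y * p) * (x' - y' * q) + (y * y') * (p * q)"
        by (simp add: algebra_simps)
      also have "\<dots> \<in> M"
      proof -
        have "x' * (x - y * p) \<in> M" by (rule ideal_mult[OF M(1) x(4) V(2)])
        moreover have "(y * p) * (x' - y' * q) \<in> M" by (rule ideal_mult[OF M(1) x'(4) polys_mult[OF x(3) p]])
        moreover have "(y * y') * (p * q) \<in> M" by (rule ideal_mult[OF M(1) pq polys_mult[OF x(3) x'(3)]])
        ultimately show ?thesis using M(1) by (auto simp: ideal_poly_ring_iff)
      qed
      finally have "x * x' \<in> M" .
      then have "x * x' = 0" using indep_modD[OF M(3) polys_mult[OF x(1) x'(1)]] by blast
      then show False using x x' by simp
    qed
  qed
  then show ?thesis using that M by blast
qed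

section \<open>The height of a prime ideal is at least the codimension\<close>

text \<open>For \<open>F\<close> a maximal set of variables that are independent modulo the prime \<open>Q\<close>, a chain of primes
  below \<open>Q\<close> with \<open>card V - card F\<close> steps is obtained by contracting \<open>Q\<close> to the variables of a growing
  set \<open>W\<close> and extending it back to all variables.\<close>

definition mon_part :: "pos set \<Rightarrow> (pos \<Rightarrow>\<^sub>0 nat) \<Rightarrow> (pos \<Rightarrow>\<^sub>0 nat)" where
  "mon_part W a = (\<Sum>v\<in>supp a \<inter> W. single v (expo a v))"

lemma expo_mon_part: "expo (mon_part W a) v = (if v \<in> W then expo a v else 0)"
  by (auto simp: mon_part_def lookup_sum lookup_single when_def in_keys_iff)

lemma supp_mon_part: "supp (mon_part W a) = supp a \<inter> W"
  by (auto simp: in_keys_iff expo_mon_part split: if_splits)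

lemma mon_part_add: "mon_part W (a + b) = mon_part W a + mon_part W b"
  by (rule poly_mapping_eqI) (simp add: expo_mon_part lookup_add)

lemma mon_part_split: "mon_part (- W) a + mon_part W a = a"
  by (rule poly_mapping_eqI) (simp add: expo_mon_part lookup_add)

lemma mon_part_id:
  assumes "supp a \<subseteq> W"
  shows "mon_part W a = a" "mon_part (- W) a = 0"
proof -
  have "expo a v = 0" if "v \<notin> W" for v
    using assms that by (metis in_keys_iff subsetD)
  then show "mon_part W a = a" "mon_part (- W) a = 0"
    by (auto intro!: poly_mapping_eqI simp: expo_mon_part)
qed

text \<open>A polynomial as a polynomial in the variables outside \<open>W\<close> with coefficients in the
  variables of \<open>W\<close>.\<close>

definition regroup :: "pos set \<Rightarrow> 'k::field poly_pos \<Rightarrow> (pos \<Rightarrow>\<^sub>0 nat) \<Rightarrow>\<^sub>0 'k poly_pos" where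
  "regroup W = lin_ext (\<lambda>a x. single (mon_part (- W) a) (single (mon_part W a) x))"

lemma regroup_add: "regroup W (p + q) = regroup W p + regroup W q"
  unfolding regroup_def by (rule lin_ext_add) (simp_all add: single_add)

lemma regroup_sum: "regroup W (sum f A) = (\<Sum>i\<in>A. regroup W (f i))"
  unfolding regroup_def by (rule lin_ext_sum) (simp_all add: single_add)

lemma regroup_mult: "regroup W (p * q) = regroup W p * regroup W q"
  unfolding regroup_def by (rule lin_ext_mult) (simp_all add: single_add mult_single mon_part_add)

lemma regroup_single:
  "regroup W (single a x) = single (mon_part (- W) a) (single (mon_part W a) x)"
  unfolding regroup_def by (rule lin_ext_single) simp

lemma coef_regroup:
  "coef (regroup W p) c = (\<Sum>a\<in>mons p. if mon_part (- W) a = c then single (mon_part W a) (coef p a) else 0)"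
  unfolding regroup_def lin_ext_def by (simp add: lookup_sum lookup_single when_def)

lemma regroup_coef_in_polys:
  assumes "p \<in> polys V"
  shows "coef (regroup W p) c \<in> polys (V \<inter> W)"
  unfolding coef_regroup
proof (rule polys_sum)
  fix a assume "a \<in> mons p"
  then have "supp (mon_part W a) \<subseteq> V \<inter> W" using assms by (auto simp: supp_mon_part polys_iff)
  then show "(if mon_part (- W) a = c then single (mon_part W a) (coef p a) else 0) \<in> polys (V \<inter> W)"
    by (simp add: polys_iff)
qed

lemma mons_regroup:
  assumes "p \<in> polys V" "c \<in> mons (regroup W p)"
  shows "supp c \<subseteq> V - W"
proof -
  have "(\<Sum>a\<in>mons p. if mon_part (- W) a = c then single (mon_part W a) (coef p a) else 0) \<noteq> 0"
    using assms(2) by (simp add: in_keys_iff coef_regroup)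
  then obtain a where "a \<in> mons p"
      "(if mon_part (- W) a = c then single (mon_part W a) (coef p a) else 0) \<noteq> 0"
    by (rule sum.not_neutral_contains_not_neutral)
  then have "supp a \<subseteq> V" "mon_part (- W) a = c" using assms(1) by (auto simp: polys_iff split: if_splits)
  then show ?thesis using supp_mon_part[of "- W" a] by blast
qed

lemma regroup_polys:
  assumes "p \<in> polys W"
  shows "regroup W p = single 0 p"
proof -
  have "regroup W p = (\<Sum>a\<in>mons p. single 0 (single a (coef p a)))"
    unfolding regroup_def lin_ext_def using assms
    by (intro sum.cong refl) (simp add: polys_iff mon_part_id)
  also have "\<dots> = single 0 (\<Sum>a\<in>mons p. single a (coef p a))"
    by (rule poly_mapping_eqI) (simp add: lookup_sum lookup_single when_def)
  finally show ?thesis by (simp flip: poly_eq_sum_singles)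
qed

lemma regroup_expand:
  "p = (\<Sum>c\<in>mons (regroup W p). single c 1 * coef (regroup W p) c)"
proof -
  define \<Psi> :: "((pos \<Rightarrow>\<^sub>0 nat) \<Rightarrow>\<^sub>0 'a poly_pos) \<Rightarrow> 'a poly_pos"
    where "\<Psi> = lin_ext (\<lambda>c q. single c 1 * q)"
  have "\<Psi> (regroup W p) = (\<Sum>a\<in>mons p. \<Psi> (single (mon_part (- W) a) (single (mon_part W a) (coef p a))))"
    unfolding \<Psi>_def regroup_def lin_ext_def[of "\<lambda>a x. single (mon_part (- W) a) (single (mon_part W a) x)"]
    by (rule lin_ext_sum) (simp_all add: distrib_left)
  also have "\<dots> = (\<Sum>a\<in>mons p. single a (coef p a))"
    by (intro sum.cong refl) (simp add: \<Psi>_def lin_ext_single mult_single mon_part_split)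
  also have "\<dots> = p" by (rule poly_eq_sum_singles[symmetric])
  finally show ?thesis by (simp add: \<Psi>_def lin_ext_def)
qed

lemma regroup_eq_0:
  assumes "regroup W p = 0"
  shows "p = 0"
proof -
  have "p = (\<Sum>c\<in>mons (regroup W p). single c 1 * coef (regroup W p) c)"
    by (rule regroup_expand)
  also have "\<dots> = 0" by (simp add: assms)
  finally show ?thesis .
qed

text \<open>The extension to the full polynomial ring of the contraction of \<open>Q\<close> to the variables of
  \<open>W\<close>.\<close>

definition ext_contraction :: "pos set \<Rightarrow> 'k::field poly_pos set \<Rightarrow> pos set \<Rightarrow> 'k poly_pos set" where
  "ext_contraction V Q W = {p \<in> polys V. \<forall>c. coef (regroup W p) c \<in> Q}"

lemma ext_contraction_ideal:
  assumes Q: "ideal Q (poly_ring V)"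
  shows "ideal (ext_contraction V Q W) (poly_ring V)"
  unfolding ideal_poly_ring_iff
proof (intro conjI ballI)
  show "0 \<in> ext_contraction V Q W"
    using Q by (simp add: ext_contraction_def ideal_poly_ring_iff regroup_def lin_ext_def)
next
  fix p q assume "p \<in> ext_contraction V Q W" "q \<in> ext_contraction V Q W"
  then show "p + q \<in> ext_contraction V Q W"
    using Q by (auto simp: ext_contraction_def ideal_poly_ring_iff regroup_add lookup_add intro: polys_add)
next
  fix p q :: "'a poly_pos" assume p: "p \<in> ext_contraction V Q W" and q: "q \<in> polys V"
  have "coef (regroup W (q * p)) c \<in> Q" for c
    unfolding regroup_mult coef_times
  proof (intro ideal_sum[OF Q])
    fix a b
    have "coef (regroup W q) a \<in> polys V" using regroup_coef_in_polys[OF q] polys_mono by blast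
    moreover have "coef (regroup W p) b \<in> Q" using p by (simp add: ext_contraction_def)
    ultimately have "coef (regroup W q) a * coef (regroup W p) b \<in> Q"
      using ideal_mult[OF Q] by blast
    moreover have "0 \<in> Q" using Q by (simp add: ideal_poly_ring_iff)
    ultimately show "(coef (regroup W q) a * coef (regroup W p) b when a + b = c) \<in> Q"
      by (simp add: when_def)
  qed
  then show "q * p \<in> ext_contraction V Q W"
    using p q by (auto simp: ext_contraction_def intro: polys_mult)
qed (auto simp: ext_contraction_def)

text \<open>Gauss's argument: the product of the last coefficients outside \<open>Q\<close> is again outside \<open>Q\<close>.\<close>

lemma ext_contraction_prime:
  assumes Q: "primeideal Q (poly_ring V)"
  shows "primeideal (ext_contraction V Q W) (poly_ring V)"
  unfolding primeideal_poly_ring_iff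
proof (intro conjI ballI impI)
  have idQ: "ideal Q (poly_ring V)" using Q by (simp add: primeideal_poly_ring_iff)
  then have zQ: "0 \<in> Q" by (simp add: ideal_poly_ring_iff)
  show "ideal (ext_contraction V Q W) (poly_ring V)" by (rule ext_contraction_ideal[OF idQ])
  have "regroup W (1 :: 'a poly_pos) = single 0 1"
    by (rule regroup_polys) simp
  then have "coef (regroup W (1 :: 'a poly_pos)) 0 = 1" by simp
  moreover have "1 \<notin> Q" using Q by (simp add: primeideal_poly_ring_iff)
  ultimately show "1 \<notin> ext_contraction V Q W"
    unfolding ext_contraction_def by (metis (mono_tags, lifting) mem_Collect_eq)
  fix p q :: "'a poly_pos" assume p: "p \<in> polys V" and q: "q \<in> polys V"
    and pq: "p * q \<in> ext_contraction V Q W"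
  show "p \<in> ext_contraction V Q W \<or> q \<in> ext_contraction V Q W"
  proof (rule ccontr)
    assume "\<not> ?thesis"
    then have "p \<notin> ext_contraction V Q W" "q \<notin> ext_contraction V Q W" by simp_all
    then have cc: "\<exists>c. coef (regroup W p) c \<notin> Q" "\<exists>c. coef (regroup W q) c \<notin> Q"
      using p q by (simp_all add: ext_contraction_def)
    define bad where "bad u = {c. coef (regroup W u) c \<notin> Q}" for u
    have fin: "finite (bad u)" for u
    proof (rule finite_subset)
      show "bad u \<subseteq> mons (regroup W u)"
      proof
        fix c assume "c \<in> bad u"
        then have "coef (regroup W u) c \<noteq> 0" using zQ by (metis bad_def mem_Collect_eq)
        then show "c \<in> mons (regroup W u)" by (simp add: in_keys_iff)
      qed
    qed simp
    define A B where "A = Max (bad p)" and "B = Max (bad q)"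
    have "A \<in> bad p" unfolding A_def by (rule Max_in[OF fin]) (use cc(1) in \<open>simp add: bad_def\<close>)
    moreover have "B \<in> bad q" unfolding B_def by (rule Max_in[OF fin]) (use cc(2) in \<open>simp add: bad_def\<close>)
    ultimately have AB: "coef (regroup W p) A \<notin> Q" "coef (regroup W q) B \<notin> Q" by (simp_all add: bad_def)
    have above: "coef (regroup W p) a \<in> Q" if "A < a" for a
    proof (rule ccontr)
      assume "coef (regroup W p) a \<notin> Q"
      then have "a \<le> A" unfolding A_def by (intro Max_ge[OF fin]) (simp add: bad_def)
      then show False using that by simp
    qed
    have above': "coef (regroup W q) b \<in> Q" if "B < b" for b
    proof (rule ccontr)
      assume "coef (regroup W q) b \<notin> Q"
      then have "b \<le> B" unfolding B_def by (intro Max_ge[OF fin]) (simp add: bad_def)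
      then show False using that by simp
    qed
    have V: "coef (regroup W u) a \<in> polys V" if "u \<in> polys V" for u a
      using regroup_coef_in_polys[OF that] polys_mono by blast
    let ?t = "\<lambda>(a, b). coef (regroup W p) a * coef (regroup W q) b when a + b = A + B"
    let ?K = "mons (regroup W p) \<times> mons (regroup W q)"
    have "coef (regroup W (p * q)) (A + B) = sum ?t ?K"
      by (simp add: regroup_mult coef_times sum.cartesian_product)
    also have "\<dots> = ?t (A, B) + sum ?t (?K - {(A, B)})"
      using AB zQ by (intro sum.remove) (auto simp: in_keys_iff)
    finally have eq: "coef (regroup W (p * q)) (A + B)
      = coef (regroup W p) A * coef (regroup W q) B + sum ?t (?K - {(A, B)})" by simp
    have "sum ?t (?K - {(A, B)}) \<in> Q"
    proof (rule ideal_sum[OF idQ])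
      fix x assume x: "x \<in> ?K - {(A, B)}"
      obtain a b where ab: "x = (a, b)" by fastforce
      show "?t x \<in> Q"
      proof (cases "a + b = A + B")
        case True
        have "A < a \<or> B < b"
        proof (rule ccontr)
          assume "\<not> ?thesis"
          then have "a \<le> A" "b \<le> B" by auto
          then show False
            using True x ab add_less_le_mono[of a A b B] add_le_less_mono[of a A b B]
            by (metis DiffD2 add_left_cancel insertI1 order_less_irrefl order_neq_le_trans)
        qed
        then have "coef (regroup W p) a * coef (regroup W q) b \<in> Q"
          using ideal_mult[OF idQ above' V[OF p]] ideal_mult[OF idQ above V[OF q]] by (auto simp: mult.commute)
        then show ?thesis using True ab by simp
      qed (use ab zQ in simp)
    qed
    moreover have "coef (regroup W (p * q)) (A + B) \<in> Q" using pq by (simp add: ext_contraction_def)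
    ultimately have "coef (regroup W (p * q)) (A + B) - sum ?t (?K - {(A, B)}) \<in> Q"
      by (intro ideal_diff[OF idQ])
    then have "coef (regroup W p) A * coef (regroup W q) B \<in> Q" by (simp only: eq add_diff_cancel_right')
    then show False using Q V[OF p] V[OF q] AB unfolding primeideal_poly_ring_iff by blast
  qed
qed

lemma ext_contraction_mono:
  assumes Q: "ideal Q (poly_ring V)" and W: "W \<subseteq> W'"
  shows "ext_contraction V Q W \<subseteq> ext_contraction V Q W'"
proof
  fix p assume p: "p \<in> ext_contraction V Q W"
  then have pV: "p \<in> polys V" unfolding ext_contraction_def by blast
  have zQ: "0 \<in> Q" using Q by (simp add: ideal_poly_ring_iff)
  have "coef (regroup W' p) d \<in> Q" for d
  proof -
    have "regroup W' p = (\<Sum>c\<in>mons (regroup W p). regroup W' (single c 1 * coef (regroup W p) c))"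
      by (subst regroup_expand[of p W]) (rule regroup_sum)
    moreover have "coef (regroup W' (single c 1 * coef (regroup W p) c)) d \<in> Q"
      if c: "c \<in> mons (regroup W p)" for c
    proof -
      have "coef (regroup W p) c \<in> polys W'"
        using regroup_coef_in_polys[OF pV, of W c] W polys_mono[of "V \<inter> W" W'] by blast
      then have "regroup W' (single c 1 * coef (regroup W p) c)
        = single (mon_part (- W') c) (single (mon_part W' c) 1 * coef (regroup W p) c)"
        by (simp add: regroup_mult regroup_single regroup_polys mult_single)
      moreover have "single (mon_part W' c) 1 * coef (regroup W p) c \<in> Q"
      proof (rule ideal_mult[OF Q])
        show "coef (regroup W p) c \<in> Q" using p by (simp add: ext_contraction_def)
        show "single (mon_part W' c) 1 \<in> polys V"
          using mons_regroup[OF pV c] by (auto simp: polys_iff supp_mon_part)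
      qed
      ultimately show ?thesis using zQ by (simp add: lookup_single when_def)
    qed
    ultimately show ?thesis by (simp add: lookup_sum ideal_sum[OF Q])
  qed
  then show "p \<in> ext_contraction V Q W'" using pV by (simp add: ext_contraction_def)
qed

lemma ext_contraction_iff:
  assumes "ideal Q (poly_ring V)" "p \<in> polys W" "p \<in> polys V"
  shows "p \<in> ext_contraction V Q W \<longleftrightarrow> p \<in> Q"
proof -
  have "coef (regroup W p) c = (if c = 0 then p else 0)" for c
    using regroup_polys[OF assms(2)] by (simp add: lookup_single when_def)
  moreover have "0 \<in> Q" using assms(1) by (simp add: ideal_poly_ring_iff)
  ultimately show ?thesis using assms(3) by (simp add: ext_contraction_def)
qed

lemma polys_empty: "p \<in> polys {} \<Longrightarrow> p = single 0 (coef p 0)"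
proof (rule poly_mapping_eqI)
  fix a
  assume p: "p \<in> polys {}"
  have "a = 0" if "a \<in> mons p" using p that by (simp add: polys_iff)
  then show "coef p a = coef (single 0 (coef p 0)) a"
    by (cases "a \<in> mons p") (auto simp: in_keys_iff lookup_single when_def)
qed

lemma indep_mod_empty:
  assumes "primeideal Q (poly_ring V)"
  shows "indep_mod Q {}"
  unfolding indep_mod_def
proof (intro ballI impI, rule ccontr)
  fix p :: "'a poly_pos" assume p: "p \<in> polys {}" "p \<in> Q" "p \<noteq> 0"
  define x where "x = coef p 0"
  have px: "p = single 0 x" using polys_empty[OF p(1)] by (simp add: x_def)
  then have "x \<noteq> 0" using p(3) by auto
  have "ideal Q (poly_ring V)" using assms by (simp add: primeideal_poly_ring_iff)
  from ideal_mult[OF this p(2), of "single 0 (inverse x)"]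
  have "1 \<in> Q" using \<open>x \<noteq> 0\<close> by (simp add: px mult_single polys_iff)
  then show False using assms by (simp add: primeideal_poly_ring_iff)
qed

text \<open>Adding the variables outside a maximal independent set one at a time, the extended
  contractions of \<open>Q\<close> grow strictly: the new variable is algebraic over the independent set.\<close>

lemma prime_chain_below:
  fixes Q :: "'k::field poly_pos set"
  assumes V: "finite V" and Q: "primeideal Q (poly_ring V)"
  obtains S P where "S \<subseteq> V" "indep_mod Q S" "prime_chain (poly_ring V) (card V - card S) P"
    "P (card V - card S) = Q"
proof -
  have idQ: "ideal Q (poly_ring V)" using Q by (simp add: primeideal_poly_ring_iff)
  have "finite {S. S \<subseteq> V \<and> indep_mod Q S}" using V by simp
  moreover have "{} \<in> {S. S \<subseteq> V \<and> indep_mod Q S}" using indep_mod_empty[OF Q] by simp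
  ultimately have "\<exists>S\<in>{S. S \<subseteq> V \<and> indep_mod Q S}. {} \<subseteq> S
      \<and> (\<forall>T\<in>{S. S \<subseteq> V \<and> indep_mod Q S}. S \<subseteq> T \<longrightarrow> S = T)"
    by (rule finite_has_maximal2)
  then obtain S where S: "S \<subseteq> V" "indep_mod Q S"
    and "\<forall>T\<in>{S. S \<subseteq> V \<and> indep_mod Q S}. S \<subseteq> T \<longrightarrow> S = T" by blast
  then have max: "T = S" if "T \<subseteq> V" "indep_mod Q T" "S \<subseteq> T" for T
    using that by blast
  obtain us where us: "set us = V - S" "distinct us"
    using finite_distinct_list[of "V - S"] V by auto
  have len: "length us = card V - card S"
    using distinct_card[OF us(2)] us(1) card_Diff_subset[OF finite_subset[OF S(1) V] S(1)] by simp
  define W where "W i = S \<union> set (take i us)" for i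
  define P where "P i = ext_contraction V Q (W i)" for i
  have "P i \<subset> P (Suc i)" if i: "i < length us" for i
  proof -
    let ?u = "us ! i"
    have uV: "?u \<in> V" "?u \<notin> S" using nth_mem[OF i] us(1) by auto
    have WS: "W (Suc i) = insert ?u (W i)"
      using i by (auto simp: W_def take_Suc_conv_app_nth)
    have uW: "?u \<notin> W i"
      using i us(2) uV by (auto simp: W_def in_set_conv_nth nth_eq_iff_index_eq)
    have "\<not> indep_mod Q (insert ?u S)" using max[of "insert ?u S"] uV S(1) by auto
    then obtain g where g: "g \<in> polys (insert ?u S)" "g \<in> Q" "g \<noteq> 0" by (auto simp: indep_mod_def)
    have gV: "g \<in> polys V" using g(1) uV S(1) polys_mono[of "insert ?u S" V] by blast
    have "insert ?u S \<subseteq> W (Suc i)" unfolding WS by (auto simp: W_def)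
    then have "g \<in> polys (W (Suc i))" using g(1) polys_mono by blast
    then have in1: "g \<in> P (Suc i)" unfolding P_def by (rule ext_contraction_iff[OF idQ _ gV, THEN iffD2]) (rule g(2))
    have "g \<notin> P i"
    proof
      assume "g \<in> P i"
      then have Qc: "coef (regroup (W i) g) c \<in> Q" for c
        unfolding P_def ext_contraction_def by blast
      have "coef (regroup (W i) g) c \<in> polys S" for c
        using regroup_coef_in_polys[OF g(1), of "W i" c] uW polys_mono[of "insert ?u S \<inter> W i" S] by blast
      then have "coef (regroup (W i) g) c = 0" for c using indep_modD[OF S(2)] Qc by blast
      then have "regroup (W i) g = 0" by (intro poly_mapping_eqI) simp
      then show False using regroup_eq_0 g(3) by blast
    qed
    moreover have "P i \<subseteq> P (Suc i)" unfolding P_def WS by (rule ext_contraction_mono[OF idQ]) auto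
    ultimately show ?thesis using in1 by blast
  qed
  moreover have "primeideal (P i) (poly_ring V)" for i
    unfolding P_def by (rule ext_contraction_prime[OF Q])
  ultimately have "prime_chain (poly_ring V) (length us) P" by (simp add: prime_chain_def)
  moreover have "P (length us) = Q"
  proof -
    have "W (length us) = V" using us(1) S(1) by (auto simp: W_def)
    moreover have "Q \<subseteq> polys V" using idQ by (simp add: ideal_poly_ring_iff)
    ultimately show ?thesis
      using ext_contraction_iff[OF idQ, of _ V] by (auto simp: P_def ext_contraction_def)
  qed
  ultimately show ?thesis using that[OF S] len by simp
qed

lemma krull_dim_poly_ring:
  assumes V: "finite V"
  shows "krull_dim (poly_ring V :: 'k::field poly_pos ring) = enat (card V)"
proof (rule antisym)
  show "krull_dim (poly_ring V :: 'k poly_pos ring) \<le> enat (card V)"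
    unfolding krull_dim_def
  proof (rule Sup_least)
    fix x assume "x \<in> {enat l |l. \<exists>P. prime_chain (poly_ring V :: 'k poly_pos ring) l P}"
    then obtain l and P :: "nat \<Rightarrow> 'k poly_pos set" where l: "x = enat l" "prime_chain (poly_ring V) l P" by auto
    have "indep_mod (P l) {}" using l(2) by (intro indep_mod_empty[of _ V]) (simp add: prime_chain_def)
    from prime_chain_length_le[OF l(2) V _ this] show "x \<le> enat (card V)" using l(1) by simp
  qed
next
  define Q :: "'k poly_pos set" where "Q = {p \<in> polys V. coef p 0 = 0}"
  have coef0: "coef (p * q) 0 = coef p 0 * coef q 0" for p q :: "'k poly_pos"
  proof -
    have ab: "a + b = 0 \<longleftrightarrow> a = 0 \<and> b = 0" for a b :: "pos \<Rightarrow>\<^sub>0 nat"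
      by (auto simp: poly_mapping_eq_iff fun_eq_iff lookup_add)
    have "coef (p * q) 0 = (\<Sum>a\<in>mons p. \<Sum>b\<in>mons q. if b = 0 then (if a = 0 then coef p 0 * coef q 0 else 0) else 0)"
      unfolding coef_times ab by (intro sum.cong refl) (simp add: when_def)
    also have "\<dots> = (\<Sum>a\<in>mons p. if a = 0 then (if 0 \<in> mons q then coef p 0 * coef q 0 else 0) else 0)"
      by (intro sum.cong refl) auto
    also have "\<dots> = coef p 0 * coef q 0" by (auto simp: in_keys_iff)
    finally show ?thesis .
  qed
  have Q: "primeideal Q (poly_ring V)"
    unfolding primeideal_poly_ring_iff ideal_poly_ring_iff
    by (auto simp: Q_def coef0 lookup_add lookup_one intro: polys_add polys_mult)
  obtain S P where S: "S \<subseteq> V" "indep_mod Q S" and P: "prime_chain (poly_ring V) (card V - card S) P"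
    "P (card V - card S) = Q"
    by (rule prime_chain_below[OF V Q])
  have "S = {}"
  proof (rule ccontr)
    assume "S \<noteq> {}"
    then obtain v where v: "v \<in> S" by blast
    have "single v (Suc 0) \<noteq> (0 :: pos \<Rightarrow>\<^sub>0 nat)" by (metis lookup_single_eq lookup_zero nat.distinct(1))
    then have "Var v \<in> Q" using v S(1) by (auto simp: Q_def polys_Var Var_def lookup_single when_def polys_iff)
    then have "Var v = (0 :: 'k poly_pos)" using indep_modD[OF S(2) polys_Var[OF v]] by blast
    then show False by (metis Var_def lookup_single_eq lookup_zero zero_neq_one)
  qed
  then show "enat (card V) \<le> krull_dim (poly_ring V :: 'k poly_pos ring)"
    using P unfolding krull_dim_def by (intro Sup_upper) auto
qed

section \<open>Reduction to monomials supported on faces\<close>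

text \<open>A monomial divisible by the diagonal of an \<open>r\<close>-minor is, modulo the minor, a combination of
  smaller monomials of the same degree.\<close>

lemma standard_reduction:
  fixes I :: "'k::field poly_pos set"
  assumes I: "ideal I (poly_ring V)" and V: "finite V"
    and minors: "\<And>xs. chain_in V xs \<Longrightarrow> length xs = r \<Longrightarrow> chain_minor V xs \<in> I"
    and a: "supp a \<subseteq> V"
  shows "\<exists>y. single a 1 - y \<in> I \<and> (\<forall>b\<in>mons y. supp b \<in> chain_free r V \<and> mdeg b = mdeg a)"
proof (rule ccontr)
  define good where "good a \<longleftrightarrow> (\<exists>y. single a 1 - y \<in> I
    \<and> (\<forall>b\<in>mons y. supp b \<in> chain_free r V \<and> mdeg b = mdeg a))" for a
  define Bad where "Bad = {b. supp b \<subseteq> V \<and> mdeg b = mdeg a \<and> \<not> good b}"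
  assume "\<not> ?thesis"
  then have "a \<in> Bad" using a by (simp add: Bad_def good_def)
  have "Bad \<subseteq> box V (Suc (mdeg a))"
  proof
    fix b assume b: "b \<in> Bad"
    have "expo b v \<le> mdeg b" for v
      by (cases "v \<in> supp b") (auto simp: mdeg_def in_keys_iff intro: member_le_sum)
    then have "\<forall>v. expo b v < Suc (mdeg a)" using b by (simp add: Bad_def less_Suc_eq_le del: split_paired_All)
    then show "b \<in> box V (Suc (mdeg a))" using b by (simp add: Bad_def box_def del: split_paired_All)
  qed
  then have fin: "finite Bad" by (rule finite_subset) (simp add: finite_box[OF V])
  \<comment> \<open>The least counterexample; lower monomials of the same degree can already be reduced.\<close>
  define e where "e = Min Bad"
  have "e \<in> Bad" unfolding e_def using fin \<open>a \<in> Bad\<close> by (intro Min_in) auto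
  then have e: "supp e \<subseteq> V" "mdeg e = mdeg a" "\<not> good e" by (simp_all add: Bad_def)
  have lower: "good b" if "supp b \<subseteq> V" "mdeg b = mdeg a" "b < e" for b
  proof (rule ccontr)
    assume "\<not> good b"
    then have "b \<in> Bad" using that by (simp add: Bad_def)
    then show False using Min_le[OF fin] that(3) by (simp add: e_def leD)
  qed
  have zI: "0 \<in> I" using I by (simp add: ideal_poly_ring_iff)
  have "supp e \<notin> chain_free r V"
  proof
    assume "supp e \<in> chain_free r V"
    then have "good e" unfolding good_def using zI by (intro exI[of _ "single e 1"]) simp
    then show False using e(3) by simp
  qed
  then obtain ys where ys: "chain_in (supp e) ys" "r \<le> length ys"
    using e(1) by (auto simp: chain_free_def not_less)
  define xs where "xs = take r ys"
  have xs: "chain_in (supp e) xs" "length xs = r"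
    using ys set_take_subset[of r ys] sorted_wrt_take[of strictly_nw ys r] by (auto simp: chain_in_def xs_def)
  have xsV: "chain_in V xs" by (rule chain_in_mono[OF xs(1) e(1)])
  define \<delta> :: "'k poly_pos" where "\<delta> = chain_minor V xs"
  let ?top = "sqfree_mon (set xs)"
  define c where "c = e - ?top"
  have expo_c: "expo c v + expo ?top v = expo e v" for v
    using xs(1) by (auto simp: c_def lookup_minus expo_sqfree_mon chain_in_def in_keys_iff subset_iff
        simp del: split_paired_All)
  have ec: "e = c + ?top" by (rule poly_mapping_eqI) (simp add: lookup_add expo_c)
  have supp_c: "supp c \<subseteq> V" using e(1) by (simp add: ec supp_add)
  have top: "?top \<in> mons \<delta>" "coef \<delta> ?top = 1"
    using coef_chain_minor_top[OF xsV, where 'k='k] by (simp_all add: \<delta>_def in_keys_iff)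
  have mdeg_top: "mdeg ?top = r"
    using chain_minor_supp(3) top(1) xs(2) unfolding \<delta>_def by blast
  have "good (c + b)" if b: "b \<in> mons \<delta> - {?top}" for b
  proof (rule lower)
    have b': "b \<in> mons \<delta>" using b by blast
    show "supp (c + b) \<subseteq> V" using chain_minor_supp(1) b' supp_c by (auto simp: \<delta>_def supp_add)
    show "mdeg (c + b) = mdeg a"
      using chain_minor_supp(3)[OF b'[unfolded \<delta>_def]] mdeg_top xs(2) e(2) by (simp add: ec mdeg_add)
    have "b \<le> ?top" using chain_minor_mons_le[of xs b V] b' xs(1) by (simp add: \<delta>_def chain_in_def)
    then have "b < ?top" using b by auto
    then show "c + b < e" unfolding ec by (rule add_strict_left_mono)
  qed
  then have "\<forall>b\<in>mons \<delta> - {?top}. \<exists>y. single (c + b) 1 - y \<in> I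
    \<and> (\<forall>b'\<in>mons y. supp b' \<in> chain_free r V \<and> mdeg b' = mdeg (c + b))"
    unfolding good_def by blast
  then obtain y where y: "\<And>b. b \<in> mons \<delta> - {?top} \<Longrightarrow> single (c + b) 1 - y b \<in> I"
    "\<And>b b'. b \<in> mons \<delta> - {?top} \<Longrightarrow> b' \<in> mons (y b) \<Longrightarrow> supp b' \<in> chain_free r V \<and> mdeg b' = mdeg (c + b)"
    by metis
  let ?z = "\<lambda>b. single 0 (coef \<delta> b)"
  define Y where "Y = - (\<Sum>b\<in>mons \<delta> - {?top}. ?z b * y b)"
  have "\<delta> = single ?top 1 + (\<Sum>b\<in>mons \<delta> - {?top}. single b (coef \<delta> b))"
    using top by (subst poly_eq_sum_singles[of \<delta>]) (simp add: sum.remove)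
  then have "single c 1 * \<delta> = single c 1 * (single ?top 1
      + (\<Sum>b\<in>mons \<delta> - {?top}. single b (coef \<delta> b)))" by simp
  also have "\<dots> = single e 1 + (\<Sum>b\<in>mons \<delta> - {?top}. ?z b * single (c + b) 1)"
    by (simp add: distrib_left sum_distrib_left mult_single ec)
  finally have "single e 1 - Y = single c 1 * \<delta>
      - (\<Sum>b\<in>mons \<delta> - {?top}. ?z b * (single (c + b) 1 - y b))"
    by (simp add: Y_def right_diff_distrib sum_subtractf)
  also have "\<dots> \<in> I"
  proof (rule ideal_diff[OF I ideal_mult[OF I] ideal_sum[OF I ideal_mult[OF I]]])
    show "\<delta> \<in> I" unfolding \<delta>_def by (rule minors[OF xsV xs(2)])
  qed (use y(1) supp_c in \<open>auto simp: polys_iff\<close>)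
  finally have "single e 1 - Y \<in> I" .
  moreover have "supp b' \<in> chain_free r V \<and> mdeg b' = mdeg e" if "b' \<in> mons Y" for b'
  proof -
    have "b' \<in> mons (\<Sum>b\<in>mons \<delta> - {?top}. ?z b * y b)" using that by (simp add: Y_def)
    then obtain b where b: "b \<in> mons \<delta> - {?top}" "b' \<in> mons (?z b * y b)"
      using keys_sum[of "\<lambda>b. ?z b * y b" "mons \<delta> - {?top}"] by blast
    then have "b' \<in> mons (y b)" using keys_mult[of "?z b" "y b"] by (auto split: if_splits)
    moreover have "mdeg b = r" using chain_minor_supp(3) b(1) xs(2) unfolding \<delta>_def by blast
    ultimately show ?thesis
      using y(2)[OF b(1)] mdeg_top by (simp add: ec mdeg_add)
  qed
  ultimately have "good e" unfolding good_def by blast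
  then show False using e(3) by simp
qed

text \<open>The \<open>s ^ card S\<close> monomials in \<open>S\<close> with exponents below \<open>s\<close> reduce to independent combinations of
  monomials supported on faces; of the latter there are at most a constant times \<open>s ^ D\<close> of the
  relevant degrees.\<close>

lemma indep_card_le:
  fixes I :: "'k::field poly_pos set"
  assumes I: "ideal I (poly_ring V)" and V: "finite V"
    and minors: "\<And>xs. chain_in V xs \<Longrightarrow> length xs = r \<Longrightarrow> chain_minor V xs \<in> I"
    and S: "S \<subseteq> V" "indep_mod I S" and D: "\<And>G. G \<in> chain_free r V \<Longrightarrow> card G \<le> D"
  shows "card S \<le> D"
proof (rule growth_exponent_le)
  fix s :: nat assume s: "1 \<le> s"
  have finS: "finite S" using S(1) V by (rule finite_subset)
  let ?faces = "chain_free r V" and ?q = "s * card S + 1"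
  have fin: "finite ?faces" by (rule finite_subset[of _ "Pow V"]) (use V in \<open>auto simp: chain_free_def\<close>)
  have finG: "finite G" if "G \<in> ?faces" for G using that V by (auto simp: chain_free_def intro: finite_subset)
  let ?B = "\<Union>G\<in>?faces. box G ?q"
  have "\<forall>a\<in>box S s. \<exists>y. single a 1 - y \<in> I
    \<and> (\<forall>b\<in>mons y. supp b \<in> ?faces \<and> mdeg b = mdeg a)"
  proof
    fix a assume "a \<in> box S s"
    then have "supp a \<subseteq> V" using S(1) unfolding box_def by blast
    then show "\<exists>y. single a 1 - y \<in> I
      \<and> (\<forall>b\<in>mons y. supp b \<in> ?faces \<and> mdeg b = mdeg a)"
      using standard_reduction[OF I V, of r a] minors by blast
  qed
  then obtain y where y: "\<And>a. a \<in> box S s \<Longrightarrow> single a 1 - y a \<in> I"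
    "\<And>a b. a \<in> box S s \<Longrightarrow> b \<in> mons (y a) \<Longrightarrow> supp b \<in> ?faces \<and> mdeg b = mdeg a"
    by metis
  have "card (box S s) \<le> card ?B"
  proof (rule card_le_of_independent[where y = y])
    show "finite (box S s)" by (rule finite_box[OF finS s])
    show "finite ?B" using fin finG by (intro finite_UN_I finite_box) auto
    fix a assume a: "a \<in> box S s"
    show "mons (y a) \<subseteq> ?B"
    proof
      fix b assume b: "b \<in> mons (y a)"
      have "mdeg a = (\<Sum>v\<in>S. expo a v)" using a by (intro mdeg_superset[OF finS]) (simp add: box_def)
      also have "\<dots> \<le> (\<Sum>v\<in>S. s)" using a by (intro sum_mono less_imp_le) (simp add: box_def del: split_paired_All)
      finally have "mdeg b \<le> s * card S" using y(2)[OF a b] by (simp add: mult.commute)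
      moreover have "expo b v \<le> mdeg b" for v
        by (cases "v \<in> supp b") (auto simp: mdeg_def in_keys_iff intro: member_le_sum)
      ultimately have "\<forall>v. expo b v < ?q" by (auto intro: le_imp_less_Suc order_trans simp del: split_paired_All)
      then have "b \<in> box (supp b) ?q" by (simp add: box_def del: split_paired_All)
      then show "b \<in> ?B" using y(2)[OF a b] by blast
    qed
  next
    fix c :: "(pos \<Rightarrow>\<^sub>0 nat) \<Rightarrow> 'k" and a
    assume rel: "(\<Sum>a\<in>box S s. single 0 (c a) * y a) = 0" and a: "a \<in> box S s"
    let ?p = "\<Sum>a\<in>box S s. single a (c a)"
    have "?p = (\<Sum>a\<in>box S s. single 0 (c a) * (single a 1 - y a))"
      using rel by (simp add: right_diff_distrib sum_subtractf mult_single)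
    also have "\<dots> \<in> I"
      by (intro ideal_sum[OF I] ideal_mult[OF I] y(1)) (auto simp: polys_iff)
    finally have "?p \<in> I" .
    moreover have "?p \<in> polys S" by (rule polys_sum) (auto simp: polys_iff box_def)
    ultimately have "?p = 0" using indep_modD[OF S(2)] by blast
    then have "coef ?p a = 0" by simp
    then show "c a = 0" using a finite_box[OF finS s] by (simp add: lookup_sum lookup_single when_def)
  qed
  also have "\<dots> \<le> (\<Sum>G\<in>?faces. card (box G ?q))" by (rule card_UN_le[OF fin])
  also have "\<dots> \<le> (\<Sum>G\<in>?faces. (s * (card S + 1)) ^ D)"
  proof (rule sum_mono)
    fix G assume G: "G \<in> ?faces"
    have "card (box G ?q) = ?q ^ card G" by (rule card_box[OF finG[OF G]]) simp
    also have "\<dots> \<le> ?q ^ D" using D[OF G] by (intro power_increasing) auto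
    also have "\<dots> \<le> (s * (card S + 1)) ^ D" using s by (intro power_mono) auto
    finally show "card (box G ?q) \<le> (s * (card S + 1)) ^ D" .
  qed
  also have "\<dots> = card ?faces * (card S + 1) ^ D * s ^ D"
    by (simp only: sum_constant power_mult_distrib of_nat_id mult.assoc mult.commute[of "s ^ D"])
  finally show "s ^ card S \<le> card ?faces * (card S + 1) ^ D * s ^ D"
    by (simp only: card_box[OF finS s])
qed

section \<open>Determinantal ideals of matrices with zeros in two corners\<close>

lemma det_in_polys:
  fixes A :: "'k::field poly_pos mat"
  assumes A: "A \<in> carrier_mat q q" and entries: "\<And>i j. i < q \<Longrightarrow> j < q \<Longrightarrow> A $$ (i, j) \<in> polys V"
  shows "det A \<in> polys V"
  unfolding det_def'[OF A]
proof (intro polys_sum polys_mult polys_prod)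
  fix p i assume "p \<in> {p. p permutes {0..<q}}" "i \<in> {0..<q}"
  then show "A $$ (i, p i) \<in> polys V" using permutes_in_image[of p "{0..<q}" i] by (intro entries) auto
qed (auto simp: sign_def intro: polys_uminus)

locale corner_matrix =
  fixes n m r :: nat and V :: "pos set" and X :: "'k::field poly_pos mat" and I :: "'k poly_pos set"
  assumes shape: "corner_shape n m V" and r: "1 \<le> r"
    and X: "X = mat n m (\<lambda>(i, j). entry V (Suc i, Suc j))"
    and I: "I = determinantal_ideal (poly_ring V) r X"
begin

lemma V_sub: "V \<subseteq> {1..n} \<times> {1..m}"
  using shape by (simp add: corner_shape_def)

lemma finV: "finite V"
  using V_sub by (rule finite_subset) simp

lemma minors_sub: "minors r X \<subseteq> polys V"
proof
  fix p assume "p \<in> minors r X"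
  then obtain K J where KJ: "p = det (submatrix X K J)" "K \<subseteq> {..<n}" "J \<subseteq> {..<m}" "card K = r" "card J = r"
    by (auto simp: minors_def X)
  show "p \<in> polys V"
    unfolding KJ(1) X submatrix_pick(1)[OF KJ(2-5)]
    by (rule det_in_polys[of _ r]) (auto simp: entry_def polys_Var)
qed

lemma ideal_I: "ideal I (poly_ring V)"
proof -
  interpret R: cring "poly_ring V :: 'k poly_pos ring" by (rule poly_ring_cring)
  show ?thesis unfolding I determinantal_ideal_def using minors_sub by (intro R.genideal_ideal) simp
qed

lemma I_sub: "I \<subseteq> polys V"
  using ideal_I by (simp add: ideal_poly_ring_iff)

lemma minors_in_I: "minors r X \<subseteq> I"
proof -
  interpret R: cring "poly_ring V :: 'k poly_pos ring" by (rule poly_ring_cring)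
  show ?thesis unfolding I determinantal_ideal_def using minors_sub by (intro R.genideal_self) simp
qed

lemma chain_minor_in_I: "chain_in V xs \<Longrightarrow> length xs = r \<Longrightarrow> chain_minor V xs \<in> I"
  using chain_minor_in_minors[OF X V_sub] minors_in_I by blast

lemma vanishing_at_small_rank:
  fixes \<iota> :: "'k \<Rightarrow> 'c::field"
  assumes hom: "comm_ring_hom \<iota>" and rank: "rank_le (r - 1) {1..n} {1..m} \<xi>"
    and zero: "\<And>p. p \<in> {1..n} \<times> {1..m} - V \<Longrightarrow> \<xi> p = 0" and f: "f \<in> I"
  shows "eval_at \<iota> \<xi> f = 0"
proof -
  interpret R: cring "poly_ring V :: 'k poly_pos ring" by (rule poly_ring_cring)
  interpret ev: comm_ring_hom "eval_at \<iota> \<xi>" by (rule eval_at_hom[OF hom])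
  define Z where "Z = {p \<in> polys V. eval_at \<iota> \<xi> p = 0}"
  have "ideal Z (poly_ring V)"
    unfolding ideal_poly_ring_iff by (auto simp: Z_def ev.hom_add ev.hom_mult intro: polys_add polys_mult)
  moreover have "minors r X \<subseteq> Z"
  proof
    fix p assume p: "p \<in> minors r X"
    then obtain K J where KJ: "p = det (submatrix X K J)" "K \<subseteq> {..<n}" "J \<subseteq> {..<m}" "card K = r" "card J = r"
      by (auto simp: minors_def X)
    note sub = submatrix_pick[OF KJ(2-5)]
    let ?B = "mat r r (\<lambda>(k, l). \<xi> (Suc (pick K k), Suc (pick J l)))"
    have "eval_at \<iota> \<xi> p = det (map_mat (eval_at \<iota> \<xi>) (submatrix X K J))"
      unfolding KJ(1) by (simp only: ev.hom_det)
    also have "map_mat (eval_at \<iota> \<xi>) (submatrix X K J)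
      = ?B"
    proof (rule eq_matI)
      fix k l assume "k < dim_row ?B"
        "l < dim_col ?B"
      then have kl: "k < r" "l < r" by simp_all
      let ?p = "(Suc (pick K k), Suc (pick J l))"
      have "eval_at \<iota> \<xi> (entry V ?p) = \<xi> ?p"
      proof (cases "?p \<in> V")
        case False
        then have "\<xi> ?p = 0" using sub(2)[OF kl(1)] sub(3)[OF kl(2)] by (intro zero) auto
        then show ?thesis using False by (simp add: entry_def)
      qed (simp add: entry_def eval_at_Var[OF hom])
      then show "map_mat (eval_at \<iota> \<xi>) (submatrix X K J) $$ (k, l)
        = ?B $$ (k, l)"
        using kl by (simp add: X sub(1))
    qed (simp_all add: X sub(1))
    also have "det \<dots> = 0"
      by (rule rank_le_minor_zero[OF rank, where x = "\<lambda>k. Suc (pick K k)" and y = "\<lambda>l. Suc (pick J l)"])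
         (use r sub(2,3) in \<open>auto simp: Suc_le_eq\<close>)
    finally show "p \<in> Z" using p minors_sub by (auto simp: Z_def)
  qed
  ultimately have "I \<subseteq> Z" unfolding I determinantal_ideal_def by (rule R.genideal_minimal)
  then show ?thesis using f by (auto simp: Z_def)
qed

text \<open>Points over the fraction field of \<open>k[x]\<close> are used because it is infinite.\<close>

lemma leading_monomial_not_on_face:
  assumes F: "F \<in> chain_free r V" and f: "f \<in> I" "f \<noteq> 0"
  shows "\<not> supp (Max (mons f)) \<subseteq> F"
proof
  assume sub: "supp (Max (mons f)) \<subseteq> F"
  obtain G where G: "G \<in> facets (chain_free r V)" "F \<subseteq> G" by (rule face_in_facet[OF finV F])
  define \<iota> :: "'k \<Rightarrow> 'k poly fract" where "\<iota> x = Fract [:x:] 1" for x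
  have hom: "comm_ring_hom \<iota>"
    by unfold_locales (simp_all add: \<iota>_def Zero_fract_def One_fract_def one_pCons mult.commute)
  have "inj (\<lambda>k. Fract (monom 1 k) 1 :: 'k poly fract)"
  proof (rule injI)
    fix k l assume "Fract (monom 1 k) 1 = (Fract (monom 1 l) 1 :: 'k poly fract)"
    then have "monom 1 k = (monom 1 l :: 'k poly)" by (simp add: eq_fract)
    then have "degree (monom 1 k :: 'k poly) = degree (monom 1 l :: 'k poly)" by simp
    then show "k = l" by (simp add: degree_monom_eq)
  qed
  then have "infinite (range (\<lambda>k. Fract (monom 1 k) 1 :: 'k poly fract))" by (rule range_inj_infinite)
  then have inf: "infinite (UNIV :: 'k poly fract set)" using finite_subset subset_UNIV by blast
  interpret facet_point n m r V G \<iota>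
    by (rule facet_point.intro[OF shape G(1) hom inf])
  have "f \<in> polys V" using f(1) I_sub by blast
  moreover have "supp (Max (mons f)) \<subseteq> G" using sub G(2) by blast
  ultimately obtain \<xi> where "eval_at \<iota> \<xi> f \<noteq> 0" "rank_le (r - 1) {1..n} {1..m} \<xi>"
    "\<And>p. p \<in> {1..n} \<times> {1..m} - V \<Longrightarrow> \<xi> p = 0"
    using exists_point f(2) by blast
  then show False using vanishing_at_small_rank[OF hom] f(1) by blast
qed

text \<open>Diagonals of minors are leading monomials of members of \<open>I\<close>, so a face contains no
  chain of length \<open>r\<close>; conversely, no leading monomial of a member of \<open>I\<close> is supported on a set
  without such chains.\<close>

theorem stanley_reisner_eq: "stanley_reisner V I = chain_free r V"
proof (intro equalityI subsetI)
  fix F assume F: "F \<in> stanley_reisner V I"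
  then have FV: "F \<subseteq> V" and notin: "(\<Prod>v\<in>F. Var v) \<notin> initial_ideal (poly_ring V) I"
    by (auto simp: stanley_reisner_def)
  have finF: "finite F" using FV finV by (rule finite_subset)
  have "length ys < r" if ys: "chain_in F ys" for ys
  proof (rule ccontr)
    assume "\<not> length ys < r"
    define xs where "xs = take r ys"
    have xs: "chain_in F xs" "length xs = r"
      using ys set_take_subset[of r ys] sorted_wrt_take[of strictly_nw ys r] \<open>\<not> length ys < r\<close>
      by (auto simp: chain_in_def xs_def)
    have xsV: "chain_in V xs" by (rule chain_in_mono[OF xs(1) FV])
    have "sqfree_mon F = sqfree_mon (set xs) + sqfree_mon (F - set xs)"
      using xs(1) finF by (intro poly_mapping_eqI) (auto simp: lookup_add expo_sqfree_mon chain_in_def)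
    moreover have "single (Max (mons (chain_minor V xs :: 'k poly_pos)) + sqfree_mon (F - set xs)) 1
      \<in> initial_ideal (poly_ring V) I"
      by (rule initial_ideal_multiple[OF I_sub chain_minor_in_I[OF xsV xs(2)] Max_mons_chain_minor(2)[OF xsV]])
         (use FV finF in auto)
    ultimately show False
      using notin by (simp add: prod_Var[OF finF] Max_mons_chain_minor(1)[OF xsV])
  qed
  then show "F \<in> chain_free r V" using FV by (simp add: chain_free_def)
next
  fix F assume F: "F \<in> chain_free r V"
  then have FV: "F \<subseteq> V" by (simp add: chain_free_def)
  have finF: "finite F" using FV finV by (rule finite_subset)
  have "single (sqfree_mon F) 1 \<notin> initial_ideal (poly_ring V) I"
  proof
    assume "single (sqfree_mon F) 1 \<in> initial_ideal (poly_ring V) I"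
    then obtain f b where f: "f \<in> I" "f \<noteq> 0" "sqfree_mon F = Max (mons f) + b"
      using initial_ideal_divisor[OF I_sub] by blast
    have "supp (Max (mons f)) \<subseteq> supp (sqfree_mon F)" by (simp only: f(3) supp_add) blast
    then show False using leading_monomial_not_on_face[OF F f(1,2)] finF by simp
  qed
  then show "F \<in> stanley_reisner V I" using FV by (simp add: stanley_reisner_def prod_Var[OF finF])
qed

lemma empty_face: "{} \<in> chain_free r V"
  using r by (auto simp: chain_free_def chain_in_def)

text \<open>A facet \<open>F\<close> is independent modulo \<open>I\<close>, hence modulo some prime over \<open>I\<close>, and this bounds the height
  of that prime from above. Conversely, a set that is independent modulo any prime over \<open>I\<close> has at most
  the size of a facet, so that below this prime there is a chain of length at least \<open>h\<close>.\<close>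

theorem height_determinantal:
  assumes card: "\<And>F. F \<in> facets (chain_free r V) \<Longrightarrow> card F = card V - h" and h: "h \<le> card V"
  shows "height (poly_ring V) I = enat h"
proof (rule antisym)
  obtain F where F: "F \<in> facets (chain_free r V)" by (rule face_in_facet[OF finV empty_face])
  have FV: "F \<subseteq> V" by (rule facets_chain_free(2)[OF F])
  have finF: "finite F" using FV finV by (rule finite_subset)
  have "indep_mod I F"
    unfolding indep_mod_def
  proof (intro ballI impI, rule ccontr)
    fix f assume f: "f \<in> polys F" "f \<in> I" "f \<noteq> 0"
    then have "supp (Max (mons f)) \<subseteq> F" by (auto simp: polys_iff simp del: split_paired_All intro!: bspec[of "mons f"] Max_in)
    then show False using leading_monomial_not_on_face[OF facets_chain_free(1)[OF F] f(2,3)] by blast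
  qed
  then obtain Q where Q: "primeideal Q (poly_ring V)" "I \<subseteq> Q" "indep_mod Q F"
    using prime_ideal_avoiding[OF ideal_I FV] by blast
  have "prime_height (poly_ring V) Q \<le> enat h"
    unfolding prime_height_def
  proof (rule Sup_least)
    fix x assume "x \<in> {enat l |l. \<exists>P. prime_chain (poly_ring V) l P \<and> P l = Q}"
    then obtain l P where l: "x = enat l" "prime_chain (poly_ring V) l P" "P l = Q" by blast
    have "l + card F \<le> card V"
      by (rule prime_chain_length_le[OF l(2) finV FV]) (use l(3) Q(3) in simp)
    then show "x \<le> enat h" using card[OF F] h l(1) by simp
  qed
  moreover have "height (poly_ring V) I \<le> prime_height (poly_ring V) Q"
    unfolding height_def using Q by (intro Inf_lower) blast
  ultimately show "height (poly_ring V) I \<le> enat h" by (rule order_trans[rotated])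
next
  have D: "card G \<le> card V - h" if "G \<in> chain_free r V" for G
  proof -
    obtain F where F: "F \<in> facets (chain_free r V)" "G \<subseteq> F" by (rule face_in_facet[OF finV \<open>G \<in> _\<close>])
    then show ?thesis
      using card_mono[OF finite_subset[OF facets_chain_free(2)[OF F(1)] finV] F(2)] card[OF F(1)] by simp
  qed
  show "enat h \<le> height (poly_ring V) I"
    unfolding height_def
  proof (rule Inf_greatest)
    fix x assume "x \<in> {prime_height (poly_ring V) Q |Q. primeideal Q (poly_ring V) \<and> I \<subseteq> Q}"
    then obtain Q where Q: "x = prime_height (poly_ring V) Q" "primeideal Q (poly_ring V)" "I \<subseteq> Q" by blast
    obtain S P where S: "S \<subseteq> V" "indep_mod Q S"
      and P: "prime_chain (poly_ring V) (card V - card S) P" "P (card V - card S) = Q"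
      by (rule prime_chain_below[OF finV Q(2)])
    have "indep_mod I S" using S(2) Q(3) by (auto simp: indep_mod_def)
    from indep_card_le[OF ideal_I finV chain_minor_in_I S(1) this D]
    have "card S \<le> card V - h" by simp
    then have "enat h \<le> enat (card V - card S)" using h by simp
    also have "\<dots> \<le> x" unfolding Q(1) prime_height_def using P by (intro Sup_upper) blast
    finally show "enat h \<le> x" .
  qed
qed

end

lemma triangular_shape_corner: "corner_shape n m (triangular_shape n m t1 t2)"
  by (auto simp: corner_shape_def triangular_shape_def)

lemma gd_entries_triangular:
  assumes gd: "gd_ladders n m s c t d" and tri: "triangle1 t1 s c" "triangle2 t2 m t d"
  shows "gd_entries n m s c t d = triangular_shape n m t1 t2"
  unfolding gd_entries_def ladder1_triangle[OF gd tri(1)] ladder2_triangle[OF gd tri(2)] triangular_shape_def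
  by auto

lemma triangle_sizes:
  assumes gd: "gd_ladders n m s c t d" and tri: "triangle1 t1 s c" "triangle2 t2 m t d" and n: "0 < n"
  shows "t1 < n" "t1 < m" "t2 < n" "t2 < m"
proof -
  show "t1 < m" "t2 < m" using gd tri by (auto simp: gd_ladders_def triangle1_def triangle2_def)
  show "t1 < n"
    using gd tri(1) n by (cases "t1 = 0") (auto simp: gd_ladders_def triangle1_def)
  show "t2 < n"
  proof (cases "t2 = 0")
    case False
    then have "d m = t2" using tri(2) \<open>t2 < m\<close> unfolding triangle2_def by (metis atLeastAtMost_iff less_one less_or_eq_imp_le not_less le_add_diff_inverse2)
    then show ?thesis using gd tri(2) False by (auto simp: gd_ladders_def triangle2_def)
  qed (use n in simp)
qed

theorem theorem4p5:
  fixes X :: "'k::field poly_pos mat"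
    and R :: "'k poly_pos ring"
    and I :: "'k poly_pos set"
    and \<Delta> :: "pos set set"
    and n m r s t t1 t2 :: nat
    and c d :: "nat \<Rightarrow> nat"
  assumes "gd_ladders n m s c t d"
    and "triangle1 t1 s c"
    and "triangle2 t2 m t d"
    and "1 \<le> r" and "r \<le> min n m"
    and "X = generic_gd_matrix n m s c t d"
    and "R = poly_ring (gd_entries n m s c t d)"
    and "I = determinantal_ideal R r X"
    and "\<Delta> = stanley_reisner (gd_entries n m s c t d) I"
  shows "pure_complex \<Delta>
    \<and> (\<exists>dimR. krull_dim R = enat dimR
        \<and> complex_dim \<Delta> = int dimR - EN n m r + ENS t1 r + ENS t2 r - 1)
    \<and> (\<exists>h. height R I = enat h
        \<and> int h = EN n m r - ENS t1 r - ENS t2 r)"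
proof -
  define V where "V = gd_entries n m s c t d"
  have V: "V = triangular_shape n m t1 t2"
    unfolding V_def by (rule gd_entries_triangular[OF assms(1-3)])
  interpret corner_matrix n m r V X I
  proof
    show "corner_shape n m V" unfolding V by (rule triangular_shape_corner)
    show "X = mat n m (\<lambda>(i, j). entry V (Suc i, Suc j))"
      unfolding assms(6) generic_gd_matrix_def V_def entry_def by (rule eq_matI) simp_all
    show "I = determinantal_ideal (poly_ring V) r X" using assms(7,8) by (simp add: V_def)
  qed (rule assms(4))
  let ?T = "{v\<in>V. r \<le> fst v \<and> r \<le> snd v}"
  have sizes: "t1 < n" "t1 < m" "t2 < n" "t2 < m"
    using triangle_sizes[OF assms(1-3)] assms(4,5) by auto
  have h: "int (card ?T) = EN n m r - ENS t1 r - ENS t2 r"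
    unfolding V by (rule card_far_corner[OF sizes]) (use assms(4,5) in auto)
  have T_le: "card ?T \<le> card V" by (rule card_mono[OF finV]) auto
  have facet_card: "card F = card V - card ?T" if F: "F \<in> facets (chain_free r V)" for F
  proof -
    have "card (V - F) = card ?T"
      by (rule facet_card_complement[OF F r, where n = n and m = m
            and D = "{\<delta>. \<delta> < int n - int t1 \<and> - \<delta> < int m - int t2}"])
         (auto simp: V triangular_shape_def)
    moreover have "F \<subseteq> V" by (rule facets_chain_free(2)[OF F])
    ultimately show ?thesis
      using card_Diff_subset[OF finite_subset[OF _ finV], of F V] card_mono[OF finV, of F] by simp
  qed
  have \<Delta>: "\<Delta> = chain_free r V" using stanley_reisner_eq assms(9) by (simp add: V_def)
  obtain F where F: "F \<in> facets (chain_free r V)" by (rule face_in_facet[OF finV empty_face])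
  have fin: "finite (chain_free r V)"
    by (rule finite_subset[of _ "Pow V"]) (use finV in \<open>auto simp: chain_free_def\<close>)
  have "Max (card ` chain_free r V) = card V - card ?T"
  proof (rule Max_eqI)
    fix k assume "k \<in> card ` chain_free r V"
    then obtain G where G: "G \<in> chain_free r V" "k = card G" by blast
    obtain H where H: "H \<in> facets (chain_free r V)" "G \<subseteq> H" by (rule face_in_facet[OF finV G(1)])
    have "finite H" by (rule finite_subset[OF facets_chain_free(2)[OF H(1)] finV])
    from card_mono[OF this H(2)] show "k \<le> card V - card ?T" using facet_card[OF H(1)] G(2) by simp
  next
    show "card V - card ?T \<in> card ` chain_free r V"
      using facet_card[OF F] facets_chain_free(1)[OF F] by (metis imageI)
  qed (use fin in simp)
  then have dim: "complex_dim \<Delta> = int (card V) - EN n m r + ENS t1 r + ENS t2 r - 1"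
    using h T_le by (simp add: complex_dim_def \<Delta> of_nat_diff)
  have "pure_complex \<Delta>"
    unfolding pure_complex_def \<Delta> face_dim_def using facet_card by simp
  moreover have "krull_dim R = enat (card V)"
    unfolding assms(7) V_def[symmetric] by (rule krull_dim_poly_ring[OF finV])
  moreover have "height R I = enat (card ?T)"
    unfolding assms(7) V_def[symmetric] by (rule height_determinantal[OF facet_card T_le])
  ultimately show ?thesis using dim h by blast
qed

end
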